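(* Suppose that Assumption 1 and Assumption 2 hold (with functions $b$ and $a$), or that Assumption 1 and Assumption 2' hold (with functions $b$ and $a$). Suppose moreover that $\int \mathrm{d}|\mu|(y)\, e^{a(y)+2b(y)} < \infty$. Then \[ Z = \exp\Bigl\{ \sum_{n\geq1} \int\mathrm{d}\mu(x_1) \cdots \int\mathrm{d}\mu(x_n) \, \varphi(x_1,\dots,x_n) \Bigr\}, \] where the series in the exponential converges absolutely, i.e. $\sum_{n\ge1}\int\mathrm{d}|\mu|(x_1)\cdots\int\mathrm{d}|\mu|(x_n)\,|\varphi(x_1,\dots,x_n)|<\infty$. Furthermore, for $|\mu|$-almost all $x_1 \in \mathbb{X}$, \[ \sum_{n\geq2} n \int\mathrm{d}|\mu|(x_2) \cdots \int\mathrm{d}|\mu|(x_n) \, |\varphi(x_1,\dots,x_n)| \leq \bigl(e^{a(x_1)}-1\bigr) e^{2b(x_1)} \] under Assumptions 1 and 2, and the same bound with $e^{b(x_1)}$ in place of $e^{2b(x_1)}$ under Assumptions 1 and 2'.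
   Context: Let $(\mathbb{X},\mathcal{X},\mu)$ be a measure space with $\mu$ a complex measure, and $|\mu|$ its total variation. Let $u,\zeta$ be complex measurable symmetric functions on $\mathbb{X}\times\mathbb{X}$ with $\zeta(x,y)=e^{-u(x,y)}-1$; the real part of $u$ may take the value $+\infty$, in which case $\zeta(x,y)=-1$. Define \[ Z=\sum_{n\ge0}\frac1{n!}\int\mathrm{d}\mu(x_1)\cdots\int\mathrm{d}\mu(x_n)\prod_{1\le i<j\le n}\bigl(1+\zeta(x_i,x_j)\bigr), \] the $n=0$ term being $1$. Let $\overline u(x,y)=u(x,y)$ if $\mathrm{Re}\,u(x,y)\ne\infty$ and $\overline u(x,y)=1$ if $\mathrm{Re}\,u(x,y)=\infty$. Assumption 1 (stability): there is a nonnegative function $b$ on $\mathbb{X}$ such that for all $n$ and $\otimes^n\mu$-almost all $x_1,\dots,x_n$: $\prod_{1\le i<j\le n}|1+\zeta(x_i,x_j)|\le\prod_{i=1}^n e^{b(x_i)}$. Assumption 2: there is a nonnegative function $a$ on $\mathbb{X}$ such that for almost all $x$: $\int\mathrm{d}|\mu|(y)\,|\zeta(x,y)|\,e^{a(y)+2b(y)}\le a(x)$. Assumption 2': there is a nonnegative function $a$ on $\mathbb{X}$ such that for almost all $x$: $\int\mathrm{d}|\mu|(y)\,|\overline u(x,y)|\,e^{a(y)+b(y)}\le a(x)$. Let $\mathcal{C}_n$ be the set of connected graphs (unoriented, no loops) on vertex set $\{1,\dots,n\}$. Define $\varphi(x_1)=1$ and, for $n\ge2$, $\varphi(x_1,\dots,x_n)=\frac1{n!}\sum_{G\in\mathcal{C}_n}\prod_{\{i,j\}\in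 G}\zeta(x_i,x_j)$ (product over edges of $G$). *)

theory Defs
  imports "HOL-Analysis.Analysis"
begin

text \<open>The complex measure mu is represented by its total variation M = |mu| (a positive
measure) together with a measurable density h with norm (h x) = 1, i.e. d mu = h d|mu|
(polar decomposition).  The potential u is represented by a complex function u together
with a predicate hc marking the points where Re u = +infinity.\<close>

definition zeta :: "('a \<Rightarrow> 'a \<Rightarrow> complex) \<Rightarrow> ('a \<Rightarrow> 'a \<Rightarrow> bool) \<Rightarrow> 'a \<Rightarrow> 'a \<Rightarrow> complex" where
  "zeta u hc x y = (if hc x y then -1 else exp (- u x y) - 1)"

definition ubar :: "('a \<Rightarrow> 'a \<Rightarrow> complex) \<Rightarrow> ('a \<Rightarrow> 'a \<Rightarrow> bool) \<Rightarrow> 'a \<Rightarrow> 'a \<Rightarrow> complex" where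
  "ubar u hc x y = (if hc x y then 1 else u x y)"

text \<open>Edges of simple graphs on the vertex set {1..n}.\<close>
definition graph_edges :: "nat \<Rightarrow> nat set set" where
  "graph_edges n = {e. \<exists>i j. i \<in> {1..n} \<and> j \<in> {1..n} \<and> i \<noteq> j \<and> e = {i, j}}"

definition connected_graphs :: "nat \<Rightarrow> nat set set set" where
  "connected_graphs n = {G. G \<subseteq> graph_edges n \<and>
     (\<forall>i\<in>{1..n}. \<forall>j\<in>{1..n}. (i, j) \<in> {(k, l). {k, l} \<in> G}\<^sup>*)}"

definition phi :: "('a \<Rightarrow> 'a \<Rightarrow> complex) \<Rightarrow> nat \<Rightarrow> (nat \<Rightarrow> 'a) \<Rightarrow> complex" where
  "phi z n x = (if n = 1 then 1 else
     (1 / of_nat (fact n)) * (\<Sum>G\<in>connected_graphs n. \<Prod>e\<in>G. z (x (Min e)) (x (Max e))))"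

text \<open>n-th term of the series defining Z: (1/n!) int dmu(x_1)..dmu(x_n) prod_{i<j} (1+zeta).\<close>
definition Zterm :: "'a measure \<Rightarrow> ('a \<Rightarrow> complex) \<Rightarrow> ('a \<Rightarrow> 'a \<Rightarrow> complex) \<Rightarrow> nat \<Rightarrow> complex" where
  "Zterm M h z n = (1 / of_nat (fact n)) *
     (\<integral>x. (\<Prod>i\<in>{1..n}. h (x i)) * (\<Prod>i\<in>{1..n}. \<Prod>j\<in>{i<..n}. 1 + z (x i) (x j))
        \<partial>(PiM {1..n} (\<lambda>_. M)))"

text \<open>n-th cluster term: int dmu(x_1)..dmu(x_n) phi(x_1,..,x_n).\<close>
definition cluster_term :: "'a measure \<Rightarrow> ('a \<Rightarrow> complex) \<Rightarrow> ('a \<Rightarrow> 'a \<Rightarrow> complex) \<Rightarrow> nat \<Rightarrow> complex" where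
  "cluster_term M h z n =
     (\<integral>x. (\<Prod>i\<in>{1..n}. h (x i)) * phi z n x \<partial>(PiM {1..n} (\<lambda>_. M)))"

end

theory Submission
  imports Defs
begin

text \<open>
  Write \<open>\<phi>(V)\<close> for the sum over connected graphs on \<open>V\<close>. Two pointwise bounds by sums over trees hold at every configuration that
  satisfies the stability condition for all its subsets.
  With weights \<open>\<zeta>\<close>: in the Kirkwood--Salsburg recursion the removed root \<open>i\<close> can always be
  chosen with \<open>\<Prod>j. \<bar>1 + \<zeta> i j\<bar> \<le> exp (2 b i)\<close>, because the product of these numbers over all \<open>i\<close> is the square of the
  stability bound. With weights \<open>u\<close>: by the Brydges--Kennedy flow, \<open>\<phi>\<close> at coupling \<open>s\<close> satisfies
  \<open>\<phi>' V = - U V * \<phi> V - \<Sum> u(V1, V2) \<phi> V1 \<phi> V2\<close> over the splittings of \<open>V\<close>, and the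
  integrating factor is controlled by stability.

  The tree sums are integrated from the leaves to the root: by the assumption on \<open>a\<close>, the children of a vertex at \<open>x\<close>
  contribute at most \<open>\<Sum>l. a(x)^l / l! = exp (a x)\<close>. Finally, splitting off the component of vertex 1 gives
  \<open>(n + 1) Z (n + 1) = \<Sum>k. (k + 1) c (k + 1) Z (n - k)\<close> for the terms of both series, which says that the power series
  satisfy \<open>Z' = c' Z\<close> on the unit disc, and Abel summation yields \<open>Z = exp c\<close> at 1.
\<close>

section \<open>Graph sums\<close>

text \<open>Trees are never enumerated and connected graphs are never partitioned by spanning trees.
  The tree sum is given by a recursion and handled as the leading coefficient of a graph sum with
  small weights. For the same reason the flow is not compared with a tree sum: the majorant is
  another connected graph sum, with nonnegative weights, which obeys a flow equation of the same
  form by the same lemma, and trees appear only in the final limit. Surgery on graphs is confined to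
  one decomposition of the product of all \<open>1 + w e\<close>. Convolution with this product is
  injective, so later identities between graph sums are checked after convolving. The obstacle in
  the second bound is that stability says nothing about a configuration with a hard-core pair, where
  its left-hand side is zero. For finite energies it is a lower bound on the real part of the energy
  and scales with any coupling \<open>s \<ge> 0\<close>; this is why hard cores are first replaced
  by a finite repulsion.\<close>

definition edges :: "'v set \<Rightarrow> 'v set set" where
  "edges V = {e. e \<subseteq> V \<and> card e = 2}"

definition adj :: "'v set set \<Rightarrow> ('v \<times> 'v) set" where
  "adj G = {(k, l). {k, l} \<in> G}"

text \<open>Roots may or may not be joined to each other; only the vertices of \<open>B\<close> have
  to be reached. Deleting a root and promoting its neighbours to roots therefore stays inside this
  class.\<close>

definition rooted_graphs :: "'v set \<Rightarrow> 'v set \<Rightarrow> 'v set set set" where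
  "rooted_graphs A B = {G. G \<subseteq> edges (A \<union> B) \<and> (\<forall>b\<in>B. \<exists>a\<in>A. (a, b) \<in> (adj G)\<^sup>*)}"

text \<open>For \<open>w = exp (- u) - 1\<close> this is the Boltzmann factor; multiplied out, it is
  the sum over all graphs on \<open>V\<close>. The ring is left general because complex weights and
  real majorants both occur.\<close>

definition boltz :: "('v set \<Rightarrow> 'c::comm_ring_1) \<Rightarrow> 'v set \<Rightarrow> 'c" where
  "boltz w V = (\<Prod>e\<in>edges V. 1 + w e)"

text \<open>For \<open>A = {v}\<close> this is the sum over connected graphs, that is, \<open>n!\<close> times the function
  \<open>\<phi>\<close> of the cluster expansion. Larger root sets \<open>A\<close> are needed for the recursion.\<close>

definition ursell :: "('v set \<Rightarrow> 'c::comm_ring_1) \<Rightarrow> 'v set \<Rightarrow> 'v set \<Rightarrow> 'c" where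
  "ursell w A B = (\<Sum>G\<in>rooted_graphs A B. \<Prod>e\<in>G. w e)"

lemma finite_edges: "finite V \<Longrightarrow> finite (edges V)"
  by (simp add: edges_def)

lemma finite_rooted_graphs: "finite A \<Longrightarrow> finite B \<Longrightarrow> finite (rooted_graphs A B)"
  by (rule finite_subset[of _ "Pow (edges (A \<union> B))"]) (auto simp: rooted_graphs_def finite_edges)

lemma edges_pair_iff: "{i, j} \<in> edges V \<longleftrightarrow> i \<in> V \<and> j \<in> V \<and> i \<noteq> j"
  by (auto simp: edges_def card_2_iff doubleton_eq_iff)

lemma edges_cases:
  assumes "e \<in> edges V"
  obtains i j where "e = {i, j}" "i \<in> V" "j \<in> V" "i \<noteq> j"
  using assms by (auto simp: edges_def card_2_iff)

lemma edges_mono: "A \<subseteq> B \<Longrightarrow> edges A \<subseteq> edges B"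
  by (auto simp: edges_def)

lemma edges_disjoint: "A \<inter> B = {} \<Longrightarrow> edges A \<inter> edges B = {}"
  by (auto simp: edges_def card_2_iff)

lemma edges_insert: "i \<notin> A \<Longrightarrow> edges (insert i A) = edges A \<union> (\<lambda>j. {i, j}) ` A"
  by (auto elim!: edges_cases simp: edges_pair_iff doubleton_eq_iff insert_commute)

lemma prod_edges_insert:
  fixes F :: "'v set \<Rightarrow> 'c::comm_monoid_mult"
  assumes "finite A" "i \<notin> A"
  shows "prod F (edges (insert i A)) = (\<Prod>j\<in>A. F {i, j}) * prod F (edges A)"
proof -
  have "prod F (edges (insert i A)) = prod F (edges A) * prod F ((\<lambda>j. {i, j}) ` A)"
    unfolding edges_insert[OF assms(2)] using assms
    by (intro prod.union_disjoint) (auto simp: finite_edges edges_pair_iff)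
  also have "prod F ((\<lambda>j. {i, j}) ` A) = (\<Prod>j\<in>A. F {i, j})"
    by (subst prod.reindex) (auto simp: inj_on_def doubleton_eq_iff)
  finally show ?thesis by (simp add: mult.commute)
qed

lemma sum_edges_insert:
  fixes F :: "'v set \<Rightarrow> 'c::comm_monoid_add"
  assumes "finite A" "i \<notin> A"
  shows "sum F (edges (insert i A)) = (\<Sum>j\<in>A. F {i, j}) + sum F (edges A)"
proof -
  have "sum F (edges (insert i A)) = sum F (edges A) + sum F ((\<lambda>j. {i, j}) ` A)"
    unfolding edges_insert[OF assms(2)] using assms
    by (intro sum.union_disjoint) (auto simp: finite_edges edges_pair_iff)
  also have "sum F ((\<lambda>j. {i, j}) ` A) = (\<Sum>j\<in>A. F {i, j})"
    by (subst sum.reindex) (auto simp: inj_on_def doubleton_eq_iff)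
  finally show ?thesis by (simp add: add.commute)
qed

lemma edges_empty [simp]: "edges {} = {}"
  by (auto simp: edges_def)

lemma edges_singleton [simp]: "edges {v} = {}"
  by (auto elim: edges_cases)

lemma boltz_insert:
  "finite A \<Longrightarrow> i \<notin> A \<Longrightarrow> boltz w (insert i A) = (\<Prod>j\<in>A. 1 + w {i, j}) * boltz w A"
  by (simp add: boltz_def prod_edges_insert)

lemma boltz_empty [simp]: "boltz w {} = 1"
  by (simp add: boltz_def)

lemma prod_one_plus:
  fixes f :: "'b \<Rightarrow> 'c::comm_semiring_1"
  assumes "finite S"
  shows "(\<Prod>x\<in>S. 1 + f x) = (\<Sum>T\<in>Pow S. \<Prod>x\<in>T. f x)"
  using assms
proof (induction S)
  case (insert x S)
  have "(\<Sum>T\<in>Pow (insert x S). prod f T) = (\<Sum>T\<in>Pow S. prod f T) + (\<Sum>T\<in>insert x ` Pow S. prod f T)"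
    unfolding Pow_insert using insert by (intro sum.union_disjoint) auto
  also have "(\<Sum>T\<in>insert x ` Pow S. prod f T) = (\<Sum>T\<in>Pow S. prod f (insert x T))"
    using insert by (subst sum.reindex) (auto simp: inj_on_def)
  also have "\<dots> = (\<Sum>T\<in>Pow S. f x * prod f T)"
    using insert by (intro sum.cong refl prod.insert) (auto dest: finite_subset)
  finally show ?case using insert by (simp add: distrib_right sum_distrib_left sum.distrib)
qed simp

section \<open>Decomposition of a graph by the vertices reached from the roots\<close>

lemma rtrancl_adj_union:
  assumes "G1 \<subseteq> edges W" "G2 \<subseteq> edges U" "W \<inter> U = {}" "(a, c) \<in> (adj (G1 \<union> G2))\<^sup>*" "a \<in> W"
  shows "c \<in> W"
  using assms(4,5)
proof (induction rule: rtrancl_induct)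
  case (step y z)
  then have "y \<in> W" "{y, z} \<in> G1 \<union> G2" by (auto simp: adj_def)
  then show ?case using assms(1-3)
    by (metis Int_iff Un_iff edges_pair_iff empty_iff subsetD)
qed

lemma adj_mono: "G \<subseteq> G' \<Longrightarrow> adj G \<subseteq> adj G'"
  by (auto simp: adj_def)

lemma adj_sym: "sym (adj G)"
  by (auto simp: adj_def sym_def insert_commute)

definition reached :: "'v set \<Rightarrow> 'v set \<Rightarrow> 'v set set \<Rightarrow> 'v set" where
  "reached A B G = {b\<in>B. \<exists>a\<in>A. (a, b) \<in> (adj G)\<^sup>*}"

lemma reached_union:
  assumes "A \<inter> B = {}" "K \<subseteq> B" "G1 \<in> rooted_graphs A K" "G2 \<subseteq> edges (B - K)"
  shows "reached A B (G1 \<union> G2) = K"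
proof
  have G1: "G1 \<subseteq> edges (A \<union> K)" using assms by (simp add: rooted_graphs_def)
  have dis: "(A \<union> K) \<inter> (B - K) = {}" using assms by auto
  show "reached A B (G1 \<union> G2) \<subseteq> K"
    using rtrancl_adj_union[OF G1 assms(4) dis] assms(1) by (fastforce simp: reached_def)
  show "K \<subseteq> reached A B (G1 \<union> G2)"
  proof
    fix b assume "b \<in> K"
    then obtain a where "a \<in> A" "(a, b) \<in> (adj G1)\<^sup>*" using assms by (auto simp: rooted_graphs_def)
    moreover have "(adj G1)\<^sup>* \<subseteq> (adj (G1 \<union> G2))\<^sup>*" by (intro rtrancl_mono adj_mono) auto
    ultimately show "b \<in> reached A B (G1 \<union> G2)" using \<open>b \<in> K\<close> assms by (auto simp: reached_def)
  qed
qed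

lemma adj_closed_reached:
  assumes "G \<subseteq> edges (A \<union> B)" "{i, j} \<in> G" "i \<in> A \<union> reached A B G"
  shows "j \<in> A \<union> reached A B G"
proof -
  obtain a where "a \<in> A" "(a, i) \<in> (adj G)\<^sup>*" using assms(3) by (auto simp: reached_def)
  then have "(a, j) \<in> (adj G)\<^sup>*" using assms(2) by (auto simp: adj_def intro: rtrancl_into_rtrancl)
  moreover have "j \<in> A \<union> B" using assms edges_pair_iff by (metis subsetD)
  ultimately show ?thesis using \<open>a \<in> A\<close> by (auto simp: reached_def)
qed

lemma graph_split_reached:
  assumes "G \<subseteq> edges (A \<union> B)" "A \<inter> B = {}"
  defines "K \<equiv> reached A B G"
  shows "G \<inter> edges (A \<union> K) \<union> G \<inter> edges (B - K) = G"
proof -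
  have "e \<in> edges (A \<union> K) \<union> edges (B - K)" if "e \<in> G" for e
  proof -
    have "e \<in> edges (A \<union> B)" using that assms(1) by auto
    then obtain i j where e: "e = {i, j}" "i \<in> A \<union> B" "j \<in> A \<union> B" "i \<noteq> j"
      by (rule edges_cases)
    have "i \<in> A \<union> K \<longleftrightarrow> j \<in> A \<union> K"
      using adj_closed_reached[OF assms(1), of i j] adj_closed_reached[OF assms(1), of j i] that e(1)
      unfolding K_def by (auto simp: insert_commute)
    then show ?thesis using e by (auto simp: edges_pair_iff)
  qed
  then show ?thesis by auto
qed

lemma reached_rooted:
  assumes "G \<subseteq> edges (A \<union> B)"
  defines "K \<equiv> reached A B G"
  shows "G \<inter> edges (A \<union> K) \<in> rooted_graphs A K"
proof -
  have *: "(a, c) \<in> (adj (G \<inter> edges (A \<union> K)))\<^sup>* \<and> c \<in> A \<union> K" if "(a, c) \<in> (adj G)\<^sup>*" "a \<in> A" for a c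
    using that
  proof (induction rule: rtrancl_induct)
    case (step y z)
    then have yz: "{y, z} \<in> G" "y \<in> A \<union> K" by (auto simp: adj_def)
    then have "z \<in> A \<union> K" using adj_closed_reached[OF assms(1)] K_def by auto
    moreover have "{y, z} \<in> edges (A \<union> K)"
      using yz \<open>z \<in> A \<union> K\<close> assms(1) edges_pair_iff by (metis subsetD)
    ultimately show ?case using step yz by (auto simp: adj_def intro: rtrancl_into_rtrancl)
  qed simp
  show ?thesis using * by (auto simp: rooted_graphs_def K_def reached_def)
qed

text \<open>A graph on \<open>A \<union> B\<close> is the same as the set \<open>K\<close> of
  vertices of \<open>B\<close> reached from \<open>A\<close>, a rooted graph on
  \<open>A \<union> K\<close>, and an arbitrary graph on \<open>B - K\<close>: an edge between the
  last two vertex sets would make its other end reachable.\<close>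

lemma boltz_decomp:
  assumes "finite A" "finite B" "A \<inter> B = {}"
  shows "boltz w (A \<union> B) = (\<Sum>K\<in>Pow B. ursell w A K * boltz w (B - K))"
proof -
  have fin: "finite K" "finite (B - K)" if "K \<in> Pow B" for K using that assms finite_subset by auto
  let ?S = "SIGMA K:Pow B. rooted_graphs A K \<times> Pow (edges (B - K))"
  have "(\<Sum>K\<in>Pow B. ursell w A K * boltz w (B - K))
      = (\<Sum>K\<in>Pow B. \<Sum>(G1, G2)\<in>rooted_graphs A K \<times> Pow (edges (B - K)). prod w G1 * prod w G2)"
    using fin by (intro sum.cong refl)
      (simp add: ursell_def boltz_def prod_one_plus finite_edges sum_product sum.cartesian_product)
  also have "\<dots> = (\<Sum>(K, G1, G2)\<in>?S. prod w G1 * prod w G2)"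
    using assms fin by (subst sum.Sigma) (auto simp: finite_rooted_graphs finite_edges split_beta)
  also have "\<dots> = (\<Sum>G\<in>Pow (edges (A \<union> B)). prod w G)"
  proof (rule sum.reindex_bij_witness[where
        i = "\<lambda>G. (reached A B G, G \<inter> edges (A \<union> reached A B G), G \<inter> edges (B - reached A B G))"
        and j = "\<lambda>(K, G1, G2). G1 \<union> G2"])
    fix p assume "p \<in> ?S"
    then obtain K G1 G2 where p: "p = (K, G1, G2)" "K \<subseteq> B" "G1 \<in> rooted_graphs A K" "G2 \<subseteq> edges (B - K)"
      by auto
    have r: "reached A B (G1 \<union> G2) = K" using reached_union[OF assms(3) p(2-4)] .
    have G1: "G1 \<subseteq> edges (A \<union> K)" using p by (simp add: rooted_graphs_def)
    have dis: "edges (A \<union> K) \<inter> edges (B - K) = {}" using assms by (intro edges_disjoint) auto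
    show "(case p of (K, G1, G2) \<Rightarrow> G1 \<union> G2) \<in> Pow (edges (A \<union> B))"
      using G1 p edges_mono[of "A \<union> K" "A \<union> B"] edges_mono[of "B - K" "A \<union> B"] by blast
    show "(\<lambda>G. (reached A B G, G \<inter> edges (A \<union> reached A B G), G \<inter> edges (B - reached A B G)))
           (case p of (K, G1, G2) \<Rightarrow> G1 \<union> G2) = p"
      using p r G1 dis by auto
    have "finite G1" "finite G2"
      using G1 p fin[of K] finite_edges[of "A \<union> K"] finite_edges[of "B - K"] assms finite_subset by auto
    then show "prod w (case p of (K, G1, G2) \<Rightarrow> G1 \<union> G2) = (case p of (K, G1, G2) \<Rightarrow> prod w G1 * prod w G2)"
      using p dis G1 by (auto intro!: prod.union_disjoint)
  next
    fix G assume "G \<in> Pow (edges (A \<union> B))"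
    then have G: "G \<subseteq> edges (A \<union> B)" by simp
    show "(case (reached A B G, G \<inter> edges (A \<union> reached A B G), G \<inter> edges (B - reached A B G)) of
        (K, G1, G2) \<Rightarrow> G1 \<union> G2) = G"
      using graph_split_reached[OF G assms(3)] by simp
    show "(reached A B G, G \<inter> edges (A \<union> reached A B G), G \<inter> edges (B - reached A B G)) \<in> ?S"
      using reached_rooted[OF G] by (auto simp: reached_def)
  qed
  also have "\<dots> = boltz w (A \<union> B)"
    using assms by (simp add: boltz_def prod_one_plus finite_edges)
  finally show ?thesis by simp
qed

text \<open>The system is triangular: the summand \<open>L = B\<close> has coefficient
  \<open>boltz w {} = 1\<close>, and all others involve proper subsets. The hypothesis is stated for
  every \<open>K \<subseteq> B\<close> so that the induction can descend.\<close>

lemma boltz_conv_unique: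
  fixes w :: "'v set \<Rightarrow> 'c::comm_ring_1"
  assumes "finite B"
    and "\<And>K. K \<subseteq> B \<Longrightarrow> (\<Sum>L\<in>Pow K. p L * boltz w (K - L)) = (\<Sum>L\<in>Pow K. q L * boltz w (K - L))"
  shows "p B = q B"
  using assms
proof (induction B rule: finite_psubset_induct)
  case (psubset B)
  have eq: "p L = q L" if "L \<subset> B" for L
    using that by (intro psubset) (auto intro: psubset.prems)
  have *: "(\<Sum>L\<in>Pow B. r L * boltz w (B - L)) = r B + (\<Sum>L\<in>Pow B - {B}. r L * boltz w (B - L))"
    for r :: "'v set \<Rightarrow> 'c"
    using psubset.hyps by (subst sum.remove[of _ B]) auto
  have "(\<Sum>L\<in>Pow B - {B}. p L * boltz w (B - L)) = (\<Sum>L\<in>Pow B - {B}. q L * boltz w (B - L))"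
    by (intro sum.cong refl arg_cong2[where f = "(*)"] eq) auto
  with psubset.prems[of B] *[of p] *[of q] show ?case by simp
qed

lemma sum_Pow_Pow_swap:
  assumes "finite B"
  shows "(\<Sum>C\<in>Pow B. \<Sum>K\<in>Pow (B - C). X C K) = (\<Sum>K\<in>Pow B. \<Sum>C\<in>Pow K. X C (K - C))"
proof -
  have fin: "finite (B - C)" "finite (Pow C)" if "C \<in> Pow B" for C using that assms finite_subset by auto
  have "(\<Sum>C\<in>Pow B. \<Sum>K\<in>Pow (B - C). X C K) = (\<Sum>(C, K)\<in>(SIGMA C:Pow B. Pow (B - C)). X C K)"
    using assms fin by (subst sum.Sigma) auto
  also have "\<dots> = (\<Sum>(K, C)\<in>(SIGMA K:Pow B. Pow K). X C (K - C))"
    by (rule sum.reindex_bij_witness[where i = "\<lambda>(K, C). (C, K - C)" and j = "\<lambda>(C, K). (C \<union> K, C)"])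
      (auto intro!: arg_cong2[where f = X])
  also have "\<dots> = (\<Sum>K\<in>Pow B. \<Sum>C\<in>Pow K. X C (K - C))"
    using assms fin by (subst sum.Sigma) auto
  finally show ?thesis .
qed

text \<open>The Kirkwood--Salsburg recursion: remove the root \<open>i\<close> and make its neighbours \<open>C\<close> in \<open>B\<close> new roots.\<close>

lemma ursell_rec:
  assumes "finite A" "finite B" "A \<inter> B = {}" "i \<in> A"
  shows "ursell w A B = (\<Prod>j\<in>A - {i}. 1 + w {i, j}) *
    (\<Sum>C\<in>Pow B. (\<Prod>j\<in>C. w {i, j}) * ursell w (A - {i} \<union> C) (B - C))" (is "_ = ?q B")
proof (rule boltz_conv_unique[where p = "\<lambda>B. ursell w A B" and q = ?q, OF assms(2)])
  fix K assume K: "K \<subseteq> B"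
  let ?P = "\<Prod>j\<in>A - {i}. 1 + w {i, j}"
  have fK: "finite K" and dK: "A \<inter> K = {}" using K assms finite_subset by auto
  have "(\<Sum>L\<in>Pow K. ursell w A L * boltz w (K - L)) = boltz w (insert i ((A - {i}) \<union> K))"
    using boltz_decomp[OF assms(1) fK dK, of w] assms(4) by (simp add: insert_absorb flip: Un_insert_left)
  also have "\<dots> = (\<Prod>j\<in>(A - {i}) \<union> K. 1 + w {i, j}) * boltz w ((A - {i}) \<union> K)"
    using assms fK dK by (intro boltz_insert) auto
  \<comment> \<open>The factors joining \<open>i\<close> to other roots stay a product, since such
    edges are unconstrained. Those joining \<open>i\<close> to \<open>K\<close> are expanded; the
    chosen set \<open>C\<close> becomes new roots, and what remains is decomposed again with respect
    to the enlarged root set.\<close>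
  also have "(\<Prod>j\<in>(A - {i}) \<union> K. 1 + w {i, j}) = ?P * (\<Prod>j\<in>K. 1 + w {i, j})"
    using assms fK dK by (intro prod.union_disjoint) auto
  also have "(\<Prod>j\<in>K. 1 + w {i, j}) = (\<Sum>C\<in>Pow K. \<Prod>j\<in>C. w {i, j})"
    using fK by (rule prod_one_plus)
  also have "?P * (\<Sum>C\<in>Pow K. \<Prod>j\<in>C. w {i, j}) * boltz w ((A - {i}) \<union> K)
     = ?P * (\<Sum>C\<in>Pow K. (\<Prod>j\<in>C. w {i, j}) * boltz w ((A - {i} \<union> C) \<union> (K - C)))"
    by (auto simp: mult.assoc sum_distrib_right intro!: arg_cong2[where f = "(*)"] sum.cong arg_cong[where f = "boltz w"])
  also have "\<dots> = ?P * (\<Sum>C\<in>Pow K. \<Sum>L\<in>Pow (K - C).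
      (\<Prod>j\<in>C. w {i, j}) * ursell w (A - {i} \<union> C) L * boltz w (K - C - L))"
  proof (intro arg_cong2[where f = "(*)"] sum.cong refl)
    fix C assume C: "C \<in> Pow K"
    have "boltz w ((A - {i} \<union> C) \<union> (K - C))
        = (\<Sum>L\<in>Pow (K - C). ursell w (A - {i} \<union> C) L * boltz w (K - C - L))"
      using C dK fK assms finite_subset by (intro boltz_decomp) auto
    then show "(\<Prod>j\<in>C. w {i, j}) * boltz w ((A - {i} \<union> C) \<union> (K - C)) = (\<Sum>L\<in>Pow (K - C).
      (\<Prod>j\<in>C. w {i, j}) * ursell w (A - {i} \<union> C) L * boltz w (K - C - L))"
      by (simp add: sum_distrib_left mult.assoc)
  qed
  also have "(\<Sum>C\<in>Pow K. \<Sum>L\<in>Pow (K - C).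
      (\<Prod>j\<in>C. w {i, j}) * ursell w (A - {i} \<union> C) L * boltz w (K - C - L))
    = (\<Sum>L\<in>Pow K. \<Sum>C\<in>Pow L. (\<Prod>j\<in>C. w {i, j}) * ursell w (A - {i} \<union> C) (L - C) * boltz w (K - C - (L - C)))"
    by (rule sum_Pow_Pow_swap[OF fK])
  also have "\<dots> = (\<Sum>L\<in>Pow K. (\<Sum>C\<in>Pow L. (\<Prod>j\<in>C. w {i, j}) * ursell w (A - {i} \<union> C) (L - C)) * boltz w (K - L))"
    unfolding sum_distrib_right
    by (intro sum.cong refl arg_cong2[where f = "(*)"] arg_cong[where f = "boltz w"]) auto
  finally show "(\<Sum>L\<in>Pow K. ursell w A L * boltz w (K - L)) = (\<Sum>L\<in>Pow K. ?q L * boltz w (K - L))"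
    by (subst (asm) sum_distrib_left) (simp add: mult.assoc)
qed

section \<open>Forests as the leading order of rooted graph sums\<close>

lemma ursell_no_roots: "ursell w {} B = (if B = {} then 1 else 0)"
proof -
  have "rooted_graphs {} B = (if B = {} then {{}} else {})"
    by (auto simp: rooted_graphs_def)
  then show ?thesis by (simp add: ursell_def)
qed

lemma card_rec_less:
  assumes "finite A" "finite B" "i \<in> A" "C \<subseteq> B"
  shows "card (A - {i} \<union> C) + card (B - C) < card A + card B"
proof -
  have "card (A - {i} \<union> C) \<le> card (A - {i}) + card C" by (rule card_Un_le)
  moreover have "card (B - C) = card B - card C" using assms by (meson card_Diff_subset finite_subset)
  moreover have "card C \<le> card B" using assms by (intro card_mono)
  moreover have "card (A - {i}) < card A" using assms by (intro card_Diff1_less)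
  ultimately show ?thesis by linarith
qed

text \<open>The sum over the forests on \<open>A \<union> B\<close> in which every tree contains exactly one vertex of \<open>A\<close>. These are
  the graphs counted by \<^const>\<open>ursell\<close> with the fewest edges, so \<^const>\<open>ursell\<close> is asymptotic to
  this sum for small weights; that is how \<open>forest_rec\<close> frees the recursion from the choice of the
  root, and how relabelling invariance is obtained.\<close>

function forest :: "('v set \<Rightarrow> real) \<Rightarrow> 'v set \<Rightarrow> 'v set \<Rightarrow> real" where
  "forest w A B = (if finite A \<and> finite B \<and> A \<noteq> {} then
     (let i = (SOME i. i \<in> A) in
       \<Sum>C\<in>Pow B. (\<Prod>j\<in>C. w {i, j}) * forest w (A - {i} \<union> C) (B - C))
     else if B = {} then 1 else 0)"
  by auto
termination
  by (relation "Wellfounded.measure (\<lambda>(w, A, B). card A + card B)")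
    (auto intro!: card_rec_less intro: someI)

declare forest.simps [simp del]

lemma forest_no_roots: "forest w {} B = (if B = {} then 1 else 0)"
  by (simp add: forest.simps)

lemma forest_some_rec:
  assumes "finite A" "finite B" "A \<noteq> {}"
  shows "\<exists>i\<in>A. forest w A B = (\<Sum>C\<in>Pow B. (\<Prod>j\<in>C. w {i, j}) * forest w (A - {i} \<union> C) (B - C))"
  using assms by (intro bexI[of _ "SOME i. i \<in> A"]) (auto simp: forest.simps[of w A B] Let_def some_in_eq)

lemma ursell_rec_tendsto:
  fixes W :: "real \<Rightarrow> 'v set \<Rightarrow> real"
  assumes fin: "finite A" "finite B" "A \<inter> B = {}" and i: "i \<in> A" "A \<union> B \<subseteq> V"
    and W: "\<And>e. e \<in> edges V \<Longrightarrow> ((\<lambda>\<epsilon>. W \<epsilon> e / \<epsilon>) \<longlongrightarrow> w e) (at_right 0)"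
    and IH: "\<And>C. C \<subseteq> B \<Longrightarrow>
      ((\<lambda>\<epsilon>. ursell (W \<epsilon>) (A - {i} \<union> C) (B - C) / \<epsilon> ^ card (B - C)) \<longlongrightarrow> h C) (at_right 0)"
  shows "((\<lambda>\<epsilon>. ursell (W \<epsilon>) A B / \<epsilon> ^ card B) \<longlongrightarrow> (\<Sum>C\<in>Pow B. (\<Prod>j\<in>C. w {i, j}) * h C)) (at_right 0)"
proof -
  have W0: "((\<lambda>\<epsilon>. W \<epsilon> e) \<longlongrightarrow> 0) (at_right 0)" if "e \<in> edges V" for e
  proof -
    have "((\<lambda>\<epsilon>. W \<epsilon> e / \<epsilon> * \<epsilon>) \<longlongrightarrow> w e * 0) (at_right 0)"
      by (intro tendsto_mult W that tendsto_ident_at)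
    moreover have "\<forall>\<^sub>F \<epsilon> in at_right 0. W \<epsilon> e / \<epsilon> * \<epsilon> = W \<epsilon> e"
      by (auto simp: eventually_at_filter)
    ultimately show ?thesis by (simp add: tendsto_cong)
  qed
  have "((\<lambda>\<epsilon>. (\<Prod>j\<in>A - {i}. 1 + W \<epsilon> {i, j}) * (\<Sum>C\<in>Pow B. (\<Prod>j\<in>C. W \<epsilon> {i, j} / \<epsilon>) *
      (ursell (W \<epsilon>) (A - {i} \<union> C) (B - C) / \<epsilon> ^ card (B - C)))) \<longlongrightarrow>
      (\<Prod>j\<in>A - {i}. 1 + 0) * (\<Sum>C\<in>Pow B. (\<Prod>j\<in>C. w {i, j}) * h C)) (at_right 0)"
    using i fin by (intro tendsto_mult tendsto_prod tendsto_sum tendsto_add tendsto_const W0 W IH)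
      (auto simp: edges_pair_iff)
  moreover have "\<forall>\<^sub>F \<epsilon> in at_right 0. (\<Prod>j\<in>A - {i}. 1 + W \<epsilon> {i, j}) * (\<Sum>C\<in>Pow B. (\<Prod>j\<in>C. W \<epsilon> {i, j} / \<epsilon>) *
      (ursell (W \<epsilon>) (A - {i} \<union> C) (B - C) / \<epsilon> ^ card (B - C))) = ursell (W \<epsilon>) A B / \<epsilon> ^ card B"
  proof -
    have "(\<Prod>j\<in>A - {i}. 1 + W \<epsilon> {i, j}) * (\<Sum>C\<in>Pow B. (\<Prod>j\<in>C. W \<epsilon> {i, j} / \<epsilon>) *
      (ursell (W \<epsilon>) (A - {i} \<union> C) (B - C) / \<epsilon> ^ card (B - C))) = ursell (W \<epsilon>) A B / \<epsilon> ^ card B"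
      if "\<epsilon> > 0" for \<epsilon>
    proof -
      have "(\<Prod>j\<in>C. W \<epsilon> {i, j} / \<epsilon>) * (ursell (W \<epsilon>) (A - {i} \<union> C) (B - C) / \<epsilon> ^ card (B - C))
         = (\<Prod>j\<in>C. W \<epsilon> {i, j}) * ursell (W \<epsilon>) (A - {i} \<union> C) (B - C) / \<epsilon> ^ card B" if "C \<subseteq> B" for C
      proof -
        have "\<epsilon> ^ card B = \<epsilon> ^ card C * \<epsilon> ^ card (B - C)"
          using that fin by (metis card_Diff_subset card_mono finite_subset le_add_diff_inverse power_add)
        then show ?thesis by (simp add: prod_dividef)
      qed
      then show ?thesis
        unfolding ursell_rec[OF fin i(1)] by (simp flip: sum_divide_distrib)
    qed
    then show ?thesis by (auto simp: eventually_at_filter)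
  qed
  ultimately show ?thesis by (simp add: tendsto_cong)
qed

lemma ursell_tendsto_forest:
  fixes W :: "real \<Rightarrow> 'v set \<Rightarrow> real"
  assumes "finite A" "finite B" "A \<inter> B = {}" "A \<union> B \<subseteq> V"
    and W: "\<And>e. e \<in> edges V \<Longrightarrow> ((\<lambda>\<epsilon>. W \<epsilon> e / \<epsilon>) \<longlongrightarrow> w e) (at_right 0)"
  shows "((\<lambda>\<epsilon>. ursell (W \<epsilon>) A B / \<epsilon> ^ card B) \<longlongrightarrow> forest w A B) (at_right 0)"
  using assms(1-4)
proof (induction "card A + card B" arbitrary: A B rule: less_induct)
  case less
  show ?case
  proof (cases "A = {}")
    case True
    then show ?thesis by (auto simp: ursell_no_roots forest_no_roots)
  next
    case False
    then obtain i where i: "i \<in> A"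
      "forest w A B = (\<Sum>C\<in>Pow B. (\<Prod>j\<in>C. w {i, j}) * forest w (A - {i} \<union> C) (B - C))"
      using forest_some_rec[OF less.prems(1,2) False, of w] by blast
    have "((\<lambda>\<epsilon>. ursell (W \<epsilon>) (A - {i} \<union> C) (B - C) / \<epsilon> ^ card (B - C)) \<longlongrightarrow>
        forest w (A - {i} \<union> C) (B - C)) (at_right 0)" if "C \<subseteq> B" for C
      using that less.prems i(1) finite_subset[OF that]
      by (intro less.hyps card_rec_less) auto
    then show ?thesis unfolding i(2)
      using less.prems i(1) W by (intro ursell_rec_tendsto[where V = V]) auto
  qed
qed

lemma tendsto_forest_scaled:
  assumes "finite A" "finite B" "A \<inter> B = {}"
  shows "((\<lambda>\<epsilon>. ursell (\<lambda>e. \<epsilon> * w e) A B / \<epsilon> ^ card B) \<longlongrightarrow> forest w A B) (at_right 0)"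
proof (rule ursell_tendsto_forest[OF assms order_refl])
  show "((\<lambda>\<epsilon>. (\<epsilon> * w e) / \<epsilon>) \<longlongrightarrow> w e) (at_right 0)" for e
    by (rule tendsto_eventually) (auto simp: eventually_at_filter)
qed

lemma forest_rec:
  assumes "finite A" "finite B" "A \<inter> B = {}" "i \<in> A"
  shows "forest w A B = (\<Sum>C\<in>Pow B. (\<Prod>j\<in>C. w {i, j}) * forest w (A - {i} \<union> C) (B - C))"
proof (rule tendsto_unique[OF _ tendsto_forest_scaled[OF assms(1-3)]])
  show "((\<lambda>\<epsilon>. ursell (\<lambda>e. \<epsilon> * w e) A B / \<epsilon> ^ card B) \<longlongrightarrow>
     (\<Sum>C\<in>Pow B. (\<Prod>j\<in>C. w {i, j}) * forest w (A - {i} \<union> C) (B - C))) (at_right 0)"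
  proof (rule ursell_rec_tendsto[OF assms order_refl])
    show "((\<lambda>\<epsilon>. (\<epsilon> * w e) / \<epsilon>) \<longlongrightarrow> w e) (at_right 0)" for e
      by (rule tendsto_eventually) (auto simp: eventually_at_filter)
    show "((\<lambda>\<epsilon>. ursell (\<lambda>e. \<epsilon> * w e) (A - {i} \<union> C) (B - C) / \<epsilon> ^ card (B - C)) \<longlongrightarrow>
        forest w (A - {i} \<union> C) (B - C)) (at_right 0)" if "C \<subseteq> B" for C
      using assms that finite_subset[OF that] by (intro tendsto_forest_scaled) auto
  qed
qed simp

lemma forest_nonneg:
  assumes "finite A" "finite B" "A \<inter> B = {}" "\<And>e. e \<in> edges (A \<union> B) \<Longrightarrow> w e \<ge> 0"
  shows "forest w A B \<ge> 0"
  using assms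
proof (induction "card A + card B" arbitrary: A B rule: less_induct)
  case less
  show ?case
  proof (cases "A = {}")
    case False
    then obtain i where i: "i \<in> A" by auto
    have "w {i, j} \<ge> 0" if "C \<subseteq> B" "j \<in> C" for C j
      using that less.prems i by (intro less.prems(4)) (auto simp: edges_pair_iff)
    moreover have "forest w (A - {i} \<union> C) (B - C) \<ge> 0" if "C \<subseteq> B" for C
      using that less.prems(1-3) i finite_subset[OF that] edges_mono[of "A - {i} \<union> C \<union> (B - C)" "A \<union> B"]
      by (intro less.hyps card_rec_less less.prems(4)) auto
    ultimately show ?thesis
      unfolding forest_rec[OF less.prems(1-3) i] by (intro sum_nonneg mult_nonneg_nonneg prod_nonneg) auto
  qed (simp add: forest_no_roots)
qed

section \<open>Choice of the root and the tree bound with weights \<open>norm (w e)\<close>\<close>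

lemma prod_prod_edges:
  fixes F :: "'v set \<Rightarrow> 'c::comm_monoid_mult"
  assumes "finite A"
  shows "(\<Prod>i\<in>A. \<Prod>j\<in>A - {i}. F {i, j}) = (prod F (edges A))\<^sup>2"
  using assms
proof (induction A)
  case (insert k A)
  have "(\<Prod>i\<in>insert k A. \<Prod>j\<in>insert k A - {i}. F {i, j})
      = (\<Prod>j\<in>A. F {k, j}) * (\<Prod>i\<in>A. \<Prod>j\<in>insert k A - {i}. F {i, j})"
    using insert by simp
  also have "(\<Prod>i\<in>A. \<Prod>j\<in>insert k A - {i}. F {i, j}) = (\<Prod>i\<in>A. F {k, i} * (\<Prod>j\<in>A - {i}. F {i, j}))"
  proof (intro prod.cong refl)
    fix i assume "i \<in> A"
    then have "insert k A - {i} = insert k (A - {i})" using insert by auto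
    then show "(\<Prod>j\<in>insert k A - {i}. F {i, j}) = F {k, i} * (\<Prod>j\<in>A - {i}. F {i, j})"
      using insert by (simp add: insert_commute)
  qed
  finally show ?case
    using insert by (simp add: prod.distrib prod_edges_insert power2_eq_square mult_ac)
qed simp

text \<open>Origin of the 2 in \<open>exp (2 * b i)\<close>: in the product over all vertices each
  pair is seen from both of its ends, whereas stability counts it once.\<close>

lemma exists_stable_vertex:
  fixes w :: "'v set \<Rightarrow> complex"
  assumes "finite A" "A \<noteq> {}" "(\<Prod>e\<in>edges A. norm (1 + w e)) \<le> (\<Prod>i\<in>A. exp (b i))"
  shows "\<exists>i\<in>A. (\<Prod>j\<in>A - {i}. norm (1 + w {i, j})) \<le> exp (2 * b i)"
proof (rule ccontr)
  assume "\<not> ?thesis"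
  then have lt: "exp (2 * b i) < (\<Prod>j\<in>A - {i}. norm (1 + w {i, j}))" if "i \<in> A" for i
    using that by (auto simp: not_le)
  obtain k where "k \<in> A" using assms by auto
  then have "(\<Prod>i\<in>A. exp (2 * b i)) < (\<Prod>i\<in>A. \<Prod>j\<in>A - {i}. norm (1 + w {i, j}))"
    using assms lt by (intro prod_mono_strict[of k]) (auto intro: less_imp_le less_trans[OF exp_gt_zero])
  also have "\<dots> = (\<Prod>e\<in>edges A. norm (1 + w e))\<^sup>2"
    using assms by (intro prod_prod_edges)
  also have "\<dots> \<le> (\<Prod>i\<in>A. exp (b i))\<^sup>2"
    using assms by (intro power_mono prod_nonneg) auto
  also have "\<dots> = (\<Prod>i\<in>A. exp (2 * b i))"
    by (simp add: prod_power_distrib flip: exp_double)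
  finally show False by simp
qed

text \<open>Each vertex is removed as a root exactly once and pays its factor
  \<open>exp (2 * b i)\<close> at that moment. The vertex is selected by stability of the current
  root set alone; since this set changes along the recursion, stability is required for all
  subsets.\<close>

lemma norm_ursell_le_forest:
  fixes w :: "'v set \<Rightarrow> complex"
  assumes "finite A" "finite B" "A \<inter> B = {}"
    and stab: "\<And>A'. A' \<subseteq> A \<union> B \<Longrightarrow> (\<Prod>e\<in>edges A'. norm (1 + w e)) \<le> (\<Prod>i\<in>A'. exp (b i))"
  shows "norm (ursell w A B) \<le> (\<Prod>i\<in>A \<union> B. exp (2 * b i)) * forest (\<lambda>e. norm (w e)) A B"
  using assms
proof (induction "card A + card B" arbitrary: A B rule: less_induct)
  case less
  show ?case
  proof (cases "A = {}")
    case False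
    then obtain i where i: "i \<in> A" and le: "(\<Prod>j\<in>A - {i}. norm (1 + w {i, j})) \<le> exp (2 * b i)"
      using exists_stable_vertex[of A w b] less.prems by auto
    let ?R = "\<Prod>i\<in>A \<union> B - {i}. exp (2 * b i)"
    have IH: "norm (ursell w (A - {i} \<union> C) (B - C)) \<le> ?R * forest (\<lambda>e. norm (w e)) (A - {i} \<union> C) (B - C)"
      if "C \<subseteq> B" for C
    proof -
      have eq: "(A - {i} \<union> C) \<union> (B - C) = A \<union> B - {i}" using that less.prems i by auto
      have "norm (ursell w (A - {i} \<union> C) (B - C)) \<le> (\<Prod>i\<in>(A - {i} \<union> C) \<union> (B - C). exp (2 * b i)) *
          forest (\<lambda>e. norm (w e)) (A - {i} \<union> C) (B - C)"
        using that less.prems(1-3) i finite_subset[OF that]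
        by (intro less.hyps card_rec_less less.prems(4)) auto
      then show ?thesis unfolding eq .
    qed
    have "norm (ursell w A B) = (\<Prod>j\<in>A - {i}. norm (1 + w {i, j})) *
       norm (\<Sum>C\<in>Pow B. (\<Prod>j\<in>C. w {i, j}) * ursell w (A - {i} \<union> C) (B - C))"
      unfolding ursell_rec[OF less.prems(1-3) i] by (simp add: norm_mult prod_norm)
    also have "\<dots> \<le> exp (2 * b i) * (\<Sum>C\<in>Pow B. (\<Prod>j\<in>C. norm (w {i, j})) *
        (?R * forest (\<lambda>e. norm (w e)) (A - {i} \<union> C) (B - C)))"
    proof (intro mult_mono le sum_norm_le)
      fix C assume "C \<in> Pow B"
      then show "norm ((\<Prod>j\<in>C. w {i, j}) * ursell w (A - {i} \<union> C) (B - C)) \<le> (\<Prod>j\<in>C. norm (w {i, j})) *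
        (?R * forest (\<lambda>e. norm (w e)) (A - {i} \<union> C) (B - C))"
        using IH by (auto simp: norm_mult prod_norm[symmetric] intro!: mult_left_mono prod_nonneg)
    qed auto
    also have "\<dots> = (exp (2 * b i) * ?R) * forest (\<lambda>e. norm (w e)) A B"
      unfolding forest_rec[OF less.prems(1-3) i, of "\<lambda>e. norm (w e)"]
      by (simp add: sum_distrib_left mult_ac)
    also have "exp (2 * b i) * ?R = (\<Prod>i\<in>A \<union> B. exp (2 * b i))"
      using less.prems i by (subst (2) prod.remove[of _ i]) auto
    finally show ?thesis .
  qed (auto simp: forest_no_roots ursell_no_roots)
qed

section \<open>The tree bound with the potential as weight\<close>

definition spanning_graphs :: "'v set \<Rightarrow> 'v set set set" where
  "spanning_graphs V = {G. G \<subseteq> edges V \<and> (\<forall>i\<in>V. \<forall>j\<in>V. (i, j) \<in> (adj G)\<^sup>*)}"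

text \<open>The form without a root is needed for the flow, which splits \<open>V\<close> into two
  parts of which the second has no distinguished vertex.\<close>

definition conn :: "('v set \<Rightarrow> 'c::comm_ring_1) \<Rightarrow> 'v set \<Rightarrow> 'c" where
  "conn w V = (\<Sum>G\<in>spanning_graphs V. \<Prod>e\<in>G. w e)"

text \<open>\<open>K = V\<close> is included. In the Boltzmann recursion it gives the full connected
  sum, as \<open>boltz w {} = 1\<close>; in the flow equation it gives nothing, as
  \<open>cut u V {} = 0\<close>.\<close>

definition subs :: "'v \<Rightarrow> 'v set \<Rightarrow> 'v set set" where
  "subs v V = {K. v \<in> K \<and> K \<subseteq> V}"

definition cut :: "('v set \<Rightarrow> 'c::comm_monoid_add) \<Rightarrow> 'v set \<Rightarrow> 'v set \<Rightarrow> 'c" where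
  "cut u K L = (\<Sum>i\<in>K. \<Sum>j\<in>L. u {i, j})"

lemma rooted_graphs_singleton:
  assumes "v \<in> V"
  shows "rooted_graphs {v} (V - {v}) = spanning_graphs V"
proof -
  have V: "{v} \<union> (V - {v}) = V" using assms by auto
  have "(\<forall>b\<in>V - {v}. \<exists>a\<in>{v}. (a, b) \<in> (adj G)\<^sup>*) \<longleftrightarrow> (\<forall>i\<in>V. \<forall>j\<in>V. (i, j) \<in> (adj G)\<^sup>*)" for G
  proof
    assume *: "\<forall>b\<in>V - {v}. \<exists>a\<in>{v}. (a, b) \<in> (adj G)\<^sup>*"
    have 1: "(v, b) \<in> (adj G)\<^sup>*" if "b \<in> V" for b using * that by (cases "b = v") auto
    have "(b, v) \<in> (adj G)\<^sup>*" if "b \<in> V" for b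
      using 1[OF that] sym_rtrancl[OF adj_sym, of G] by (auto dest: symD)
    with 1 show "\<forall>i\<in>V. \<forall>j\<in>V. (i, j) \<in> (adj G)\<^sup>*" by (meson rtrancl_trans)
  qed (use assms in auto)
  then show ?thesis unfolding rooted_graphs_def spanning_graphs_def V by blast
qed

lemma ursell_conn: "v \<in> V \<Longrightarrow> ursell w {v} (V - {v}) = conn w V"
  by (simp add: ursell_def conn_def rooted_graphs_singleton)

lemma finite_spanning_graph: "finite V \<Longrightarrow> G \<in> spanning_graphs V \<Longrightarrow> finite G"
  by (auto simp: spanning_graphs_def intro: finite_subset finite_edges)

lemma conn_singleton [simp]: "conn w {v} = 1"
proof -
  have "spanning_graphs {v} = {{}}" by (auto simp: spanning_graphs_def)
  then show ?thesis by (simp add: conn_def)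
qed

lemma conn_zero:
  assumes "finite V" "i \<in> V" "j \<in> V" "i \<noteq> j"
  shows "conn (\<lambda>_. 0) V = 0"
  unfolding conn_def
proof (rule sum.neutral, rule ballI)
  fix G assume G: "G \<in> spanning_graphs V"
  have "G \<noteq> {}"
  proof
    assume "G = {}"
    then have "(i, j) \<in> {}\<^sup>*" using G assms by (auto simp: spanning_graphs_def adj_def)
    then show False using assms by simp
  qed
  then show "(\<Prod>e\<in>G. 0) = (0::'b)" using finite_spanning_graph[OF assms(1) G] by (auto simp: card_gt_0_iff intro!: zero_power)
qed

lemma conn_nonneg:
  fixes w :: "'v set \<Rightarrow> real"
  assumes "\<And>e. e \<in> edges V \<Longrightarrow> 0 \<le> w e"
  shows "0 \<le> conn w V"
  unfolding conn_def using assms by (intro sum_nonneg prod_nonneg) (auto simp: spanning_graphs_def)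

lemma finite_subs: "finite V \<Longrightarrow> finite (subs v V)"
  by (simp add: subs_def)

lemma boltz_conn:
  assumes "finite V" "v \<in> V"
  shows "boltz w V = (\<Sum>K\<in>subs v V. conn w K * boltz w (V - K))"
proof -
  have "boltz w V = (\<Sum>K\<in>Pow (V - {v}). ursell w {v} K * boltz w (V - {v} - K))"
    using boltz_decomp[of "{v}" "V - {v}" w] assms by (simp add: insert_absorb)
  also have "\<dots> = (\<Sum>K\<in>subs v V. conn w K * boltz w (V - K))"
  proof (rule sum.reindex_bij_witness[where i = "\<lambda>K. K - {v}" and j = "insert v"])
    fix K assume K: "K \<in> Pow (V - {v})"
    then have "insert v K - {v} = K" "V - {v} - K = V - insert v K" by auto
    then show "conn w (insert v K) * boltz w (V - insert v K) = ursell w {v} K * boltz w (V - {v} - K)"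
      using ursell_conn[of v "insert v K" w] by simp
  qed (use assms in \<open>auto simp: subs_def\<close>)
  finally show ?thesis .
qed

lemma cut_empty [simp]: "cut u K {} = 0"
  by (simp add: cut_def)

lemma sum_edges_union:
  fixes u :: "'v set \<Rightarrow> 'c::comm_ring_1"
  assumes "finite K" "finite L" "K \<inter> L = {}"
  shows "sum u (edges (K \<union> L)) = sum u (edges K) + sum u (edges L) + cut u K L"
  using assms
proof (induction K)
  case (insert i K)
  have "sum u (edges (insert i (K \<union> L))) = (\<Sum>j\<in>K \<union> L. u {i, j}) + sum u (edges (K \<union> L))"
    using insert by (intro sum_edges_insert) auto
  also have "(\<Sum>j\<in>K \<union> L. u {i, j}) = (\<Sum>j\<in>K. u {i, j}) + (\<Sum>j\<in>L. u {i, j})"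
    using insert by (intro sum.union_disjoint) auto
  finally show ?case
    using insert by (simp add: sum_edges_insert cut_def algebra_simps)
qed (simp add: cut_def)

text \<open>\<open>d\<close> is the expected derivative of \<open>conn\<close>. The identity says
  that differentiating the decomposition \<open>boltz_conn\<close> by the product rule gives the
  energy times \<open>boltz\<close>, as it must. The energy of \<open>V\<close> consists of those
  inside \<open>K\<close> and inside \<open>V - K\<close>, which match directly, and of the cut
  between them, which has to produce the splitting terms of \<open>d\<close>.\<close>

lemma boltz_leibniz:
  fixes u w :: "'v set \<Rightarrow> 'c::comm_ring_1"
  assumes V: "finite V" "v \<in> V"
  defines "d \<equiv> \<lambda>K. sum u (edges K) * conn w K + (\<Sum>L\<in>subs v K. cut u L (K - L) * (conn w L * conn w (K - L)))"
  shows "(\<Sum>K\<in>subs v V. d K * boltz w (V - K) + conn w K * (sum u (edges (V - K)) * boltz w (V - K)))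
    = sum u (edges V) * boltz w V"
proof -
  have fin: "finite K" if "K \<in> subs v V" for K using that V by (auto simp: subs_def intro: finite_subset)
  \<comment> \<open>Each vertex \<open>j\<close> in \<open>V - K\<close> that interacts with
    \<open>K\<close> is sorted by its own component \<open>M\<close> within \<open>V - K\<close>;
    summing over the \<open>j\<close> in \<open>M\<close> restores the cut between \<open>K\<close>
    and \<open>M\<close>.\<close>
  have pair: "cut u K (V - K) * boltz w (V - K)
      = (\<Sum>M\<in>Pow (V - K). cut u K M * (conn w M * boltz w (V - K - M)))" if "K \<in> subs v V" for K
  proof -
    let ?L = "V - K"
    have "cut u K ?L * boltz w ?L = (\<Sum>j\<in>?L. (\<Sum>i\<in>K. u {i, j}) * boltz w ?L)"
      unfolding cut_def by (subst sum.swap) (simp add: sum_distrib_right)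
    also have "\<dots> = (\<Sum>j\<in>?L. \<Sum>M\<in>subs j ?L. (\<Sum>i\<in>K. u {i, j}) * (conn w M * boltz w (?L - M)))"
    proof (intro sum.cong refl)
      fix j assume "j \<in> ?L"
      then show "(\<Sum>i\<in>K. u {i, j}) * boltz w ?L
          = (\<Sum>M\<in>subs j ?L. (\<Sum>i\<in>K. u {i, j}) * (conn w M * boltz w (?L - M)))"
        using V boltz_conn[of ?L j w] by (simp add: sum_distrib_left)
    qed
    also have "\<dots> = (\<Sum>(j, M)\<in>(SIGMA j:?L. subs j ?L). (\<Sum>i\<in>K. u {i, j}) * (conn w M * boltz w (?L - M)))"
      using V by (intro sum.Sigma) (auto simp: finite_subs)
    also have "\<dots> = (\<Sum>(M, j)\<in>(SIGMA M:Pow ?L. M). (\<Sum>i\<in>K. u {i, j}) * (conn w M * boltz w (?L - M)))"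
      by (rule sum.reindex_bij_witness[where i = "\<lambda>(a, b). (b, a)" and j = "\<lambda>(a, b). (b, a)"])
        (auto simp: subs_def)
    also have "\<dots> = (\<Sum>M\<in>Pow ?L. \<Sum>j\<in>M. (\<Sum>i\<in>K. u {i, j}) * (conn w M * boltz w (?L - M)))"
      using V by (intro sum.Sigma[symmetric]) (auto intro: finite_subset)
    also have "\<dots> = (\<Sum>M\<in>Pow ?L. cut u K M * (conn w M * boltz w (?L - M)))"
      unfolding cut_def by (subst sum.swap) (simp add: sum_distrib_right)
    finally show ?thesis .
  qed
  have "(\<Sum>K\<in>subs v V. (\<Sum>L\<in>subs v K. cut u L (K - L) * (conn w L * conn w (K - L))) * boltz w (V - K))
      = (\<Sum>(K, L)\<in>(SIGMA K:subs v V. subs v K). cut u L (K - L) * (conn w L * conn w (K - L)) * boltz w (V - K))"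
    unfolding sum_distrib_right using V fin by (intro sum.Sigma) (auto simp: finite_subs)
  \<comment> \<open>The set \<open>K\<close> occurring in \<open>d\<close> is the union of the
    component \<open>L\<close> of \<open>v\<close> and the component \<open>M\<close> attached to
    it.\<close>
  also have "\<dots> = (\<Sum>(L, M)\<in>(SIGMA L:subs v V. Pow (V - L)). conn w L * (cut u L M * (conn w M * boltz w (V - L - M))))"
  proof (rule sum.reindex_bij_witness[where i = "\<lambda>(L, M). (L \<union> M, L)" and j = "\<lambda>(K, L). (L, K - L)"])
    fix p assume "p \<in> (SIGMA K:subs v V. subs v K)"
    then obtain K L where p: "p = (K, L)" "L \<subseteq> K" by (auto simp: subs_def)
    then have "V - L - (K - L) = V - K" by auto
    then show "(case case p of (K, L) \<Rightarrow> (L, K - L) of (L, M) \<Rightarrow> conn w L * (cut u L M * (conn w M * boltz w (V - L - M))))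
       = (case p of (K, L) \<Rightarrow> cut u L (K - L) * (conn w L * conn w (K - L)) * boltz w (V - K))"
      using p by (simp add: mult_ac)
  qed (auto simp: subs_def)
  also have "\<dots> = (\<Sum>L\<in>subs v V. \<Sum>M\<in>Pow (V - L). conn w L * (cut u L M * (conn w M * boltz w (V - L - M))))"
    using V by (intro sum.Sigma[symmetric]) (auto simp: finite_subs)
  also have "\<dots> = (\<Sum>L\<in>subs v V. conn w L * (cut u L (V - L) * boltz w (V - L)))"
    using pair by (intro sum.cong refl) (simp add: sum_distrib_left)
  finally have key: "(\<Sum>K\<in>subs v V. (\<Sum>L\<in>subs v K. cut u L (K - L) * (conn w L * conn w (K - L))) * boltz w (V - K))
      = (\<Sum>L\<in>subs v V. conn w L * (cut u L (V - L) * boltz w (V - L)))" .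
  have "sum u (edges V) * boltz w V = (\<Sum>K\<in>subs v V. sum u (edges V) * (conn w K * boltz w (V - K)))"
    using boltz_conn[OF V, of w] by (simp add: sum_distrib_left)
  also have "\<dots> = (\<Sum>K\<in>subs v V. sum u (edges K) * conn w K * boltz w (V - K) +
      conn w K * (sum u (edges (V - K)) * boltz w (V - K)) + conn w K * (cut u K (V - K) * boltz w (V - K)))"
  proof (intro sum.cong refl)
    fix K assume K: "K \<in> subs v V"
    then have "K \<union> (V - K) = V" by (auto simp: subs_def)
    then have "sum u (edges V) = sum u (edges K) + sum u (edges (V - K)) + cut u K (V - K)"
      using sum_edges_union[of K "V - K" u] fin[OF K] V by auto
    then show "sum u (edges V) * (conn w K * boltz w (V - K)) = sum u (edges K) * conn w K * boltz w (V - K) +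
      conn w K * (sum u (edges (V - K)) * boltz w (V - K)) + conn w K * (cut u K (V - K) * boltz w (V - K))"
      by (simp add: algebra_simps)
  qed
  finally show ?thesis
    unfolding d_def by (simp add: sum.distrib key distrib_right)
qed

lemma boltz_has_derivative:
  fixes W :: "'c::real_normed_field \<Rightarrow> 'v set \<Rightarrow> 'c"
  assumes "finite V"
    and dW: "\<And>e. e \<in> edges V \<Longrightarrow> ((\<lambda>s. W s e) has_field_derivative u e * (1 + W s0 e)) (at s0)"
  shows "((\<lambda>s. boltz (W s) V) has_field_derivative sum u (edges V) * boltz (W s0) V) (at s0)"
proof -
  have "((\<lambda>s. boltz (W s) V) has_field_derivative
      (\<Sum>e\<in>edges V. (u e * (1 + W s0 e)) * (\<Prod>y\<in>edges V - {e}. 1 + W s0 y))) (at s0)"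
    unfolding boltz_def using dW by (intro has_field_derivative_prod) (auto intro!: derivative_eq_intros)
  also have "(\<Sum>e\<in>edges V. (u e * (1 + W s0 e)) * (\<Prod>y\<in>edges V - {e}. 1 + W s0 y))
      = sum u (edges V) * boltz (W s0) V"
    unfolding sum_distrib_right boltz_def
    using assms by (intro sum.cong refl) (simp add: finite_edges prod.remove mult.assoc)
  finally show ?thesis .
qed

text \<open>The Brydges--Kennedy flow equation: along \<open>W' = u (1 + W)\<close> the Boltzmann weights satisfy
  \<open>boltz' = U boltz\<close>, and the second term arises from passing to connected parts.\<close>

lemma conn_has_derivative:
  fixes W :: "'c::real_normed_field \<Rightarrow> 'v set \<Rightarrow> 'c"
  assumes "finite V" "v \<in> V"
    and "\<And>e. e \<in> edges V \<Longrightarrow> ((\<lambda>s. W s e) has_field_derivative u e * (1 + W s0 e)) (at s0)"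
  shows "((\<lambda>s. conn (W s) V) has_field_derivative sum u (edges V) * conn (W s0) V +
     (\<Sum>K\<in>subs v V. cut u K (V - K) * (conn (W s0) K * conn (W s0) (V - K)))) (at s0)"
  using assms
proof (induction V rule: finite_psubset_induct)
  case (psubset V)
  define d where "d \<equiv> \<lambda>K. sum u (edges K) * conn (W s0) K +
     (\<Sum>L\<in>subs v K. cut u L (K - L) * (conn (W s0) L * conn (W s0) (K - L)))"
  let ?P = "subs v V - {V}"
  have sub: "((\<lambda>s. W s e) has_field_derivative u e * (1 + W s0 e)) (at s0)" if "e \<in> edges K" "K \<subseteq> V" for e K
    using that psubset.prems edges_mono by blast
  have split: "(\<Sum>K\<in>subs v V. g K) = g V + (\<Sum>K\<in>?P. g K)" for g :: "'v set \<Rightarrow> 'c"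
    using psubset by (intro sum.remove) (auto simp: subs_def)
  \<comment> \<open>Solving for the full connected sum expresses it by proper subsets, whose
    derivatives are known by induction, so differentiability need not be shown separately.\<close>
  have eq: "conn (W s) V = boltz (W s) V - (\<Sum>K\<in>?P. conn (W s) K * boltz (W s) (V - K))" for s
    using boltz_conn[OF psubset.hyps(1) psubset.prems(1), of "W s"] split by simp
  have "((\<lambda>s. conn (W s) V) has_field_derivative sum u (edges V) * boltz (W s0) V -
     (\<Sum>K\<in>?P. d K * boltz (W s0) (V - K) + conn (W s0) K * (sum u (edges (V - K)) * boltz (W s0) (V - K)))) (at s0)"
    unfolding eq
  proof (intro DERIV_diff DERIV_sum)
    show "((\<lambda>s. boltz (W s) V) has_field_derivative sum u (edges V) * boltz (W s0) V) (at s0)"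
      using psubset by (intro boltz_has_derivative) auto
    fix K assume K: "K \<in> ?P"
    have "((\<lambda>s. conn (W s) K) has_field_derivative d K) (at s0)"
      unfolding d_def using K sub by (intro psubset.IH) (auto simp: subs_def)
    moreover have "((\<lambda>s. boltz (W s) (V - K)) has_field_derivative sum u (edges (V - K)) * boltz (W s0) (V - K)) (at s0)"
      using psubset sub by (intro boltz_has_derivative) auto
    ultimately show "((\<lambda>s. conn (W s) K * boltz (W s) (V - K)) has_field_derivative
       d K * boltz (W s0) (V - K) + conn (W s0) K * (sum u (edges (V - K)) * boltz (W s0) (V - K))) (at s0)"
      by (auto intro!: derivative_eq_intros simp: mult_ac)
  qed
  moreover have "(\<Sum>K\<in>subs v V. d K * boltz (W s0) (V - K) +
      conn (W s0) K * (sum u (edges (V - K)) * boltz (W s0) (V - K))) = sum u (edges V) * boltz (W s0) V"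
    unfolding d_def by (rule boltz_leibniz[OF psubset.hyps(1) psubset.prems(1)])
  \<comment> \<open>Of the full Leibniz sum only the summand \<open>K = V\<close> is left, and it
    equals \<open>d V\<close> because the complement is empty.\<close>
  then have "sum u (edges V) * boltz (W s0) V -
     (\<Sum>K\<in>?P. d K * boltz (W s0) (V - K) + conn (W s0) K * (sum u (edges (V - K)) * boltz (W s0) (V - K))) = d V"
    unfolding split by (simp add: diff_eq_eq)
  ultimately show ?case unfolding d_def by simp
qed

text \<open>The left-hand side is a sum over graphs with a marked bridge in \<open>H\<close>. It is compared with the derivative
  of \<^const>\<open>conn\<close> in the direction of the weights in \<open>H\<close>, computed once by the flow equation and once graph by graph.\<close>

lemma conn_hard_le:
  fixes w :: "'v set \<Rightarrow> real"
  assumes V: "finite V" "v \<in> V" and w: "\<And>e. e \<in> edges V \<Longrightarrow> 0 \<le> w e"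
    and H: "\<And>e. e \<in> edges V \<Longrightarrow> e \<in> H \<Longrightarrow> w e = \<eta>" and \<eta>: "\<eta> > 0"
  shows "\<eta> * (\<Sum>K\<in>subs v V. cut (indicator H) K (V - K) * (conn w K * conn w (V - K)))
    \<le> sum (indicator H) (edges V) * conn w V"
proof -
  let ?I = "indicator H :: 'v set \<Rightarrow> real" and ?h = "sum (indicator H) (edges V) :: real"
  \<comment> \<open>The flow equation asks for the derivative at a single point only, so an affine
    curve through \<open>w\<close> with the right tangent suffices.\<close>
  define W where "W = (\<lambda>s e. w e + s * (?I e * (1 + w e)))"
  let ?X = "\<Sum>K\<in>subs v V. cut ?I K (V - K) * (conn w K * conn w (V - K))"
  have W0: "W 0 = w" by (simp add: W_def)
  have dW: "((\<lambda>s. W s e) has_field_derivative ?I e * (1 + w e)) (at 0)" for e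
    unfolding W_def by (auto intro!: derivative_eq_intros)
  have d1: "((\<lambda>s. conn (W s) V) has_field_derivative ?h * conn w V + ?X) (at 0)"
    using conn_has_derivative[OF V, of W ?I 0] dW unfolding W0 by auto
  have d2: "((\<lambda>s. conn (W s) V) has_field_derivative
      (\<Sum>G\<in>spanning_graphs V. \<Sum>e\<in>G. (?I e * (1 + w e)) * (\<Prod>y\<in>G - {e}. w y))) (at 0)"
    unfolding conn_def
  proof (intro DERIV_sum)
    fix G
    have "((\<lambda>s. \<Prod>e\<in>G. W s e) has_field_derivative
      (\<Sum>e\<in>G. (?I e * (1 + w e)) * (\<Prod>y\<in>G - {e}. W 0 y))) (at 0)"
      by (intro has_field_derivative_prod dW)
    then show "((\<lambda>s. \<Prod>e\<in>G. W s e) has_field_derivative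
      (\<Sum>e\<in>G. (?I e * (1 + w e)) * (\<Prod>y\<in>G - {e}. w y))) (at 0)" unfolding W0 .
  qed
  have "\<eta> * (?h * conn w V + ?X) =
      \<eta> * (\<Sum>G\<in>spanning_graphs V. \<Sum>e\<in>G. (?I e * (1 + w e)) * (\<Prod>y\<in>G - {e}. w y))"
    unfolding DERIV_unique[OF d1 d2] ..
  also have "\<dots> = (\<Sum>G\<in>spanning_graphs V. \<Sum>e\<in>G. \<eta> * ((?I e * (1 + w e)) * (\<Prod>y\<in>G - {e}. w y)))"
    by (simp add: sum_distrib_left)
  also have "\<dots> \<le> (\<Sum>G\<in>spanning_graphs V. ?h * ((1 + \<eta>) * prod w G))"
  proof (intro sum_mono)
    fix G assume G: "G \<in> spanning_graphs V"
    have GE: "G \<subseteq> edges V" "finite G" using G V finite_spanning_graph by (auto simp: spanning_graphs_def)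
    \<comment> \<open>For an edge of \<open>H\<close> the factor \<open>\<eta>\<close> is its own
      weight and restores the edge that differentiation removed from the product.\<close>
    have "(\<Sum>e\<in>G. \<eta> * ((?I e * (1 + w e)) * (\<Prod>y\<in>G - {e}. w y))) = (\<Sum>e\<in>G. ?I e * ((1 + \<eta>) * prod w G))"
    proof (intro sum.cong refl)
      fix e assume e: "e \<in> G"
      show "\<eta> * ((?I e * (1 + w e)) * (\<Prod>y\<in>G - {e}. w y)) = ?I e * ((1 + \<eta>) * prod w G)"
      proof (cases "e \<in> H")
        case True
        then have "w e = \<eta>" using e GE H by auto
        then show ?thesis using True GE e by (simp add: prod.remove[of G e w])
      qed simp
    qed
    also have "\<dots> = (\<Sum>e\<in>G. ?I e) * ((1 + \<eta>) * prod w G)" by (rule sum_distrib_right[symmetric])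
    also have "\<dots> \<le> ?h * ((1 + \<eta>) * prod w G)"
      using GE V w \<eta> by (intro mult_right_mono sum_mono2 mult_nonneg_nonneg prod_nonneg) (auto simp: finite_edges)
    finally show "(\<Sum>e\<in>G. \<eta> * ((?I e * (1 + w e)) * (\<Prod>y\<in>G - {e}. w y))) \<le> ?h * ((1 + \<eta>) * prod w G)" .
  qed
  also have "\<dots> = ?h * (1 + \<eta>) * conn w V"
    by (simp add: conn_def sum_distrib_left mult.assoc)
  \<comment> \<open>The terms \<open>\<eta> * ?h * conn w V\<close> on both sides cancel.\<close>
  finally show ?thesis by (simp add: algebra_simps)
qed

lemma cut_of_minus: "cut (\<lambda>e. - u e) K L = - cut u K (L::'v set)" for u :: "'v set \<Rightarrow> 'c::ab_group_add"
  by (simp add: cut_def sum_negf)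

lemma norm_cut_le: "norm (cut u K L) \<le> cut (\<lambda>e. norm (u e)) K L"
  unfolding cut_def by (rule order.trans[OF norm_sum], intro sum_mono norm_sum)

lemma cut_nonneg: "(\<And>e. 0 \<le> u e) \<Longrightarrow> 0 \<le> cut u K (L::'v set)" for u :: "'v set \<Rightarrow> real"
  unfolding cut_def by (intro sum_nonneg)

text \<open>Hard-core pairs carry the finite potential \<open>R\<close>; the factor \<open>exp (- s R)\<close> they bring into the flow pays for
  the edge weight \<open>R\<close>, so that in the majorant a hard-core edge costs only \<open>R / (R - c)\<close>, which tends to 1. The majorant is a sum over
  connected graphs at coupling \<open>\<epsilon>\<close>, rescaled such that trees remain as \<open>\<epsilon>\<close> tends to 0.\<close>

lemma conn_le_majorant:
  fixes u :: "'v set \<Rightarrow> complex" and b :: "'v \<Rightarrow> real" and R c \<epsilon> :: real and H :: "'v set set"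
  assumes V0: "finite V0" and b: "\<And>i. i \<in> V0 \<Longrightarrow> 0 \<le> b i" and R: "c < R" "0 \<le> c" and \<epsilon>: "\<epsilon> > 0"
  defines "uR \<equiv> \<lambda>e. if e \<in> H then of_real R else u e"
  assumes stab: "\<And>V. V \<subseteq> V0 \<Longrightarrow> - sum b V + (R - c) * sum (indicator H) (edges V) \<le> Re (sum uR (edges V))"
  defines "W \<equiv> \<lambda>s e. if e \<in> H then R / (R - c) * \<epsilon> else exp (\<epsilon> * s * norm (u e)) - 1"
  assumes VV: "V \<subseteq> V0" "V \<noteq> {}" "0 \<le> s"
  shows "norm (conn (\<lambda>e. exp (- of_real s * uR e) - 1) V) \<le> exp (s * sum b V) * conn (W s) V / \<epsilon> ^ (card V - 1)"
proof -
  define \<phi> where "\<phi> = (\<lambda>z V. conn (\<lambda>e. exp (- z * uR e) - 1) V)"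
  define E where "E = (\<lambda>s V. exp (s * sum b V) * conn (W s) V / \<epsilon> ^ (card V - 1))"
  \<comment> \<open>\<open>q\<close> is the rate in \<open>W' = q * (1 + W)\<close>. Hard-core
    weights do not depend on \<open>s\<close>, hence rate 0; their share of the flow is handled by
    \<open>conn_hard_le\<close> instead.\<close>
  define q where "q = (\<lambda>e. if e \<in> H then 0 else \<epsilon> * norm (u e))"
  have "finite V" using VV V0 finite_subset by auto
  from this VV have "norm (\<phi> (of_real s) V) \<le> E s V"
  proof (induction V arbitrary: s rule: finite_psubset_induct)
    case (psubset V)
    have W0: "0 \<le> W s e" if "0 \<le> s" for s e
      using that R \<epsilon> by (auto simp: W_def)
    have cnn: "0 \<le> conn (W s) K" if "0 \<le> s" for s K
      using W0[OF that] by (intro conn_nonneg)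
    show ?case
    proof (cases "\<exists>v. V = {v}")
      case True
      then obtain v where "V = {v}" by auto
      \<comment> \<open>Both connected sums are 1, and \<open>1 \<le> exp (s * b v)\<close> since
        \<open>s\<close> and \<open>b v\<close> are nonnegative.\<close>
      then show ?thesis using psubset.prems b[of v] by (simp add: E_def \<phi>_def)
    next
      case False
      obtain v where v: "v \<in> V" using psubset.prems by auto
      then obtain v' where v': "v' \<in> V" "v' \<noteq> v" using False by auto
      define U where "U = sum uR (edges V)"
      define F where "F = (\<lambda>s. exp (s * sum b V) / \<epsilon> ^ (card V - 1))"
      \<comment> \<open>The integrating factor cancels the term linear in the energy, so
        \<open>f'\<close> contains only splittings of \<open>V\<close>. Below, \<open>p\<close> is
        the majorant times the modulus of the same factor, and the goal becomes a comparison of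
        derivatives.\<close>
      define f where "f = (\<lambda>z. exp (z * U) * \<phi> z V)"
      define f' where "f' = (\<lambda>z. exp (z * U) * - (\<Sum>K\<in>subs v V. cut uR K (V - K) * (\<phi> z K * \<phi> z (V - K))))"
      define p where "p = (\<lambda>s. exp (s * Re U) * (F s * conn (W s) V))"
      define Q where "Q = (\<lambda>s. \<Sum>K\<in>subs v V. cut q K (V - K) * (conn (W s) K * conn (W s) (V - K)))"
      define X where "X = (\<lambda>s. \<Sum>K\<in>subs v V. cut (indicator H) K (V - K) * (conn (W s) K * conn (W s) (V - K)))"
      define p' where "p' = (\<lambda>s. exp (s * Re U) * F s * ((Re U + sum b V + sum q (edges V)) * conn (W s) V + Q s))"
      have F: "0 < F s" for s using \<epsilon> by (simp add: F_def)
      have df: "(f has_field_derivative f' z) (at z)" for z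
      proof -
        have "((\<lambda>z. \<phi> z V) has_field_derivative sum (\<lambda>e. - uR e) (edges V) * \<phi> z V +
            (\<Sum>K\<in>subs v V. cut (\<lambda>e. - uR e) K (V - K) * (\<phi> z K * \<phi> z (V - K)))) (at z)"
          unfolding \<phi>_def
          by (rule conn_has_derivative[OF psubset.hyps(1) v]) (auto intro!: derivative_eq_intros)
        then have "(f has_field_derivative (exp (z * U) * U) * \<phi> z V + (sum (\<lambda>e. - uR e) (edges V) * \<phi> z V +
            (\<Sum>K\<in>subs v V. cut (\<lambda>e. - uR e) K (V - K) * (\<phi> z K * \<phi> z (V - K)))) * exp (z * U)) (at z)"
          unfolding f_def by (intro DERIV_mult) (auto intro!: derivative_eq_intros)
        then show ?thesis
          by (simp add: f'_def cut_of_minus sum_negf U_def algebra_simps)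
      qed
      have dp: "(p has_real_derivative p' s) (at s)" for s
      proof -
        have "((\<lambda>s. conn (W s) V) has_field_derivative sum q (edges V) * conn (W s) V + Q s) (at s)"
          unfolding Q_def
          by (rule conn_has_derivative[OF psubset.hyps(1) v])
            (auto simp: W_def q_def intro!: derivative_eq_intros)
        moreover have "((\<lambda>s. exp (s * Re U)) has_real_derivative exp (s * Re U) * Re U) (at s)"
          by (auto intro!: derivative_eq_intros)
        moreover have "(F has_real_derivative F s * sum b V) (at s)"
          unfolding F_def using \<epsilon> by (auto intro!: derivative_eq_intros)
        ultimately have "(p has_real_derivative exp (s * Re U) * Re U * (F s * conn (W s) V) +
           (F s * sum b V * conn (W s) V + (sum q (edges V) * conn (W s) V + Q s) * F s) * exp (s * Re U)) (at s)"
          unfolding p_def by (intro DERIV_mult)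
        then show ?thesis by (simp add: p'_def algebra_simps)
      qed
      have bound: "norm (f' (of_real s)) \<le> p' s" if "0 \<le> s" for s
      proof -
        have EE: "norm (cut uR K (V - K) * (\<phi> (of_real s) K * \<phi> (of_real s) (V - K))) \<le>
            F s * (\<epsilon> * R * (cut (indicator H) K (V - K) * (conn (W s) K * conn (W s) (V - K))) +
              cut q K (V - K) * (conn (W s) K * conn (W s) (V - K)))"
          if K: "K \<in> subs v V" for K
        proof (cases "K = V")
          case False
          have KV: "K \<subset> V" "V - K \<subset> V" "K \<noteq> {}" "V - K \<noteq> {}" using K False by (auto simp: subs_def)
          have fK: "finite K" "finite (V - K)" using KV psubset.hyps finite_subset by auto
          have k: "norm (\<phi> (of_real s) K) \<le> E s K" "norm (\<phi> (of_real s) (V - K)) \<le> E s (V - K)"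
            using KV psubset.prems \<open>0 \<le> s\<close> by (auto intro!: psubset.IH)
          have "card K + card (V - K) = card V"
            using KV psubset.hyps by (metis card_Diff_subset card_mono fK(1) le_add_diff_inverse psubset_imp_subset)
          moreover have "card K \<ge> 1" "card (V - K) \<ge> 1"
            using KV fK by (auto simp: Suc_le_eq card_gt_0_iff)
          \<comment> \<open>Exponents count tree edges: the trees on the two parts, and the one edge
            that joins them.\<close>
          ultimately have "card V - 1 = (card K - 1) + (card (V - K) - 1) + 1" by simp
          then have \<epsilon>p: "\<epsilon> ^ (card V - 1) = \<epsilon> ^ (card K - 1) * \<epsilon> ^ (card (V - K) - 1) * \<epsilon>"
            by (metis power_add power_one_right)
          have "sum b V = sum b K + sum b (V - K)"
            using KV psubset.hyps by (metis add.commute psubset_imp_subset sum.subset_diff)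
          then have eq: "E s K * E s (V - K) = F s * \<epsilon> * (conn (W s) K * conn (W s) (V - K))"
            using \<epsilon> unfolding E_def F_def \<epsilon>p by (simp add: field_simps exp_add)
          have "norm (cut uR K (V - K) * (\<phi> (of_real s) K * \<phi> (of_real s) (V - K)))
              \<le> cut (\<lambda>e. norm (uR e)) K (V - K) * (E s K * E s (V - K))"
            unfolding norm_mult using k by (intro mult_mono norm_cut_le) (auto intro!: mult_nonneg_nonneg cut_nonneg order.trans[OF norm_ge_zero k(1)] )
          also have "cut (\<lambda>e. norm (uR e)) K (V - K) = R * cut (indicator H) K (V - K) + cut q K (V - K) / \<epsilon>"
            unfolding cut_def sum_distrib_left sum_divide_distrib sum.distrib[symmetric]
            using \<epsilon> R by (intro sum.cong refl) (auto simp: uR_def q_def indicator_def)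
          also have "(R * cut (indicator H) K (V - K) + cut q K (V - K) / \<epsilon>) * (E s K * E s (V - K)) =
            F s * (\<epsilon> * R * (cut (indicator H) K (V - K) * (conn (W s) K * conn (W s) (V - K))) +
              cut q K (V - K) * (conn (W s) K * conn (W s) (V - K)))"
            unfolding eq using \<epsilon> by (simp add: field_simps)
          finally show ?thesis .
        qed simp
        have "norm (f' (of_real s)) = exp (s * Re U) * norm (\<Sum>K\<in>subs v V. cut uR K (V - K) * (\<phi> (of_real s) K * \<phi> (of_real s) (V - K)))"
          by (simp add: f'_def norm_mult)
        also have "\<dots> \<le> exp (s * Re U) * (\<Sum>K\<in>subs v V. F s * (\<epsilon> * R * (cut (indicator H) K (V - K) * (conn (W s) K * conn (W s) (V - K))) +
              cut q K (V - K) * (conn (W s) K * conn (W s) (V - K))))"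
          by (intro mult_left_mono sum_norm_le EE) auto
        also have "\<dots> = exp (s * Re U) * F s * (\<epsilon> * R * X s + Q s)"
          by (simp add: X_def Q_def sum_distrib_left sum.distrib distrib_left mult.assoc)
        also have "\<dots> \<le> p' s"
          unfolding p'_def
        proof (intro mult_left_mono add_right_mono)
          \<comment> \<open>Hard-core splittings cost \<open>\<epsilon> * R * X s\<close>. Stability
            supplies the rate \<open>R - c\<close> per hard-core pair, and the weight
            \<open>R / (R - c) * \<epsilon>\<close> is chosen so that \<open>conn_hard_le\<close>
            turns the one exactly into the other.\<close>
          have "R / (R - c) * \<epsilon> * X s \<le> sum (indicator H) (edges V) * conn (W s) V"
            unfolding X_def using W0[OF that] R \<epsilon> by (intro conn_hard_le psubset.hyps v) (auto simp: W_def)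
          then have "(R - c) * (R / (R - c) * \<epsilon> * X s) \<le> (R - c) * (sum (indicator H) (edges V) * conn (W s) V)"
            using R by (intro mult_left_mono) auto
          then have "\<epsilon> * R * X s \<le> (R - c) * (sum (indicator H) (edges V)) * conn (W s) V"
            using R by (simp add: mult_ac)
          also have "\<dots> \<le> (Re U + sum b V + sum q (edges V)) * conn (W s) V"
          proof (intro mult_right_mono cnn that)
            have "0 \<le> sum q (edges V)" using \<epsilon> by (intro sum_nonneg) (auto simp: q_def)
            then show "(R - c) * sum (indicator H) (edges V) \<le> Re U + sum b V + sum q (edges V)"
              using stab[of V] psubset.prems by (simp add: U_def)
          qed
          finally show "\<epsilon> * R * X s \<le> (Re U + sum b V + sum q (edges V)) * conn (W s) V" .
        qed (use F[of s] in auto)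
        finally show ?thesis .
      qed
      show ?thesis
      proof (cases "s = 0")
        case True
        then have "\<phi> (of_real s) V = 0"
          using conn_zero[OF psubset.hyps(1) v v'(1)] v' by (simp add: \<phi>_def)
        then show ?thesis using cnn[of 0] True \<epsilon> by (simp add: E_def)
      next
        case False
        then have s: "0 < s" using psubset.prems by simp
        have "norm (f (of_real s) - f (of_real 0)) \<le> p s - p 0"
        proof (rule differentiable_bound_general[OF s, where f = "\<lambda>x. f (of_real x)" and f' = "\<lambda>x. f' (of_real x)" and \<phi>' = p'])
          show vd: "((\<lambda>x. f (of_real x)) has_vector_derivative f' (of_real x)) (at x)" for x :: real
            by (rule has_vector_derivative_real_field[OF df])
          show pd: "(p has_vector_derivative p' x) (at x)" for x
            using dp by (simp add: has_real_derivative_iff_has_vector_derivative)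
          show "continuous_on {0..s} (\<lambda>x. f (of_real x))"
            using vd has_vector_derivative_continuous continuous_at_imp_continuous_on by blast
          show "continuous_on {0..s} p"
            using pd has_vector_derivative_continuous continuous_at_imp_continuous_on by blast
        qed (use bound in auto)
        moreover have "f (of_real 0) = 0"
          using conn_zero[OF psubset.hyps(1) v v'(1)] v' by (simp add: \<phi>_def f_def)
        \<comment> \<open>\<open>p 0\<close> may be positive, since hard-core edges keep their
          weight at coupling 0; only its sign is needed.\<close>
        moreover have "0 \<le> p 0" using cnn[of 0] F[of 0] by (simp add: p_def)
        ultimately have "norm (f (of_real s)) \<le> p s" by simp
        then have "exp (s * Re U) * norm (\<phi> (of_real s) V) \<le> exp (s * Re U) * E s V"
          by (simp add: f_def p_def F_def E_def norm_mult)
        then show ?thesis by simp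
      qed
    qed
  qed
  then show ?thesis by (simp add: \<phi>_def E_def)
qed

text \<open>With \<open>R = 1 / \<epsilon>\<close> a single limit does both jobs: the finite
  repulsion becomes a hard core, and the rescaled majorant loses all graphs except trees. The
  constant \<open>c\<close> bounds the total soft energy and stays fixed as \<open>R\<close>
  grows.\<close>

lemma norm_conn_le_forest:
  fixes u :: "'v set \<Rightarrow> complex" and b :: "'v \<Rightarrow> real" and H :: "'v set set"
  assumes V: "finite V" "v \<in> V" and b: "\<And>i. i \<in> V \<Longrightarrow> 0 \<le> b i"
  defines "z \<equiv> \<lambda>e. if e \<in> H then -1 else exp (- u e) - 1"
  assumes stab: "\<And>A. A \<subseteq> V \<Longrightarrow> (\<Prod>e\<in>edges A. norm (1 + z e)) \<le> (\<Prod>i\<in>A. exp (b i))"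
  shows "norm (conn z V) \<le> (\<Prod>i\<in>V. exp (b i)) * forest (\<lambda>e. norm (if e \<in> H then 1 else u e)) {v} (V - {v})"
proof -
  define c where "c = (\<Sum>e\<in>edges V. norm (u e))"
  have c0: "0 \<le> c" by (simp add: c_def sum_nonneg)
  define zR where "zR = (\<lambda>\<epsilon> e. exp (- (if e \<in> H then of_real (1 / \<epsilon>) else u e)) - 1)"
  define W where "W = (\<lambda>\<epsilon> e. if e \<in> H then (1 / \<epsilon>) / (1 / \<epsilon> - c) * \<epsilon> else exp (\<epsilon> * norm (u e)) - 1)"
  have le: "norm (conn (zR \<epsilon>) V) \<le> exp (sum b V) * (ursell (W \<epsilon>) {v} (V - {v}) / \<epsilon> ^ card (V - {v}))"
    if \<epsilon>: "0 < \<epsilon>" "c < 1 / \<epsilon>" for \<epsilon>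
  proof -
    let ?uR = "\<lambda>e. if e \<in> H then of_real (1 / \<epsilon>) else u e"
    have "- sum b A + (1 / \<epsilon> - c) * sum (indicator H) (edges A) \<le> Re (sum ?uR (edges A))" if A: "A \<subseteq> V" for A
    \<comment> \<open>Without a hard-core pair this is the logarithm of the stability assumption.
      With one, that assumption only bounds 0, and the repulsion itself has to outweigh the soft
      energy.\<close>
    proof (cases "edges A \<inter> H = {}")
      case True
      then have eq: "(e \<in> H) = False" if "e \<in> edges A" for e using that by auto
      have "(\<Prod>e\<in>edges A. norm (1 + z e)) = (\<Prod>e\<in>edges A. exp (- Re (u e)))"
        by (intro prod.cong refl) (simp add: z_def eq)
      then have "exp (\<Sum>e\<in>edges A. - Re (u e)) \<le> exp (sum b A)"
        using stab[OF A] V A finite_subset[OF A] by (simp add: exp_sum finite_edges)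
      moreover have "sum (indicator H) (edges A) = (0::real)" using eq by (intro sum.neutral) auto
      moreover have "sum ?uR (edges A) = sum u (edges A)" by (intro sum.cong refl) (simp add: eq)
      ultimately show ?thesis by (simp add: sum_negf)
    next
      case False
      have fA: "finite A" "finite (edges A)" using finite_subset[OF A] V finite_edges by auto
      let ?h = "sum (indicator H) (edges A) :: real"
      obtain e where e: "e \<in> edges A" "e \<in> H" using False by auto
      have "indicator H e \<le> ?h" using e fA by (intro member_le_sum) auto
      then have h: "1 \<le> ?h" using e by simp
      have "- c \<le> - (\<Sum>e\<in>edges A. norm (u e))"
        unfolding c_def using V edges_mono[OF A] by (auto intro!: sum_mono2 finite_edges)
      also have "\<dots> = (\<Sum>e\<in>edges A. - norm (u e))" by (simp add: sum_negf)
      also have "\<dots> \<le> (\<Sum>e\<in>edges A. Re (?uR e) - (1 / \<epsilon>) * indicator H e)"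
        using abs_Re_le_cmod by (intro sum_mono) (auto simp: indicator_def abs_le_iff minus_le_iff)
      also have "\<dots> = Re (sum ?uR (edges A)) - (1 / \<epsilon>) * ?h"
        by (simp add: sum_subtractf sum_distrib_left)
      finally have "(1 / \<epsilon>) * ?h - c \<le> Re (sum ?uR (edges A))" by simp
      \<comment> \<open>The soft energy costs \<open>c\<close> only once; as there is at least one
        hard-core pair, charging it to every such pair is allowed and gives the rate
        \<open>1 / \<epsilon> - c\<close> per pair.\<close>
      moreover have "c * 1 \<le> c * ?h" using h c0 by (intro mult_left_mono)
      moreover have "0 \<le> sum b A" using A b by (intro sum_nonneg) auto
      ultimately show ?thesis by (simp add: left_diff_distrib)
    qed
    then have "norm (conn (\<lambda>e. exp (- of_real 1 * ?uR e) - 1) V) \<le> exp (1 * sum b V) *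
        conn (\<lambda>e. if e \<in> H then (1 / \<epsilon>) / (1 / \<epsilon> - c) * \<epsilon> else exp (\<epsilon> * 1 * norm (u e)) - 1) V / \<epsilon> ^ (card V - 1)"
      using V b \<epsilon> c0 by (intro conn_le_majorant[where V0 = V]) auto
    then have "norm (conn (zR \<epsilon>) V) \<le> exp (sum b V) * conn (W \<epsilon>) V / \<epsilon> ^ (card V - 1)"
      by (simp add: zR_def W_def cong: if_cong)
    then show ?thesis using V by (simp add: ursell_conn)
  qed
  have inv: "filterlim (\<lambda>\<epsilon>::real. 1 / \<epsilon>) at_top (at_right 0)"
    using filterlim_inverse_at_top_right by (simp add: inverse_eq_divide)
  have "((\<lambda>\<epsilon>. exp (sum b V) * (ursell (W \<epsilon>) {v} (V - {v}) / \<epsilon> ^ card (V - {v}))) \<longlongrightarrow>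
     exp (sum b V) * forest (\<lambda>e. norm (if e \<in> H then 1 else u e)) {v} (V - {v})) (at_right 0)"
  proof (intro tendsto_mult tendsto_const ursell_tendsto_forest[where V = V])
    fix e
    show "((\<lambda>\<epsilon>. W \<epsilon> e / \<epsilon>) \<longlongrightarrow> norm (if e \<in> H then 1 else u e)) (at_right 0)"
    proof (cases "e \<in> H")
      case True
      have "((\<lambda>\<epsilon>. 1 / (1 - c * \<epsilon>)) \<longlongrightarrow> 1 / (1 - c * 0)) (at_right 0)"
        by (intro tendsto_intros) auto
      moreover have "\<forall>\<^sub>F \<epsilon> in at_right 0. 1 / (1 - c * \<epsilon>) = W \<epsilon> e / \<epsilon>"
      proof -
        have "1 / (1 - c * \<epsilon>) = W \<epsilon> e / \<epsilon>" if "0 < \<epsilon>" for \<epsilon>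
        proof -
          have "1 / \<epsilon> - c = (1 - c * \<epsilon>) / \<epsilon>" using that by (simp add: field_simps)
          then show ?thesis using True that by (simp add: W_def)
        qed
        then show ?thesis by (auto simp: eventually_at_filter)
      qed
      ultimately show ?thesis using True by (simp add: tendsto_cong)
    next
      case False
      have "((\<lambda>\<epsilon>. exp (\<epsilon> * norm (u e))) has_real_derivative norm (u e)) (at 0)"
        by (auto intro!: derivative_eq_intros)
      then have "((\<lambda>\<epsilon>. W \<epsilon> e / \<epsilon>) \<longlongrightarrow> norm (u e)) (at 0)"
        using False by (simp add: has_field_derivative_iff W_def)
      then show ?thesis using False by (simp add: filterlim_at_split)
    qed
  qed (use V in auto)
  moreover have "((\<lambda>\<epsilon>. norm (conn (zR \<epsilon>) V)) \<longlongrightarrow> norm (conn z V)) (at_right 0)"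
    unfolding conn_def
  proof (intro tendsto_norm tendsto_sum tendsto_prod)
    fix e
    show "((\<lambda>\<epsilon>. zR \<epsilon> e) \<longlongrightarrow> z e) (at_right 0)"
    proof (cases "e \<in> H")
      case True
      have "((\<lambda>\<epsilon>::real. exp (- (1 / \<epsilon>))) \<longlongrightarrow> 0) (at_right 0)"
        using inv by (intro filterlim_compose[OF exp_at_bot]) (simp add: filterlim_uminus_at_bot)
      then have "((\<lambda>\<epsilon>::real. of_real (exp (- (1 / \<epsilon>))) - 1) \<longlongrightarrow> of_real 0 - (1::complex)) (at_right 0)"
        by (intro tendsto_intros)
      then show ?thesis using True by (simp add: zR_def z_def exp_of_real[symmetric] del: of_real_divide)
    qed (simp add: zR_def z_def)
  qed
  moreover have "\<forall>\<^sub>F \<epsilon> in at_right 0. norm (conn (zR \<epsilon>) V) \<le> exp (sum b V) * (ursell (W \<epsilon>) {v} (V - {v}) / \<epsilon> ^ card (V - {v}))"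
  proof -
    have "\<forall>\<^sub>F \<epsilon> in at_right 0. c < 1 / \<epsilon>" using inv by (simp add: filterlim_at_top_dense)
    moreover have "\<forall>\<^sub>F \<epsilon>::real in at_right 0. 0 < \<epsilon>" by (auto simp: eventually_at_filter)
    ultimately show ?thesis by eventually_elim (rule le)
  qed
  ultimately have "norm (conn z V) \<le> exp (sum b V) * forest (\<lambda>e. norm (if e \<in> H then 1 else u e)) {v} (V - {v})"
    by (intro tendsto_le[OF trivial_limit_at_right_real])
  then show ?thesis using V by (simp add: exp_sum)
qed

section \<open>Relabelling and measurability\<close>

lemma edges_image:
  assumes "inj_on p V"
  shows "edges (p ` V) = image p ` edges V"
proof
  show "edges (p ` V) \<subseteq> image p ` edges V"
  proof
    fix e assume "e \<in> edges (p ` V)"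
    then obtain i j where "e = {p i, p j}" "i \<in> V" "j \<in> V" "p i \<noteq> p j"
      by (elim edges_cases) auto
    then have "e = p ` {i, j}" "{i, j} \<in> edges V" by (auto simp: edges_pair_iff)
    then show "e \<in> image p ` edges V" by blast
  qed
  show "image p ` edges V \<subseteq> edges (p ` V)"
    using assms by (auto elim!: edges_cases simp: edges_pair_iff inj_on_def)
qed

lemma inj_on_image_edges: "inj_on p V \<Longrightarrow> inj_on (image p) (edges V)"
  by (rule inj_on_subset[OF inj_on_image_Pow]) (auto simp: edges_def)

lemma boltz_image: "inj_on p V \<Longrightarrow> boltz w (p ` V) = boltz (\<lambda>e. w (p ` e)) V"
  unfolding boltz_def edges_image by (subst prod.reindex) (auto intro: inj_on_image_edges)

lemma boltz_cong: "(\<And>e. e \<in> edges V \<Longrightarrow> w e = w' e) \<Longrightarrow> boltz w V = boltz w' V"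
  unfolding boltz_def by (intro prod.cong) auto

lemma ursell_cong: "(\<And>e. e \<in> edges (A \<union> B) \<Longrightarrow> w e = w' e) \<Longrightarrow> ursell w A B = ursell w' A B"
  unfolding ursell_def by (intro sum.cong prod.cong refl) (auto simp: rooted_graphs_def)

lemma conn_cong: "(\<And>e. e \<in> edges V \<Longrightarrow> w e = w' e) \<Longrightarrow> conn w V = conn w' V"
  unfolding conn_def by (intro sum.cong prod.cong refl) (auto simp: spanning_graphs_def)

lemma boltz_conn_remove:
  assumes "finite V" "v \<in> V"
  shows "boltz w V = conn w V + (\<Sum>K\<in>subs v V - {V}. conn w K * boltz w (V - K))"
  unfolding boltz_conn[OF assms] using assms
  by (subst sum.remove[of _ V]) (auto simp: finite_subs subs_def)

text \<open>Paths are not transported along \<open>p\<close>. The recursion determines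
  \<open>conn\<close> from \<open>boltz\<close>, for which relabelling is a mere reindexing of a
  product.\<close>

lemma conn_image:
  assumes "finite V" "v \<in> V" "inj_on p V"
  shows "conn w (p ` V) = conn (\<lambda>e. w (p ` e)) V"
  using assms
proof (induction V rule: finite_psubset_induct)
  case (psubset V)
  have "(\<Sum>K\<in>subs (p v) (p ` V) - {p ` V}. conn w K * boltz w (p ` V - K))
      = (\<Sum>K\<in>subs v V - {V}. conn (\<lambda>e. w (p ` e)) K * boltz (\<lambda>e. w (p ` e)) (V - K))"
  proof (rule sum.reindex_bij_witness[where j = "\<lambda>K. {x\<in>V. p x \<in> K}" and i = "image p"])
    fix K assume K: "K \<in> subs (p v) (p ` V) - {p ` V}"
    let ?K = "{x\<in>V. p x \<in> K}"
    have img: "p ` ?K = K" using K by (auto simp: subs_def)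
    then show "p ` {x\<in>V. p x \<in> K} = K" .
    have "?K \<noteq> V" using K img by auto
    then show K': "?K \<in> subs v V - {V}" using K psubset.prems by (auto simp: subs_def)
    have "p ` V - p ` ?K = p ` (V - ?K)" using psubset.prems by (auto simp: inj_on_def)
    moreover have "inj_on p (V - ?K)" "inj_on p ?K" using psubset.prems by (auto intro: inj_on_subset)
    moreover have "conn w (p ` ?K) = conn (\<lambda>e. w (p ` e)) ?K"
      using K' psubset.prems by (intro psubset.IH) (auto simp: subs_def intro: inj_on_subset)
    ultimately show "conn (\<lambda>e. w (p ` e)) ?K * boltz (\<lambda>e. w (p ` e)) (V - ?K) = conn w K * boltz w (p ` V - K)"
      using boltz_image[of p "V - ?K" w] by (simp add: img)
  next
    fix K assume K: "K \<in> subs v V - {V}"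
    then have KV: "K \<subseteq> V" "v \<in> K" "K \<noteq> V" by (auto simp: subs_def)
    show eq: "{x \<in> V. p x \<in> p ` K} = K" using KV psubset.prems by (auto simp: inj_on_def)
    then have "p ` K \<noteq> p ` V" using KV by auto
    then show "p ` K \<in> subs (p v) (p ` V) - {p ` V}" using KV by (auto simp: subs_def)
  qed
  with boltz_conn_remove[of "p ` V" "p v" w] boltz_conn_remove[of V v "\<lambda>e. w (p ` e)"]
    boltz_image[of p V w] psubset.hyps psubset.prems
  show ?case by simp
qed

lemma forest_cong:
  assumes "finite A" "finite B" "A \<inter> B = {}" "\<And>e. e \<in> edges (A \<union> B) \<Longrightarrow> w e = w' e"
  shows "forest w A B = forest w' A B"
proof (rule tendsto_unique[OF _ tendsto_forest_scaled[OF assms(1-3)]])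
  have "ursell (\<lambda>e. \<epsilon> * w e) A B = ursell (\<lambda>e. \<epsilon> * w' e) A B" for \<epsilon>
    using assms(4) by (intro ursell_cong) simp
  then show "((\<lambda>\<epsilon>. ursell (\<lambda>e. \<epsilon> * w e) A B / \<epsilon> ^ card B) \<longlongrightarrow> forest w' A B) (at_right 0)"
    using tendsto_forest_scaled[OF assms(1-3), of w'] by simp
qed simp

lemma forest_image:
  assumes "finite V" "v \<in> V" "inj_on p V"
  shows "forest w {p v} (p ` V - {p v}) = forest (\<lambda>e. w (p ` e)) {v} (V - {v})"
proof (rule tendsto_unique)
  have "card (p ` V - {p v}) = card (V - {v})"
    using assms by (simp add: card_image)
  then show "((\<lambda>\<epsilon>. conn (\<lambda>e. \<epsilon> * w e) (p ` V) / \<epsilon> ^ card (V - {v})) \<longlongrightarrow> forest w {p v} (p ` V - {p v})) (at_right 0)"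
    using tendsto_forest_scaled[of "{p v}" "p ` V - {p v}" w] assms by (simp add: ursell_conn)
  show "((\<lambda>\<epsilon>. conn (\<lambda>e. \<epsilon> * w e) (p ` V) / \<epsilon> ^ card (V - {v})) \<longlongrightarrow> forest (\<lambda>e. w (p ` e)) {v} (V - {v})) (at_right 0)"
    using tendsto_forest_scaled[of "{v}" "V - {v}" "\<lambda>e. w (p ` e)"] assms
    by (simp add: ursell_conn conn_image)
qed simp

text \<open>\<open>Min\<close> and \<open>Max\<close> orient an edge exactly as in
  \<open>phi\<close>, so that the two agree literally; for symmetric kernels the orientation is
  immaterial. The value type is general because the hard-core predicate is read in the same
  way.\<close>

definition edge_weight :: "('a \<Rightarrow> 'a \<Rightarrow> 'c) \<Rightarrow> (nat \<Rightarrow> 'a) \<Rightarrow> nat set \<Rightarrow> 'c" where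
  "edge_weight k x e = k (x (Min e)) (x (Max e))"

lemma edge_weight_pair:
  assumes "\<And>x y. k x y = k y x"
  shows "edge_weight k x {i, j} = k (x i) (x j)"
  using assms by (cases "i \<le> j") (auto simp: edge_weight_def min_def max_def)

lemma edge_weight_cong:
  assumes "\<And>x y. k x y = k y x" "e \<in> edges V" "\<And>i. i \<in> V \<Longrightarrow> x i = x' i"
  shows "edge_weight k x e = edge_weight k x' e"
  using assms(2) by (rule edges_cases) (simp add: edge_weight_pair[OF assms(1)] assms(3))

lemma edge_weight_image:
  assumes "\<And>x y. k x y = k y x" "e \<in> edges V" "\<And>i. i \<in> V \<Longrightarrow> y i = x (p i)"
  shows "edge_weight k y e = edge_weight k x (p ` e)"
  using assms(2) by (rule edges_cases) (simp add: edge_weight_pair[OF assms(1)] assms(3))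

lemma norm_edge_weight: "norm (edge_weight k x e) = edge_weight (\<lambda>x y. norm (k x y)) x e"
  by (simp add: edge_weight_def)

lemma measurable_edge_weight:
  assumes k: "(\<lambda>(x, y). k x y) \<in> borel_measurable (M \<Otimes>\<^sub>M M)" "\<And>x y. k x y = k y x"
    and X: "\<And>i. i \<in> V \<Longrightarrow> (\<lambda>\<omega>. X \<omega> i) \<in> measurable N M" and e: "e \<in> edges V"
  shows "(\<lambda>\<omega>. edge_weight k (X \<omega>) e) \<in> borel_measurable N"
proof -
  from e obtain i j where ij: "e = {i, j}" "i \<in> V" "j \<in> V" by (rule edges_cases)
  have "(\<lambda>\<omega>. (X \<omega> i, X \<omega> j)) \<in> measurable N (M \<Otimes>\<^sub>M M)"
    using X ij by (intro measurable_Pair)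
  from measurable_compose[OF this k(1)] show ?thesis
    by (simp add: ij edge_weight_pair[OF k(2)])
qed

lemma measurable_boltz:
  fixes k :: "'a \<Rightarrow> 'a \<Rightarrow> complex"
  assumes k: "(\<lambda>(x, y). k x y) \<in> borel_measurable (M \<Otimes>\<^sub>M M)" "\<And>x y. k x y = k y x"
    and X: "\<And>i. i \<in> V \<Longrightarrow> (\<lambda>\<omega>. X \<omega> i) \<in> measurable N M"
  shows "(\<lambda>\<omega>. boltz (edge_weight k (X \<omega>)) V) \<in> borel_measurable N"
  unfolding boltz_def
  by (intro borel_measurable_prod borel_measurable_add borel_measurable_const measurable_edge_weight[OF k X])

lemma measurable_conn:
  fixes k :: "'a \<Rightarrow> 'a \<Rightarrow> complex"
  assumes k: "(\<lambda>(x, y). k x y) \<in> borel_measurable (M \<Otimes>\<^sub>M M)" "\<And>x y. k x y = k y x"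
    and X: "\<And>i. i \<in> V \<Longrightarrow> (\<lambda>\<omega>. X \<omega> i) \<in> measurable N M"
  shows "(\<lambda>\<omega>. conn (edge_weight k (X \<omega>)) V) \<in> borel_measurable N"
  unfolding conn_def
  by (intro borel_measurable_prod borel_measurable_sum measurable_edge_weight[OF k X])
    (auto simp: spanning_graphs_def)

lemma measurable_forest:
  fixes k :: "'a \<Rightarrow> 'a \<Rightarrow> real"
  assumes k: "(\<lambda>(x, y). k x y) \<in> borel_measurable (M \<Otimes>\<^sub>M M)" "\<And>x y. k x y = k y x"
    and AB: "finite A" "finite B" "A \<inter> B = {}"
    and X: "\<And>i. i \<in> A \<union> B \<Longrightarrow> (\<lambda>\<omega>. X \<omega> i) \<in> measurable N M"
  shows "(\<lambda>\<omega>. forest (edge_weight k (X \<omega>)) A B) \<in> borel_measurable N"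
  using AB X
proof (induction "card A + card B" arbitrary: A B rule: less_induct)
  case less
  show ?case
  proof (cases "A = {}")
    case False
    then obtain i where i: "i \<in> A" by auto
    show ?thesis
      unfolding forest_rec[OF less.prems(1-3) i]
    proof (intro borel_measurable_sum borel_measurable_times borel_measurable_prod)
      fix C j assume C: "C \<in> Pow B" "j \<in> C"
      show "(\<lambda>\<omega>. edge_weight k (X \<omega>) {i, j}) \<in> borel_measurable N"
        using C i less.prems by (intro measurable_edge_weight[OF k, where V = "A \<union> B"]) (auto simp: edges_pair_iff)
    next
      fix C assume C: "C \<in> Pow B"
      show "(\<lambda>\<omega>. forest (edge_weight k (X \<omega>)) (A - {i} \<union> C) (B - C)) \<in> borel_measurable N"
        using C i less.prems finite_subset[of C B] by (intro less.hyps card_rec_less) auto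
    qed
  qed (simp add: forest_no_roots)
qed

section \<open>Product measures: relabelling and restricting coordinates\<close>

context sigma_finite_measure
begin

lemma product_sigma_finite_const: "product_sigma_finite (\<lambda>_. M)"
  by (simp add: product_sigma_finite_def sigma_finite_measure_axioms)

lemma distr_PiM_bij:
  fixes p :: "'i \<Rightarrow> 'j"
  assumes I: "finite I" and p: "bij_betw p I J"
  shows "distr (PiM J (\<lambda>_. M)) (PiM I (\<lambda>_. M)) (\<lambda>x. \<lambda>i\<in>I. x (p i)) = PiM I (\<lambda>_. M)"
proof -
  interpret I: product_sigma_finite "\<lambda>_::'i. M" by (rule product_sigma_finite_const)
  interpret J: product_sigma_finite "\<lambda>_::'j. M" by (rule product_sigma_finite_const)
  have J: "finite J" and pJ: "\<And>i. i \<in> I \<Longrightarrow> p i \<in> J" using I p bij_betw_finite by (auto simp: bij_betw_def)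
  define q where "q = the_inv_into I p"
  have q: "q j \<in> I" "p (q j) = j" if "j \<in> J" for j
    using that p unfolding q_def by (auto simp: bij_betw_def the_inv_into_into f_the_inv_into_f)
  have qp: "q (p i) = i" if "i \<in> I" for i
    using that p unfolding q_def by (auto simp: bij_betw_def the_inv_into_f_f)
  have meas: "(\<lambda>x. \<lambda>i\<in>I. x (p i)) \<in> measurable (PiM J (\<lambda>_. M)) (PiM I (\<lambda>_. M))"
    using pJ by (intro measurable_restrict measurable_component_singleton) auto
  show ?thesis
  proof (rule I.PiM_eqI[OF I])
    fix A assume A: "\<And>i. i \<in> I \<Longrightarrow> A i \<in> sets M"
    have sp: "A i \<subseteq> space M" if "i \<in> I" for i using A[OF that] sets.sets_into_space by auto
    have "(\<lambda>x. \<lambda>i\<in>I. x (p i)) -` (Pi\<^sub>E I A) \<inter> space (PiM J (\<lambda>_. M)) = Pi\<^sub>E J (\<lambda>j. A (q j))"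
    proof (intro set_eqI iffI)
      fix x assume x: "x \<in> (\<lambda>x. \<lambda>i\<in>I. x (p i)) -` (Pi\<^sub>E I A) \<inter> space (PiM J (\<lambda>_. M))"
      show "x \<in> Pi\<^sub>E J (\<lambda>j. A (q j))"
      proof (rule PiE_I)
        fix j assume "j \<in> J"
        have "(\<lambda>i\<in>I. x (p i)) (q j) \<in> A (q j)"
          using x q(1)[OF \<open>j \<in> J\<close>] by (auto simp: PiE_iff)
        then show "x j \<in> A (q j)" using q[OF \<open>j \<in> J\<close>] by simp
      qed (use x in \<open>auto simp: space_PiM PiE_iff extensional_def\<close>)
    next
      fix x assume x: "x \<in> Pi\<^sub>E J (\<lambda>j. A (q j))"
      have "x (p i) \<in> A i" if "i \<in> I" for i
        using x pJ[OF that] qp[OF that] by (auto simp: PiE_iff)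
      moreover have "x \<in> space (PiM J (\<lambda>_. M))"
        using x sp q(1) by (fastforce simp: space_PiM PiE_iff)
      ultimately show "x \<in> (\<lambda>x. \<lambda>i\<in>I. x (p i)) -` (Pi\<^sub>E I A) \<inter> space (PiM J (\<lambda>_. M))"
        by (auto simp: PiE_iff)
    qed
    then have "emeasure (distr (PiM J (\<lambda>_. M)) (PiM I (\<lambda>_. M)) (\<lambda>x. \<lambda>i\<in>I. x (p i))) (Pi\<^sub>E I A)
       = emeasure (PiM J (\<lambda>_. M)) (Pi\<^sub>E J (\<lambda>j. A (q j)))"
      using A I by (subst emeasure_distr[OF meas]) (auto intro!: sets_PiM_I_finite)
    also have "\<dots> = (\<Prod>j\<in>J. emeasure M (A (q j)))"
      using A q J by (intro J.emeasure_PiM) auto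
    also have "\<dots> = (\<Prod>i\<in>I. emeasure M (A i))"
      by (rule prod.reindex_bij_witness[where i = p and j = q]) (auto simp: q qp pJ)
    finally show "emeasure (distr (PiM J (\<lambda>_. M)) (PiM I (\<lambda>_. M)) (\<lambda>x. \<lambda>i\<in>I. x (p i))) (Pi\<^sub>E I A)
      = (\<Prod>i\<in>I. emeasure M (A i))" .
  qed simp
qed

lemma measurable_PiM_bij:
  assumes "bij_betw p I J"
  shows "(\<lambda>x. \<lambda>i\<in>I. x (p i)) \<in> measurable (PiM J (\<lambda>_. M)) (PiM I (\<lambda>_. M))"
  using assms by (intro measurable_restrict measurable_component_singleton) (auto simp: bij_betw_def)

text \<open>\<open>M\<close> need not be a probability measure, so restriction to fewer coordinates
  does not carry the product measure to the product measure. Preimages of null sets are still null,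
  by Fubini.\<close>

lemma AE_PiM_restrict:
  fixes I :: "nat set"
  assumes "finite I" "A \<subseteq> I" and P: "AE x in PiM A (\<lambda>_. M). P x"
  shows "AE x in PiM I (\<lambda>_. M). P (restrict x A)"
proof -
  interpret I: product_sigma_finite "\<lambda>_::nat. M" by (rule product_sigma_finite_const)
  let ?J = "I - A"
  have I: "A \<union> ?J = I" "A \<inter> ?J = {}" "finite A" "finite ?J" using assms finite_subset by auto
  from P obtain N where N: "{x\<in>space (PiM A (\<lambda>_. M)). \<not> P x} \<subseteq> N" "N \<in> null_sets (PiM A (\<lambda>_. M))"
    by (auto elim: AE_E3 simp: null_sets_def eventually_ae_filter)
  have [measurable]: "N \<in> sets (PiM A (\<lambda>_. M))" using N by auto
  have res[measurable]: "(\<lambda>x. restrict x A) \<in> measurable (PiM I (\<lambda>_. M)) (PiM A (\<lambda>_. M))"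
    using assms by (intro measurable_restrict_subset)
  have "(\<integral>\<^sup>+x. indicator N (restrict x A) \<partial>PiM I (\<lambda>_. M)) = 
     (\<integral>\<^sup>+x. (\<integral>\<^sup>+y. indicator N (restrict (merge A ?J (x, y)) A) \<partial>PiM ?J (\<lambda>_. M)) \<partial>PiM A (\<lambda>_. M))"
    using I.product_nn_integral_fold[OF I(2-4), of "\<lambda>x. indicator N (restrict x A)"] unfolding I(1) by simp
  also have "\<dots> = (\<integral>\<^sup>+x. 0 \<partial>PiM A (\<lambda>_. M))"
  proof (rule nn_integral_cong_AE)
    show "AE x in PiM A (\<lambda>_. M). (\<integral>\<^sup>+y. indicator N (restrict (merge A ?J (x, y)) A) \<partial>PiM ?J (\<lambda>_. M)) = 0"
      using AE_not_in[OF N(2)] AE_space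
    proof eventually_elim
      case (elim x)
      then have "restrict (merge A ?J (x, y)) A = x" for y
        by (auto simp: space_PiM restrict_merge PiE_iff extensional_restrict)
      then show ?case using elim by simp
    qed
  qed
  finally have "(\<integral>\<^sup>+x. indicator N (restrict x A) \<partial>PiM I (\<lambda>_. M)) = 0" by simp
  then have "AE x in PiM I (\<lambda>_. M). indicator N (restrict x A) = (0::ennreal)"
    by (subst (asm) nn_integral_0_iff_AE) auto
  then show ?thesis using AE_space
  proof eventually_elim
    case (elim x)
    then have "restrict x A \<in> space (PiM A (\<lambda>_. M))" using measurable_space[OF res] by auto
    with elim N(1) show ?case by (auto simp: indicator_def split: if_splits)
  qed
qed

lemma AE_PiM_bij:
  fixes I J :: "nat set"
  assumes "finite I" "bij_betw p I J" "AE x in PiM I (\<lambda>_. M). P x"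
  shows "AE x in PiM J (\<lambda>_. M). P (\<lambda>i\<in>I. x (p i))"
  using AE_distrD[OF measurable_PiM_bij[OF assms(2)], of P] assms(3)
  unfolding distr_PiM_bij[OF assms(1,2)] by simp

lemma AE_PiM_component:
  fixes I :: "nat set"
  assumes "finite I" "i \<in> I" "AE y in M. P y"
  shows "AE x in PiM I (\<lambda>_. M). P (x i)"
proof -
  interpret I: product_sigma_finite "\<lambda>_::nat. M" by (rule product_sigma_finite_const)
  have "AE y in distr (PiM {i} (\<lambda>_. M)) M (\<lambda>x. x i). P y"
    by (subst I.distr_singleton) (rule assms(3))
  then have "AE x in PiM {i} (\<lambda>_. M). P (x i)"
    by (intro AE_distrD[of "\<lambda>x. x i" _ M]) auto
  from AE_PiM_restrict[OF assms(1) _ this] assms(2) show ?thesis by simp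
qed

end

section \<open>Integrating trees\<close>

context sigma_finite_measure
begin

text \<open>With \<open>c = 1 / card V\<close> the sum over subsets \<open>B\<close> of a set of \<open>N\<close> labels replaces \<open>\<Sum>m. 1/m!\<close>, as
  \<open>(N choose m) / N ^ m\<close> tends to \<open>1/m!\<close>. In this form the induction needs no relabelling.\<close>

lemma forest_integral_le:
  fixes \<tau> :: "'a \<Rightarrow> 'a \<Rightarrow> real" and w a :: "'a \<Rightarrow> real" and c :: real and V A :: "nat set"
  assumes \<tau>: "(\<lambda>(x, y). \<tau> x y) \<in> borel_measurable (M \<Otimes>\<^sub>M M)" "\<And>x y. \<tau> x y = \<tau> y x" "\<And>x y. 0 \<le> \<tau> x y"
    and w[measurable]: "w \<in> borel_measurable M" and w0: "\<And>x. 0 \<le> w x"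
    and a[measurable]: "a \<in> borel_measurable M"
    and S: "AE x in M. x \<in> S"
      "\<And>x. x \<in> S \<Longrightarrow> x \<in> space M" "\<And>x. x \<in> S \<Longrightarrow> 0 \<le> a x"
      "\<And>x. x \<in> S \<Longrightarrow> (\<integral>\<^sup>+y. ennreal (\<tau> x y * w y * exp (a y)) \<partial>M) \<le> ennreal (a x)"
    and c: "0 \<le> c"
    and V: "finite V" "A \<subseteq> V" "c * card V \<le> 1" and x: "\<And>i. i \<in> A \<Longrightarrow> x i \<in> S"
  shows "(\<Sum>B\<in>Pow (V - A). \<integral>\<^sup>+y. ennreal ((\<Prod>j\<in>B. c * w (y j)) *
      forest (edge_weight \<tau> (override_on x y B)) A B) \<partial>PiM B (\<lambda>_. M)) \<le> (\<Prod>i\<in>A. ennreal (exp (a (x i))))"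
  using V x
proof (induction "card V" arbitrary: V A x rule: less_induct)
  case less
  interpret I: product_sigma_finite "\<lambda>_::nat. M" by (rule product_sigma_finite_const)
  let ?e = "edge_weight \<tau>"
  have fA: "finite A" using less.prems finite_subset by auto
  show ?case
  proof (cases "A = {}")
    case True
    have one: "(\<integral>\<^sup>+y. 1 \<partial>PiM {} (\<lambda>_::nat. M)) = 1"
      using I.product_nn_integral_prod[of "{}" "\<lambda>_ _. 1"] by simp
    have "(\<integral>\<^sup>+y. ennreal ((\<Prod>j\<in>B. c * w (y j)) * forest (?e (override_on x y B)) A B) \<partial>PiM B (\<lambda>_. M))
        = (if B = {} then 1 else 0)" for B
      using True one by (simp add: forest_no_roots)
    then show ?thesis using True less.prems by (simp add: sum.delta)
  next
    case False
    then obtain i where i: "i \<in> A" by auto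
    let ?R = "V - A"
    have fR: "finite ?R" using less.prems by auto
    have subR: "finite C" "A \<inter> C = {}" if "C \<subseteq> ?R" for C using that fR finite_subset by auto
    \<comment> \<open>One step of the recursion: \<open>C\<close> are the children of the root
      \<open>i\<close>, each carrying its weight and its edge to \<open>x i\<close>, and
      \<open>D\<close> are the labels still to be attached.\<close>
    define t where "t = (\<lambda>C D X. (\<Prod>j\<in>C. c * w (X j) * \<tau> (x i) (X j)) *
        ((\<Prod>j\<in>D. c * w (X j)) * forest (?e X) (A - {i} \<union> C) D))"
    have e0: "0 \<le> ?e X e" for X e using \<tau>(3) by (simp add: edge_weight_def)
    have f0: "0 \<le> forest (?e X) A' D" if "finite A'" "finite D" "A' \<inter> D = {}" for A' D X
      using that e0 by (intro forest_nonneg)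
    have xi: "x i \<in> S" "x i \<in> space M" using less.prems(4) i S by auto
    have xA: "x k \<in> space M" if "k \<in> A" for k using less.prems(4) that S by auto
    have \<tau>x[measurable]: "\<tau> (x i) \<in> borel_measurable M"
      using measurable_compose[OF measurable_Pair1'[OF xi(2), of M] \<tau>(1)] by simp
    have tm: "(\<lambda>\<omega>. t C D (X \<omega>)) \<in> borel_measurable N"
      if C: "C \<subseteq> ?R" "D \<subseteq> ?R - C" and X: "\<And>k. k \<in> A \<union> C \<union> D \<Longrightarrow> (\<lambda>\<omega>. X \<omega> k) \<in> measurable N M"
      for C D N and X :: "'b \<Rightarrow> nat \<Rightarrow> 'a"
    proof -
      have "(\<lambda>\<omega>. w (X \<omega> k)) \<in> borel_measurable N" "(\<lambda>\<omega>. \<tau> (x i) (X \<omega> k)) \<in> borel_measurable N"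
        if "k \<in> C \<union> D" for k
        using that X by (auto intro!: measurable_compose[OF _ w] measurable_compose[OF _ \<tau>x])
      moreover have "(\<lambda>\<omega>. forest (?e (X \<omega>)) (A - {i} \<union> C) D) \<in> borel_measurable N"
        using C subR[of C] subR[of D] fA X by (intro measurable_forest[OF \<tau>(1,2)]) auto
      ultimately show ?thesis
        unfolding t_def by (intro borel_measurable_times borel_measurable_prod borel_measurable_const) auto
    qed
    have rec: "ennreal ((\<Prod>j\<in>B. c * w (y j)) * forest (?e (override_on x y B)) A B)
        = (\<Sum>C\<in>Pow B. ennreal (t C (B - C) (override_on x y B)))" if B: "B \<subseteq> ?R" for B y
    proof -
      let ?X = "override_on x y B"
      have "i \<notin> B" using B i by auto
      then have Xi: "?X i = x i" by simp
      have t0: "0 \<le> t C (B - C) ?X" if "C \<in> Pow B" for C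
        unfolding t_def using that B subR[of C] subR[of "B - C"] fA c w0 \<tau>(3)
        by (intro mult_nonneg_nonneg prod_nonneg f0) auto
      have "(\<Prod>j\<in>B. c * w (y j)) = (\<Prod>j\<in>B. c * w (?X j))" by (intro prod.cong refl) simp
      then have "(\<Prod>j\<in>B. c * w (y j)) * forest (?e ?X) A B = (\<Prod>j\<in>B. c * w (?X j)) *
         (\<Sum>C\<in>Pow B. (\<Prod>j\<in>C. ?e ?X {i, j}) * forest (?e ?X) (A - {i} \<union> C) (B - C))"
        using forest_rec[OF fA subR[OF B] i, of "?e ?X"] by simp
      also have "\<dots> = (\<Sum>C\<in>Pow B. t C (B - C) ?X)"
        unfolding sum_distrib_left
      proof (intro sum.cong refl)
        fix C assume C: "C \<in> Pow B"
        have "(\<Prod>j\<in>C. ?e ?X {i, j}) = (\<Prod>j\<in>C. \<tau> (x i) (?X j))"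
          by (intro prod.cong refl) (simp add: edge_weight_pair[OF \<tau>(2)] Xi)
        moreover have "(\<Prod>j\<in>B. c * w (?X j)) = (\<Prod>j\<in>B - C. c * w (?X j)) * (\<Prod>j\<in>C. c * w (?X j))"
          using C subR[OF B] by (intro prod.subset_diff) auto
        ultimately show "(\<Prod>j\<in>B. c * w (?X j)) * ((\<Prod>j\<in>C. ?e ?X {i, j}) * forest (?e ?X) (A - {i} \<union> C) (B - C))
            = t C (B - C) ?X"
          unfolding t_def by (simp add: prod.distrib mult_ac)
      qed
      finally show ?thesis using t0 by (subst sum_ennreal) auto
    qed
    have ov_meas: "(\<lambda>y. override_on x y B k) \<in> measurable (PiM B (\<lambda>_. M)) M" if "k \<in> A \<union> B" for B k
      using that xA by (cases "k \<in> B") (auto simp: override_on_def)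
    have ov_meas2: "(\<lambda>p. override_on (override_on x (fst p) C) (snd p) D k)
        \<in> measurable (PiM C (\<lambda>_. M) \<Otimes>\<^sub>M PiM D (\<lambda>_. M)) M" if "k \<in> A \<union> C \<union> D" for C D k
    proof -
      consider "k \<in> D" | "k \<notin> D" "k \<in> C" | "k \<notin> D" "k \<notin> C" "k \<in> A" using \<open>k \<in> A \<union> C \<union> D\<close> by blast
      then show ?thesis
      proof cases
        case 1
        then have "(\<lambda>p. snd p k) \<in> measurable (PiM C (\<lambda>_. M) \<Otimes>\<^sub>M PiM D (\<lambda>_. M)) M" by measurable
        then show ?thesis using 1 by simp
      next
        case 2
        then have "(\<lambda>p. fst p k) \<in> measurable (PiM C (\<lambda>_. M) \<Otimes>\<^sub>M PiM D (\<lambda>_. M)) M" by measurable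
        then show ?thesis using 2 by simp
      qed (use xA in auto)
    qed
    have fold: "(\<integral>\<^sup>+y. ennreal (t C D (override_on x y (C \<union> D))) \<partial>PiM (C \<union> D) (\<lambda>_. M))
       = (\<integral>\<^sup>+y. \<integral>\<^sup>+z. ennreal (t C D (override_on (override_on x y C) z D)) \<partial>PiM D (\<lambda>_. M) \<partial>PiM C (\<lambda>_. M))"
      if C: "C \<subseteq> ?R" "D \<subseteq> ?R - C" for C D
    proof -
      have ov: "override_on x (merge C D (y, z)) (C \<union> D) = override_on (override_on x y C) z D" for y z
        using C by (intro ext) (auto simp: override_on_def merge_def)
      have "(\<lambda>y. ennreal (t C D (override_on x y (C \<union> D)))) \<in> borel_measurable (PiM (C \<union> D) (\<lambda>_. M))"
        using C by (intro measurable_compose[OF _ measurable_ennreal] tm ov_meas) auto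
      from I.product_nn_integral_fold[OF _ _ _ this] show ?thesis
        using C subR[of C] subR[of D] by (auto simp: ov)
    qed
    have perC: "(\<Sum>D\<in>Pow (?R - C). \<integral>\<^sup>+y. \<integral>\<^sup>+z. ennreal (t C D (override_on (override_on x y C) z D)) \<partial>PiM D (\<lambda>_. M) \<partial>PiM C (\<lambda>_. M))
        \<le> (\<Prod>k\<in>A - {i}. ennreal (exp (a (x k)))) * (\<Prod>j\<in>C. ennreal (c * a (x i)))" if C: "C \<subseteq> ?R" for C
    proof -
      let ?A = "A - {i} \<union> C"
      let ?g = "\<lambda>y. \<Prod>j\<in>C. c * w (y j) * \<tau> (x i) (y j)"
      have fC: "finite C" using subR C by auto
      \<comment> \<open>The removed root leaves the label set as well, so \<open>V\<close> shrinks,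
        while the labels available for \<open>D\<close> remain those outside \<open>A\<close> and
        \<open>C\<close>.\<close>
      have VA: "V - {i} - ?A = ?R - C" using i by auto
      have "(\<Sum>D\<in>Pow (?R - C). \<integral>\<^sup>+y. \<integral>\<^sup>+z. ennreal (t C D (override_on (override_on x y C) z D)) \<partial>PiM D (\<lambda>_. M) \<partial>PiM C (\<lambda>_. M))
         = (\<integral>\<^sup>+y. (\<Sum>D\<in>Pow (?R - C). \<integral>\<^sup>+z. ennreal (t C D (override_on (override_on x y C) z D)) \<partial>PiM D (\<lambda>_. M)) \<partial>PiM C (\<lambda>_. M))"
      proof (rule nn_integral_sum[symmetric])
        fix D assume D: "D \<in> Pow (?R - C)"
        then have fD: "finite D" using subR[of D] by auto
        interpret D: finite_product_sigma_finite "\<lambda>_::nat. M" D by standard (rule fD)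
        have "(\<lambda>p. ennreal (t C D (override_on (override_on x (fst p) C) (snd p) D))) \<in> borel_measurable (PiM C (\<lambda>_. M) \<Otimes>\<^sub>M PiM D (\<lambda>_. M))"
          using C D by (intro measurable_compose[OF _ measurable_ennreal] tm ov_meas2) auto
        then show "(\<lambda>y. \<integral>\<^sup>+z. ennreal (t C D (override_on (override_on x y C) z D)) \<partial>PiM D (\<lambda>_. M)) \<in> borel_measurable (PiM C (\<lambda>_. M))"
          by (intro D.borel_measurable_nn_integral) (simp add: split_beta')
      qed
      also have "\<dots> \<le> (\<integral>\<^sup>+y. (\<Prod>k\<in>A - {i}. ennreal (exp (a (x k)))) * (\<Prod>j\<in>C. ennreal (c * (\<tau> (x i) (y j) * w (y j) * exp (a (y j))))) \<partial>PiM C (\<lambda>_. M))"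
      proof (rule nn_integral_mono_AE)
        \<comment> \<open>The children become roots in the induction hypothesis, which asks for
          roots in \<open>S\<close>; this holds for almost every position.\<close>
        have "AE y in PiM C (\<lambda>_. M). \<forall>j\<in>C. y j \<in> S"
          using S(1) fC by (intro AE_finite_allI AE_PiM_component) auto
        then show "AE y in PiM C (\<lambda>_. M). (\<Sum>D\<in>Pow (?R - C). \<integral>\<^sup>+z. ennreal (t C D (override_on (override_on x y C) z D)) \<partial>PiM D (\<lambda>_. M))
          \<le> (\<Prod>k\<in>A - {i}. ennreal (exp (a (x k)))) * (\<Prod>j\<in>C. ennreal (c * (\<tau> (x i) (y j) * w (y j) * exp (a (y j)))))"
        proof eventually_elim
          case (elim y)
          let ?x = "override_on x y C"
          have g0: "0 \<le> ?g y" using c w0 \<tau>(3) by (intro prod_nonneg) auto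
          have "(\<integral>\<^sup>+z. ennreal (t C D (override_on ?x z D)) \<partial>PiM D (\<lambda>_. M))
             = ennreal (?g y) * (\<integral>\<^sup>+z. ennreal ((\<Prod>j\<in>D. c * w (z j)) * forest (?e (override_on ?x z D)) ?A D) \<partial>PiM D (\<lambda>_. M))"
            if D: "D \<in> Pow (?R - C)" for D
          proof -
            have "ennreal (t C D (override_on ?x z D)) = ennreal (?g y) * ennreal ((\<Prod>j\<in>D. c * w (z j)) * forest (?e (override_on ?x z D)) ?A D)" for z
            proof -
              have "(\<Prod>j\<in>C. c * w (override_on ?x z D j) * \<tau> (x i) (override_on ?x z D j)) = ?g y"
                using D by (intro prod.cong refl) (auto simp: override_on_def)
              moreover have "(\<Prod>j\<in>D. c * w (override_on ?x z D j)) = (\<Prod>j\<in>D. c * w (z j))"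
                by (intro prod.cong refl) simp
              ultimately show ?thesis unfolding t_def using g0 by (simp add: ennreal_mult')
            qed
            moreover have "(\<lambda>z. ennreal ((\<Prod>j\<in>D. c * w (z j)) * forest (?e (override_on ?x z D)) ?A D)) \<in> borel_measurable (PiM D (\<lambda>_. M))"
            proof (intro measurable_compose[OF _ measurable_ennreal] borel_measurable_times borel_measurable_prod measurable_forest[OF \<tau>(1,2)])
              show "(\<lambda>z. override_on ?x z D k) \<in> measurable (PiM D (\<lambda>_. M)) M" if "k \<in> ?A \<union> D" for k
                using that xA elim S(2) by (cases "k \<in> D") (auto simp: override_on_def)
            qed (use D C fA fC subR[of D] in auto)
            ultimately show ?thesis by (simp add: nn_integral_cmult)
          qed
          then have "(\<Sum>D\<in>Pow (?R - C). \<integral>\<^sup>+z. ennreal (t C D (override_on ?x z D)) \<partial>PiM D (\<lambda>_. M))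
             = ennreal (?g y) * (\<Sum>D\<in>Pow (V - {i} - ?A). \<integral>\<^sup>+z. ennreal ((\<Prod>j\<in>D. c * w (z j)) * forest (?e (override_on ?x z D)) ?A D) \<partial>PiM D (\<lambda>_. M))"
            unfolding VA by (simp add: sum_distrib_left)
          also have "\<dots> \<le> ennreal (?g y) * (\<Prod>k\<in>?A. ennreal (exp (a (?x k))))"
          proof (intro mult_left_mono less.hyps)
            have iV: "i \<in> V" using i less.prems by auto
            show "card (V - {i}) < card V" using iV less.prems by (intro card_Diff1_less)
            then have "c * card (V - {i}) \<le> c * card V" using c by (intro mult_left_mono) auto
            then show "c * card (V - {i}) \<le> 1" using less.prems by linarith
            show "?x k \<in> S" if "k \<in> ?A" for k
              using that elim less.prems(4) by (cases "k \<in> C") auto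
          qed (use less.prems C i in auto)
          also have "(\<Prod>k\<in>?A. ennreal (exp (a (?x k)))) = (\<Prod>k\<in>A - {i}. ennreal (exp (a (?x k)))) * (\<Prod>k\<in>C. ennreal (exp (a (?x k))))"
            using fA fC C by (intro prod.union_disjoint) auto
          also have "(\<Prod>k\<in>A - {i}. ennreal (exp (a (?x k)))) = (\<Prod>k\<in>A - {i}. ennreal (exp (a (x k))))"
            using C by (intro prod.cong refl) (auto simp: override_on_def)
          also have "(\<Prod>k\<in>C. ennreal (exp (a (?x k)))) = (\<Prod>k\<in>C. ennreal (exp (a (y k))))"
            by (intro prod.cong refl) simp
          also have "ennreal (?g y) = (\<Prod>j\<in>C. ennreal (c * w (y j) * \<tau> (x i) (y j)))"
            using c w0 \<tau>(3) by (intro prod_ennreal[symmetric]) auto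
          also have "(\<Prod>j\<in>C. ennreal (c * w (y j) * \<tau> (x i) (y j))) *
              ((\<Prod>k\<in>A - {i}. ennreal (exp (a (x k)))) * (\<Prod>k\<in>C. ennreal (exp (a (y k)))))
            = (\<Prod>k\<in>A - {i}. ennreal (exp (a (x k)))) * (\<Prod>j\<in>C. ennreal (c * w (y j) * \<tau> (x i) (y j)) * ennreal (exp (a (y j))))"
            by (simp add: prod.distrib mult_ac)
          also have "(\<Prod>j\<in>C. ennreal (c * w (y j) * \<tau> (x i) (y j)) * ennreal (exp (a (y j)))) = 
             (\<Prod>j\<in>C. ennreal (c * (\<tau> (x i) (y j) * w (y j) * exp (a (y j)))))"
            using c w0 \<tau>(3) by (intro prod.cong refl) (simp add: ennreal_mult'[symmetric] mult_ac)
          finally show ?case .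
        qed
      qed
      also have "\<dots> = (\<Prod>k\<in>A - {i}. ennreal (exp (a (x k)))) * (\<integral>\<^sup>+y. (\<Prod>j\<in>C. ennreal (c * (\<tau> (x i) (y j) * w (y j) * exp (a (y j))))) \<partial>PiM C (\<lambda>_. M))"
        by (intro nn_integral_cmult) measurable
      also have "(\<integral>\<^sup>+y. (\<Prod>j\<in>C. ennreal (c * (\<tau> (x i) (y j) * w (y j) * exp (a (y j))))) \<partial>PiM C (\<lambda>_. M))
         = (\<Prod>j\<in>C. \<integral>\<^sup>+y. ennreal (c * (\<tau> (x i) y * w y * exp (a y))) \<partial>M)"
        using fC by (intro I.product_nn_integral_prod) measurable
      also have "(\<integral>\<^sup>+y. ennreal (c * (\<tau> (x i) y * w y * exp (a y))) \<partial>M) = ennreal c * (\<integral>\<^sup>+y. ennreal (\<tau> (x i) y * w y * exp (a y)) \<partial>M)"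
        using c by (subst nn_integral_cmult[symmetric]) (auto simp: ennreal_mult')
      also have "(\<Prod>k\<in>A - {i}. ennreal (exp (a (x k)))) * (\<Prod>j\<in>C. ennreal c * (\<integral>\<^sup>+y. ennreal (\<tau> (x i) y * w y * exp (a y)) \<partial>M))
          \<le> (\<Prod>k\<in>A - {i}. ennreal (exp (a (x k)))) * (\<Prod>j\<in>C. ennreal c * ennreal (a (x i)))"
        using S(4)[OF xi(1)] by (intro mult_left_mono prod_mono_ennreal) auto
      finally show ?thesis using c by (simp add: ennreal_mult')
    qed
    have "(\<Sum>B\<in>Pow ?R. \<integral>\<^sup>+y. ennreal ((\<Prod>j\<in>B. c * w (y j)) * forest (?e (override_on x y B)) A B) \<partial>PiM B (\<lambda>_. M))
       = (\<Sum>B\<in>Pow ?R. \<Sum>C\<in>Pow B. \<integral>\<^sup>+y. ennreal (t C (B - C) (override_on x y (C \<union> (B - C)))) \<partial>PiM (C \<union> (B - C)) (\<lambda>_. M))"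
    proof (intro sum.cong refl)
      fix B assume B: "B \<in> Pow ?R"
      have "(\<integral>\<^sup>+y. ennreal ((\<Prod>j\<in>B. c * w (y j)) * forest (?e (override_on x y B)) A B) \<partial>PiM B (\<lambda>_. M))
        = (\<integral>\<^sup>+y. (\<Sum>C\<in>Pow B. ennreal (t C (B - C) (override_on x y B))) \<partial>PiM B (\<lambda>_. M))"
        using B by (intro nn_integral_cong rec) auto
      also have "\<dots> = (\<Sum>C\<in>Pow B. \<integral>\<^sup>+y. ennreal (t C (B - C) (override_on x y B)) \<partial>PiM B (\<lambda>_. M))"
        using B by (intro nn_integral_sum measurable_compose[OF _ measurable_ennreal] tm ov_meas) auto
      also have "\<dots> = (\<Sum>C\<in>Pow B. \<integral>\<^sup>+y. ennreal (t C (B - C) (override_on x y (C \<union> (B - C)))) \<partial>PiM (C \<union> (B - C)) (\<lambda>_. M))"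
      proof (intro sum.cong refl)
        fix C assume "C \<in> Pow B"
        then have "C \<union> (B - C) = B" by auto
        then show "(\<integral>\<^sup>+y. ennreal (t C (B - C) (override_on x y B)) \<partial>PiM B (\<lambda>_. M)) =
           (\<integral>\<^sup>+y. ennreal (t C (B - C) (override_on x y (C \<union> (B - C)))) \<partial>PiM (C \<union> (B - C)) (\<lambda>_. M))" by simp
      qed
      finally show "(\<integral>\<^sup>+y. ennreal ((\<Prod>j\<in>B. c * w (y j)) * forest (?e (override_on x y B)) A B) \<partial>PiM B (\<lambda>_. M)) = \<dots>" .
    qed
    \<comment> \<open>Choosing the children before the rest leaves, for fixed \<open>C\<close>, a
      sum over \<open>D\<close> of the form to which the induction hypothesis applies.\<close>
    also have "\<dots> = (\<Sum>C\<in>Pow ?R. \<Sum>D\<in>Pow (?R - C). \<integral>\<^sup>+y. ennreal (t C D (override_on x y (C \<union> D))) \<partial>PiM (C \<union> D) (\<lambda>_. M))"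
      by (rule sum_Pow_Pow_swap[OF fR, symmetric])
    also have "\<dots> = (\<Sum>C\<in>Pow ?R. \<Sum>D\<in>Pow (?R - C). \<integral>\<^sup>+y. \<integral>\<^sup>+z. ennreal (t C D (override_on (override_on x y C) z D)) \<partial>PiM D (\<lambda>_. M) \<partial>PiM C (\<lambda>_. M))"
      by (intro sum.cong refl fold) auto
    also have "\<dots> \<le> (\<Sum>C\<in>Pow ?R. (\<Prod>k\<in>A - {i}. ennreal (exp (a (x k)))) * (\<Prod>j\<in>C. ennreal (c * a (x i))))"
      by (intro sum_mono perC) auto
    also have "\<dots> = (\<Prod>k\<in>A - {i}. ennreal (exp (a (x k)))) * (\<Prod>j\<in>?R. 1 + ennreal (c * a (x i)))"
      using fR by (simp only: prod_one_plus sum_distrib_left)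
    \<comment> \<open>Each available label either is a child of \<open>i\<close> or is not, which
      gives one factor \<open>1 + c * a (x i) \<le> exp (c * a (x i))\<close>; as
      \<open>c * card V \<le> 1\<close>, these factors together stay below
      \<open>exp (a (x i))\<close>.\<close>
    also have "\<dots> \<le> (\<Prod>k\<in>A - {i}. ennreal (exp (a (x k)))) * ennreal (exp (a (x i)))"
    proof (intro mult_left_mono)
      have ca: "0 \<le> c * a (x i)" using c S(3)[OF xi(1)] by simp
      have "1 + ennreal (c * a (x i)) = ennreal (1 + c * a (x i))" using ca by (simp add: ennreal_plus flip: ennreal_1)
      then have "(\<Prod>j\<in>?R. 1 + ennreal (c * a (x i))) = ennreal (1 + c * a (x i)) ^ card ?R"
        by (simp only: prod_constant)
      also have "\<dots> = ennreal ((1 + c * a (x i)) ^ card ?R)"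
        using ca by (intro ennreal_power) simp
      also have "\<dots> \<le> ennreal (exp (c * a (x i)) ^ card ?R)"
        using ca by (intro ennreal_leI power_mono) auto
      also have "exp (c * a (x i)) ^ card ?R = exp ((c * card ?R) * a (x i))"
        by (simp add: exp_of_nat_mult[symmetric] mult_ac)
      also have "ennreal (exp ((c * card ?R) * a (x i))) \<le> ennreal (exp (1 * a (x i)))"
      proof -
        have "c * card ?R \<le> c * card V" using c less.prems by (intro mult_left_mono of_nat_mono card_mono) auto
        then have "c * card ?R \<le> 1" using less.prems by linarith
        then have "(c * card ?R) * a (x i) \<le> 1 * a (x i)" using S(3)[OF xi(1)] by (intro mult_right_mono)
        then show ?thesis by (intro ennreal_leI) simp
      qed
      finally show "(\<Prod>j\<in>?R. 1 + ennreal (c * a (x i))) \<le> ennreal (exp (a (x i)))" by simp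
    qed simp
    also have "\<dots> = (\<Prod>k\<in>A. ennreal (exp (a (x k))))"
      using fA i by (subst (2) prod.remove[of _ i]) (auto simp: mult.commute)
    finally show ?thesis .
  qed
qed

end

section \<open>From subsets of labels to the exponential series\<close>

lemma sum_Pow_card:
  fixes g :: "nat \<Rightarrow> 'c::comm_semiring_1"
  assumes "finite S"
  shows "(\<Sum>B\<in>Pow S. g (card B)) = (\<Sum>m\<le>card S. of_nat (card S choose m) * g m)"
proof -
  have "(\<Sum>B\<in>Pow S. g (card B)) = (\<Sum>m\<le>card S. \<Sum>B\<in>{B\<in>Pow S. card B = m}. g (card B))"
    using assms by (intro sum.group[symmetric]) (auto intro: card_mono)
  also have "\<dots> = (\<Sum>m\<le>card S. of_nat (card S choose m) * g m)"
    using n_subsets[OF assms] by (intro sum.cong refl) simp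
  finally show ?thesis .
qed

text \<open>The denominator contains \<open>Suc N\<close> because the root is one more label besides
  the \<open>N\<close> free ones, and \<open>c\<close> has to be the inverse of the number of all
  labels.\<close>

lemma choose_div_power_tendsto:
  "(\<lambda>N. real (N choose m) / real (Suc N) ^ m) \<longlonglongrightarrow> 1 / fact m"
proof (induction m)
  case (Suc m)
  have "(\<lambda>N. 1 - real (Suc m) / real (Suc N)) \<longlonglongrightarrow> 1 - 0"
    by (intro tendsto_intros LIMSEQ_Suc[OF lim_const_over_n])
  then have "(\<lambda>N. real (N choose m) / real (Suc N) ^ m * ((1 - real (Suc m) / real (Suc N)) / real (Suc m)))
      \<longlonglongrightarrow> 1 / fact m * ((1 - 0) / real (Suc m))"
    by (intro tendsto_mult Suc tendsto_divide tendsto_const) auto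
  moreover have "real (N choose Suc m) / real (Suc N) ^ Suc m =
     real (N choose m) / real (Suc N) ^ m * ((1 - real (Suc m) / real (Suc N)) / real (Suc m))" if "N \<ge> m" for N
  proof -
    have "Suc m * (N choose Suc m) = (N - m) * (N choose m)"
      by (metis binomial_absorb_comp binomial_absorption mult.commute)
    then have "real (Suc m) * real (N choose Suc m) = (real N - real m) * real (N choose m)"
      using that by (metis of_nat_diff of_nat_mult)
    then have "real (N choose Suc m) = (real N - real m) * real (N choose m) / real (Suc m)"
      by (simp add: field_simps)
    moreover have "1 - real (Suc m) / real (Suc N) = (real N - real m) / real (Suc N)"
      by (simp add: field_simps)
    ultimately show ?thesis by (simp add: mult_ac)
  qed
  then have "\<forall>\<^sub>F N in sequentially. real (N choose m) / real (Suc N) ^ m * ((1 - real (Suc m) / real (Suc N)) / real (Suc m))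
     = real (N choose Suc m) / real (Suc N) ^ Suc m"
    by (auto intro!: eventually_sequentiallyI[of m])
  ultimately show ?case by (simp add: tendsto_cong mult.commute)
qed simp

context sigma_finite_measure
begin

lemma forest_integral_card:
  fixes \<tau> :: "'a \<Rightarrow> 'a \<Rightarrow> real" and w :: "'a \<Rightarrow> real" and B B' :: "nat set"
  assumes \<tau>: "(\<lambda>(x, y). \<tau> x y) \<in> borel_measurable (M \<Otimes>\<^sub>M M)" "\<And>x y. \<tau> x y = \<tau> y x"
    and w[measurable]: "w \<in> borel_measurable M" and x: "x \<in> space M"
    and B: "finite B" "finite B'" "r \<notin> B" "r \<notin> B'" "card B = card B'"
  shows "(\<integral>\<^sup>+y. ennreal ((\<Prod>j\<in>B. w (y j)) * forest (edge_weight \<tau> (override_on (\<lambda>_. x) y B)) {r} B) \<partial>PiM B (\<lambda>_. M))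
    = (\<integral>\<^sup>+y. ennreal ((\<Prod>j\<in>B'. w (y j)) * forest (edge_weight \<tau> (override_on (\<lambda>_. x) y B')) {r} B') \<partial>PiM B' (\<lambda>_. M))"
proof -
  obtain p where p: "bij_betw p B' B" using B by (metis finite_same_card_bij)
  \<comment> \<open>Extending \<open>p\<close> by the fixed root relabels the whole vertex set of
    the trees.\<close>
  define p' where "p' = p(r := r)"
  let ?g = "\<lambda>B y. ennreal ((\<Prod>j\<in>B. w (y j)) * forest (edge_weight \<tau> (override_on (\<lambda>_. x) y B)) {r} B)"
  have p'B: "p' i = p i" if "i \<in> B'" for i using that B by (auto simp: p'_def)
  have pB: "p i \<in> B" if "i \<in> B'" for i using that p by (auto simp: bij_betw_def)
  have inj: "inj_on p' (insert r B')"
    using p B pB by (auto simp: inj_on_def p'_def bij_betw_def)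
  have img: "p' ` insert r B' = insert r B"
    using p B p'B by (auto simp: bij_betw_def p'_def image_iff)
  have "?g B' \<in> borel_measurable (PiM B' (\<lambda>_. M))"
  proof (intro measurable_compose[OF _ measurable_ennreal] borel_measurable_times borel_measurable_prod measurable_forest[OF \<tau>])
    show "(\<lambda>y. override_on (\<lambda>_. x) y B' k) \<in> measurable (PiM B' (\<lambda>_. M)) M" for k
      using x by (cases "k \<in> B'") (auto simp: override_on_def)
  qed (use B in auto)
  then have "(\<integral>\<^sup>+y. ?g B' y \<partial>PiM B' (\<lambda>_. M)) = (\<integral>\<^sup>+y. ?g B' (\<lambda>i\<in>B'. y (p i)) \<partial>PiM B (\<lambda>_. M))"
    using nn_integral_distr[OF measurable_PiM_bij[OF p], of "?g B'"] distr_PiM_bij[OF B(2) p] by simp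
  also have "\<dots> = (\<integral>\<^sup>+y. ?g B y \<partial>PiM B (\<lambda>_. M))"
  proof (rule nn_integral_cong)
    fix y
    let ?y = "\<lambda>i\<in>B'. y (p i)" and ?X = "override_on (\<lambda>_. x) y B"
    have "(\<Prod>j\<in>B'. w (?y j)) = (\<Prod>j\<in>B'. w (y (p j)))" by (intro prod.cong) auto
    also have "\<dots> = (\<Prod>j\<in>B. w (y j))" by (rule prod.reindex_bij_betw[OF p])
    finally have 1: "(\<Prod>j\<in>B'. w (?y j)) = (\<Prod>j\<in>B. w (y j))" .
    have "forest (edge_weight \<tau> (override_on (\<lambda>_. x) ?y B')) {r} B' = forest (\<lambda>e. edge_weight \<tau> ?X (p' ` e)) {r} B'"
    proof (rule forest_cong)
      fix e assume "e \<in> edges ({r} \<union> B')"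
      then show "edge_weight \<tau> (override_on (\<lambda>_. x) ?y B') e = edge_weight \<tau> ?X (p' ` e)"
      proof (rule edge_weight_image[OF \<tau>(2)])
        fix i assume i: "i \<in> {r} \<union> B'"
        show "override_on (\<lambda>_. x) ?y B' i = ?X (p' i)"
        proof (cases "i \<in> B'")
          case True
          then show ?thesis using pB[OF True] p'B[OF True] by simp
        next
          case False
          then have "i = r" using i by simp
          then show ?thesis using B by (simp add: p'_def)
        qed
      qed
    qed (use B in auto)
    also have "\<dots> = forest (edge_weight \<tau> ?X) {r} B"
      using forest_image[OF _ _ inj, of r "edge_weight \<tau> ?X"] B unfolding img by (simp add: p'_def)
    finally show "?g B' ?y = ?g B y" using 1 by simp
  qed
  finally show ?thesis by simp
qed

text \<open>Integrated trees with root 1 held at \<open>x\<close> and \<open>m\<close> further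
  vertices. The root carries no factor \<open>w\<close>; it reappears in front of the final
  bound.\<close>

definition rooted_integral :: "('a \<Rightarrow> 'a \<Rightarrow> real) \<Rightarrow> ('a \<Rightarrow> real) \<Rightarrow> 'a \<Rightarrow> nat \<Rightarrow> ennreal" where
  "rooted_integral \<tau> w x m = (\<integral>\<^sup>+y. ennreal ((\<Prod>j\<in>{2..m + 1}. w (y j)) *
      forest (edge_weight \<tau> (override_on (\<lambda>_. x) y {2..m + 1})) {1} {2..m + 1}) \<partial>PiM {2..m + 1} (\<lambda>_. M))"

lemma rooted_integral_0: "rooted_integral \<tau> w x 0 = 1"
proof -
  interpret I: product_sigma_finite "\<lambda>_::nat. M" by (rule product_sigma_finite_const)
  have "forest u {1::nat} {} = 1" for u
    using forest_rec[of "{1::nat}" "{}" 1 u] by (simp add: forest_no_roots)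
  then show ?thesis
    using I.product_nn_integral_prod[of "{}" "\<lambda>_ _. 1"] by (simp add: rooted_integral_def)
qed

text \<open>The generating function of rooted trees formally solves
  \<open>T x = exp (\<integral> \<tau> x y * w y * T y)\<close>. The assumption on \<open>a\<close>
  says that \<open>exp (a x)\<close> is a supersolution of this equation, hence an upper
  bound.\<close>

lemma rooted_integral_sum_le:
  fixes \<tau> :: "'a \<Rightarrow> 'a \<Rightarrow> real" and w a :: "'a \<Rightarrow> real"
  assumes \<tau>: "(\<lambda>(x, y). \<tau> x y) \<in> borel_measurable (M \<Otimes>\<^sub>M M)" "\<And>x y. \<tau> x y = \<tau> y x" "\<And>x y. 0 \<le> \<tau> x y"
    and w: "w \<in> borel_measurable M" and w0: "\<And>x. 0 \<le> w x"
    and a: "a \<in> borel_measurable M"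
    and S: "AE x in M. x \<in> S"
      "\<And>x. x \<in> S \<Longrightarrow> x \<in> space M" "\<And>x. x \<in> S \<Longrightarrow> 0 \<le> a x"
      "\<And>x. x \<in> S \<Longrightarrow> (\<integral>\<^sup>+y. ennreal (\<tau> x y * w y * exp (a y)) \<partial>M) \<le> ennreal (a x)"
    and x: "x \<in> S"
  shows "(\<Sum>m. ennreal (1 / fact m) * rooted_integral \<tau> w x m) \<le> ennreal (exp (a x))"
proof -
  let ?F = "rooted_integral \<tau> w x"
  let ?T = "\<lambda>B y. forest (edge_weight \<tau> (override_on (\<lambda>_. x) y B)) {1} B"
  have fin: "(\<Sum>m\<le>N. ennreal (real (N choose m) / real (Suc N) ^ m) * ?F m) \<le> ennreal (exp (a x))" for N
  proof -
    define c where "c = 1 / real (Suc N)"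
    have c: "0 \<le> c" "c * card {1..Suc N} \<le> 1" by (auto simp: c_def)
    have sub: "{1..Suc N} - {1} = {2..Suc N}" by auto
    have "(\<Sum>m\<le>N. ennreal (real (N choose m) / real (Suc N) ^ m) * ?F m) = (\<Sum>m\<le>N. of_nat (N choose m) * (ennreal (c ^ m) * ?F m))"
    proof (intro sum.cong refl)
      fix m
      have "real (N choose m) / real (Suc N) ^ m = real (N choose m) * c ^ m"
        by (simp add: c_def power_one_over)
      then show "ennreal (real (N choose m) / real (Suc N) ^ m) * ?F m = of_nat (N choose m) * (ennreal (c ^ m) * ?F m)"
        using c by (simp add: ennreal_mult' ennreal_of_nat_eq_real_of_nat mult.assoc)
    qed
    also have "\<dots> = (\<Sum>B\<in>Pow {2..Suc N}. ennreal (c ^ card B) * ?F (card B))"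
      using sum_Pow_card[of "{2..Suc N}" "\<lambda>m. ennreal (c ^ m) * ?F m"] by simp
    also have "\<dots> = (\<Sum>B\<in>Pow {2..Suc N}. \<integral>\<^sup>+y. ennreal ((\<Prod>j\<in>B. c * w (y j)) * ?T B y) \<partial>PiM B (\<lambda>_. M))"
    proof (intro sum.cong refl)
      fix B assume B: "B \<in> Pow {2..Suc N}"
      then have fB: "finite B" "1 \<notin> B" using finite_subset by auto
      have "(\<integral>\<^sup>+y. ennreal ((\<Prod>j\<in>B. c * w (y j)) * ?T B y) \<partial>PiM B (\<lambda>_. M))
         = (\<integral>\<^sup>+y. ennreal (c ^ card B) * ennreal ((\<Prod>j\<in>B. w (y j)) * ?T B y) \<partial>PiM B (\<lambda>_. M))"
        using c by (intro nn_integral_cong) (simp add: prod.distrib ennreal_mult'[symmetric] mult.assoc)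
      also have "\<dots> = ennreal (c ^ card B) * (\<integral>\<^sup>+y. ennreal ((\<Prod>j\<in>B. w (y j)) * ?T B y) \<partial>PiM B (\<lambda>_. M))"
      proof (intro nn_integral_cmult measurable_compose[OF _ measurable_ennreal] borel_measurable_times borel_measurable_prod
          measurable_forest[OF \<tau>(1,2)])
        show "(\<lambda>y. override_on (\<lambda>_. x) y B k) \<in> measurable (PiM B (\<lambda>_. M)) M" for k
          using S(2)[OF x] by (cases "k \<in> B") (auto simp: override_on_def)
        show "(\<lambda>y. w (y j)) \<in> borel_measurable (PiM B (\<lambda>_. M))" if "j \<in> B" for j
          using that w by measurable
      qed (use fB in auto)
      also have "(\<integral>\<^sup>+y. ennreal ((\<Prod>j\<in>B. w (y j)) * ?T B y) \<partial>PiM B (\<lambda>_. M)) = ?F (card B)"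
        unfolding rooted_integral_def using fB S(2)[OF x] by (intro forest_integral_card[OF \<tau>(1,2) w]) auto
      finally show "ennreal (c ^ card B) * ?F (card B) = (\<integral>\<^sup>+y. ennreal ((\<Prod>j\<in>B. c * w (y j)) * ?T B y) \<partial>PiM B (\<lambda>_. M))"
        by simp
    qed
    also have "\<dots> \<le> (\<Prod>i\<in>{1::nat}. ennreal (exp (a x)))"
      using forest_integral_le[OF \<tau> w w0 a S c(1) _ _ c(2), of "{1}" "\<lambda>_. x"] x unfolding sub by simp
    finally show ?thesis by simp
  qed
  \<comment> \<open>Limits are taken among real numbers, so every term must be finite; the bound for
    \<open>N = m\<close> contains the term \<open>m\<close> with a positive coefficient.\<close>
  have Ftop: "?F m < top" for m
  proof (rule ccontr)
    assume "\<not> ?F m < top"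
    then have "?F m = top" using top.not_eq_extremum by blast
    then have "ennreal (real (m choose m) / real (Suc m) ^ m) * ?F m = top"
      by (simp add: ennreal_mult_top)
    moreover have "ennreal (real (m choose m) / real (Suc m) ^ m) * ?F m
        \<le> (\<Sum>k\<le>m. ennreal (real (m choose k) / real (Suc m) ^ k) * ?F k)"
      by (intro member_le_sum) auto
    ultimately have "top \<le> ennreal (exp (a x))" using order.trans[OF _ fin[of m]] by metis
    then show False by (simp add: top_unique)
  qed
  define f where "f = (\<lambda>m. enn2real (?F m))"
  have Ff: "?F m = ennreal (f m)" "0 \<le> f m" for m using Ftop[of m] by (auto simp: f_def)
  have conv: "ennreal (\<Sum>m<K. c m * f m) = (\<Sum>m<K. ennreal (c m) * ?F m)" if "\<And>m. 0 \<le> c m" for c K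
  proof -
    have "(\<Sum>m<K. ennreal (c m) * ?F m) = (\<Sum>m<K. ennreal (c m * f m))"
      unfolding Ff(1) using that Ff(2) by (simp add: ennreal_mult)
    also have "\<dots> = ennreal (\<Sum>m<K. c m * f m)"
      using that Ff(2) by (intro sum_ennreal) simp
    finally show ?thesis ..
  qed
  \<comment> \<open>For a fixed number \<open>K\<close> of terms the coefficients tend to
    \<open>1 / fact m\<close> as \<open>N\<close> grows; only afterwards is the supremum over
    \<open>K\<close> taken.\<close>
  have part: "(\<Sum>m<K. ennreal (1 / fact m) * ?F m) \<le> ennreal (exp (a x))" for K
  proof -
    have "(\<Sum>m<K. real (N choose m) / real (Suc N) ^ m * f m) \<le> exp (a x)" if "K \<le> N" for N
    proof -
      have "ennreal (\<Sum>m<K. real (N choose m) / real (Suc N) ^ m * f m) = (\<Sum>m<K. ennreal (real (N choose m) / real (Suc N) ^ m) * ?F m)"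
        by (rule conv) simp
      also have "\<dots> \<le> (\<Sum>m\<le>N. ennreal (real (N choose m) / real (Suc N) ^ m) * ?F m)"
        using that by (intro sum_mono2) auto
      also have "\<dots> \<le> ennreal (exp (a x))" by (rule fin)
      finally show ?thesis by (simp add: ennreal_le_iff)
    qed
    moreover have "(\<lambda>N. \<Sum>m<K. real (N choose m) / real (Suc N) ^ m * f m) \<longlonglongrightarrow> (\<Sum>m<K. 1 / fact m * f m)"
      by (intro tendsto_sum tendsto_mult tendsto_const choose_div_power_tendsto)
    ultimately have "(\<Sum>m<K. 1 / fact m * f m) \<le> exp (a x)"
      by (intro LIMSEQ_le_const2) auto
    then have "ennreal (\<Sum>m<K. 1 / fact m * f m) \<le> ennreal (exp (a x))" by (rule ennreal_leI)
    moreover have "ennreal (\<Sum>m<K. 1 / fact m * f m) = (\<Sum>m<K. ennreal (1 / fact m) * ?F m)"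
      by (rule conv) simp
    ultimately show ?thesis by (simp only:)
  qed
  then show ?thesis by (subst suminf_eq_SUP) (intro SUP_least)
qed

lemma AE_PiM_insert:
  fixes I :: "nat set"
  assumes "finite I" "i \<notin> I" "AE x in PiM (insert i I) (\<lambda>_. M). P x"
  shows "AE y in M. AE x in PiM I (\<lambda>_. M). P (x(i := y))"
proof -
  interpret I: product_sigma_finite "\<lambda>_::nat. M" by (rule product_sigma_finite_const)
  interpret I': finite_product_sigma_finite "\<lambda>_::nat. M" I by standard (rule assms(1))
  from assms(3) obtain N where N: "{x\<in>space (PiM (insert i I) (\<lambda>_. M)). \<not> P x} \<subseteq> N" "N \<in> null_sets (PiM (insert i I) (\<lambda>_. M))"
    by (auto simp: eventually_ae_filter)
  have [measurable]: "N \<in> sets (PiM (insert i I) (\<lambda>_. M))" using N by auto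
  have pm[measurable]: "(\<lambda>p. (snd p)(i := fst p)) \<in> measurable (M \<Otimes>\<^sub>M PiM I (\<lambda>_. M)) (PiM (insert i I) (\<lambda>_. M))"
    by measurable
  have "(\<integral>\<^sup>+y. (\<integral>\<^sup>+x. indicator N (x(i := y)) \<partial>PiM I (\<lambda>_. M)) \<partial>M) = (\<integral>\<^sup>+x. indicator N x \<partial>PiM (insert i I) (\<lambda>_. M))"
    using assms by (intro I.product_nn_integral_insert_rev[symmetric]) auto
  also have "\<dots> = 0" using N by (simp add: null_sets_def)
  finally have 0: "(\<integral>\<^sup>+y. (\<integral>\<^sup>+x. indicator N (x(i := y)) \<partial>PiM I (\<lambda>_. M)) \<partial>M) = 0" .
  have m1: "(\<lambda>y. \<integral>\<^sup>+x. indicator N (x(i := y)) \<partial>PiM I (\<lambda>_. M)) \<in> borel_measurable M"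
    by (intro I'.borel_measurable_nn_integral) (use measurable_compose[OF pm, of "indicator N" borel] in \<open>simp add: split_beta'\<close>)
  have "AE y in M. (\<integral>\<^sup>+x. indicator N (x(i := y)) \<partial>PiM I (\<lambda>_. M)) = 0"
    using 0 by (subst (asm) nn_integral_0_iff_AE[OF m1])
  then show ?thesis using AE_space
  proof eventually_elim
    case (elim y)
    have um: "(\<lambda>x. x(i := y)) \<in> measurable (PiM I (\<lambda>_. M)) (PiM (insert i I) (\<lambda>_. M))"
      using elim by measurable
    have "AE x in PiM I (\<lambda>_. M). indicator N (x(i := y)) = (0::ennreal)"
      using elim(1) by (subst (asm) nn_integral_0_iff_AE) (use um in measurable)
    then show ?case using AE_space
    proof eventually_elim
      case (elim x)
      have "x(i := y) \<in> space (PiM (insert i I) (\<lambda>_. M))" using measurable_space[OF um elim(2)] .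
      with elim(1) N(1) show ?case by (auto simp: indicator_def split: if_splits)
    qed
  qed
qed

end

section \<open>Translation of \<open>phi\<close> and of the pair products into sums and products
  over edge sets\<close>

lemma connected_graphs_eq: "connected_graphs n = spanning_graphs {1..n}"
proof -
  have "e \<in> graph_edges n \<longleftrightarrow> e \<in> edges {1..n}" for e
  proof
    assume "e \<in> edges {1..n}"
    then obtain i j where "e = {i, j}" "i \<in> {1..n}" "j \<in> {1..n}" "i \<noteq> j" by (rule edges_cases)
    then show "e \<in> graph_edges n" unfolding graph_edges_def by blast
  qed (auto simp: graph_edges_def edges_pair_iff)
  then have "graph_edges n = edges {1..n}" by blast
  then show ?thesis by (simp add: connected_graphs_def spanning_graphs_def adj_def)
qed

lemma phi_eq_conn:
  assumes "n \<ge> 1"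
  shows "phi z n x = conn (edge_weight z x) {1..n} / fact n"
proof (cases "n = 1")
  case False
  then show ?thesis by (simp add: phi_def connected_graphs_eq conn_def edge_weight_def)
qed (simp add: phi_def)

lemma prod_pairs_eq_edges:
  fixes g :: "nat set \<Rightarrow> 'c::comm_monoid_mult"
  shows "(\<Prod>i\<in>{1..n}. \<Prod>j\<in>{i<..n}. g {i, j}) = prod g (edges {1..n})"
proof (induction n)
  case (Suc n)
  have "(\<Prod>i\<in>{1..Suc n}. \<Prod>j\<in>{i<..Suc n}. g {i, j}) = (\<Prod>i\<in>{1..n}. \<Prod>j\<in>{i<..Suc n}. g {i, j})"
    by simp
  also have "\<dots> = (\<Prod>i\<in>{1..n}. g {Suc n, i} * (\<Prod>j\<in>{i<..n}. g {i, j}))"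
  proof (intro prod.cong refl)
    fix i assume "i \<in> {1..n}"
    then have "{i<..Suc n} = insert (Suc n) {i<..n}" by auto
    then show "(\<Prod>j\<in>{i<..Suc n}. g {i, j}) = g {Suc n, i} * (\<Prod>j\<in>{i<..n}. g {i, j})"
      by (simp add: insert_commute)
  qed
  also have "\<dots> = prod g (edges (insert (Suc n) {1..n}))"
    using Suc by (subst prod_edges_insert) (auto simp: prod.distrib)
  also have "insert (Suc n) {1..n} = {1..Suc n}" by auto
  finally show ?case .
qed simp

lemma prod_pairs_edge_weight:
  fixes F :: "'b \<Rightarrow> 'c::comm_monoid_mult"
  assumes "\<And>x y. z x y = z y x"
  shows "(\<Prod>i\<in>{1..n}. \<Prod>j\<in>{i<..n}. F (z (x i) (x j))) = (\<Prod>e\<in>edges {1..n}. F (edge_weight z x e))"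
  using prod_pairs_eq_edges[where n = n and g = "\<lambda>e. F (edge_weight z x e)"] by (simp add: edge_weight_pair[OF assms])

section \<open>Convergence of the cluster expansion\<close>

context sigma_finite_measure
begin

text \<open>The tree bounds need stability of every subconfiguration, which the bound for the full
  configuration does not give pointwise. For \<open>A\<close> one takes the assumption for
  \<open>card A\<close> points, relabels it, and lifts it to all \<open>n\<close> coordinates; there
  are only finitely many \<open>A\<close>.\<close>

lemma AE_stable_subsets:
  fixes z :: "'a \<Rightarrow> 'a \<Rightarrow> complex" and b :: "'a \<Rightarrow> real"
  assumes zsym: "\<And>x y. z x y = z y x"
    and stab: "\<And>n. AE x in PiM {1..n} (\<lambda>_. M).
        (\<Prod>e\<in>edges {1..n}. norm (1 + edge_weight z x e)) \<le> (\<Prod>i\<in>{1..n}. exp (b (x i)))"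
  shows "AE x in PiM {1..n} (\<lambda>_. M). \<forall>A\<in>Pow {1..n}.
        (\<Prod>e\<in>edges A. norm (1 + edge_weight z x e)) \<le> (\<Prod>i\<in>A. exp (b (x i)))"
proof (rule AE_finite_allI)
  fix A assume A: "A \<in> Pow {1..n}"
  then have "finite A" using finite_subset by auto
  then obtain p where p: "bij_betw p {1..card A} A" using ex_bij_betw_nat_finite_1 by blast
  have inj: "inj_on p {1..card A}" and img: "p ` {1..card A} = A" using p by (auto simp: bij_betw_def)
  from AE_PiM_restrict[OF _ _ AE_PiM_bij[OF _ p stab]] A
  have "AE x in PiM {1..n} (\<lambda>_. M).
      (\<Prod>e\<in>edges {1..card A}. norm (1 + edge_weight z (\<lambda>i\<in>{1..card A}. restrict x A (p i)) e))
        \<le> (\<Prod>i\<in>{1..card A}. exp (b ((\<lambda>i\<in>{1..card A}. restrict x A (p i)) i)))" by auto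
  then show "AE x in PiM {1..n} (\<lambda>_. M).
      (\<Prod>e\<in>edges A. norm (1 + edge_weight z x e)) \<le> (\<Prod>i\<in>A. exp (b (x i)))"
  proof eventually_elim
    case (elim x)
    let ?y = "\<lambda>i\<in>{1..card A}. restrict x A (p i)"
    have y: "?y i = x (p i)" if "i \<in> {1..card A}" for i using that img by auto
    have "(\<Prod>e\<in>edges {1..card A}. norm (1 + edge_weight z ?y e)) = (\<Prod>e\<in>edges {1..card A}. norm (1 + edge_weight z x (p ` e)))"
    proof (intro prod.cong refl)
      fix e assume "e \<in> edges {1..card A}"
      then have "edge_weight z ?y e = edge_weight z x (p ` e)"
        using edge_weight_image[of z e "{1..card A}" ?y x p] zsym y by blast
      then show "norm (1 + edge_weight z ?y e) = norm (1 + edge_weight z x (p ` e))" by simp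
    qed
    also have "\<dots> = (\<Prod>e\<in>edges A. norm (1 + edge_weight z x e))"
      using edges_image[OF inj] unfolding img
      by (subst prod.reindex[OF inj_on_image_edges[OF inj], unfolded o_def, symmetric]) simp
    finally have 1: "(\<Prod>e\<in>edges {1..card A}. norm (1 + edge_weight z ?y e)) = (\<Prod>e\<in>edges A. norm (1 + edge_weight z x e))" .
    have "(\<Prod>i\<in>{1..card A}. exp (b (?y i))) = (\<Prod>i\<in>{1..card A}. exp (b (x (p i))))"
      using y by (intro prod.cong refl) simp
    also have "\<dots> = (\<Prod>i\<in>A. exp (b (x i)))" by (rule prod.reindex_bij_betw[OF p])
    finally show ?case using elim 1 by simp
  qed
qed simp

text \<open>Common to both cases: (\<open>\<tau>\<close>, \<open>w\<close>) is later the modulus of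
  \<open>zeta\<close> with \<open>exp (2 * b x)\<close>, or the modulus of \<open>ubar\<close> with
  \<open>exp (b x)\<close>. Pinning the first point makes it the root of all trees.\<close>

lemma cluster_bound:
  fixes z :: "'a \<Rightarrow> 'a \<Rightarrow> complex" and \<tau> :: "'a \<Rightarrow> 'a \<Rightarrow> real" and w a :: "'a \<Rightarrow> real"
  assumes zsym: "\<And>x y. z x y = z y x"
    and \<tau>: "(\<lambda>(x, y). \<tau> x y) \<in> borel_measurable (M \<Otimes>\<^sub>M M)" "\<And>x y. \<tau> x y = \<tau> y x" "\<And>x y. 0 \<le> \<tau> x y"
    and w[measurable]: "w \<in> borel_measurable M" and w0: "\<And>x. 0 \<le> w x"
    and a: "a \<in> borel_measurable M" and a0: "\<And>x. x \<in> space M \<Longrightarrow> 0 \<le> a x"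
    and S: "AE x in M. (\<integral>\<^sup>+y. ennreal (\<tau> x y * w y * exp (a y)) \<partial>M) \<le> ennreal (a x)"
    and tree: "\<And>n. n \<ge> 1 \<Longrightarrow> AE x in PiM {1..n} (\<lambda>_. M).
      norm (conn (edge_weight z x) {1..n}) \<le> (\<Prod>i\<in>{1..n}. w (x i)) * forest (edge_weight \<tau> x) {1} ({1..n} - {1})"
  shows "AE x1 in M. (\<Sum>n. \<integral>\<^sup>+ x. ennreal (real (n + 2) * norm (phi z (n + 2) (x(1 := x1)))) \<partial>(PiM {2..n + 2} (\<lambda>_. M)))
            \<le> ennreal ((exp (a x1) - 1) * w x1)"
proof -
  define S' where "S' = {x\<in>space M. (\<integral>\<^sup>+y. ennreal (\<tau> x y * w y * exp (a y)) \<partial>M) \<le> ennreal (a x)}"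
  have S': "AE x in M. x \<in> S'" using S AE_space by eventually_elim (auto simp: S'_def)
  have ins: "{1..n + 2} = insert 1 {2..n + 2}" for n :: nat by auto
  have "AE x1 in M. \<forall>n. AE x in PiM {2..n + 2} (\<lambda>_. M).
      norm (conn (edge_weight z (x(1 := x1))) {1..n + 2}) \<le> (\<Prod>i\<in>{1..n + 2}. w ((x(1 := x1)) i)) *
        forest (edge_weight \<tau> (x(1 := x1))) {1} ({1..n + 2} - {1})"
    unfolding AE_all_countable
  proof
    fix n :: nat
    have "AE x in PiM (insert 1 {2..n + 2}) (\<lambda>_. M).
      norm (conn (edge_weight z x) {1..n + 2}) \<le> (\<Prod>i\<in>{1..n + 2}. w (x i)) * forest (edge_weight \<tau> x) {1} ({1..n + 2} - {1})"
      using tree[of "n + 2"] unfolding ins[symmetric] by simp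
    from AE_PiM_insert[OF _ _ this] show "AE x1 in M. AE x in PiM {2..n + 2} (\<lambda>_. M).
      norm (conn (edge_weight z (x(1 := x1))) {1..n + 2}) \<le> (\<Prod>i\<in>{1..n + 2}. w ((x(1 := x1)) i)) *
        forest (edge_weight \<tau> (x(1 := x1))) {1} ({1..n + 2} - {1})" by simp
  qed
  then show ?thesis using S'
  proof eventually_elim
    case (elim x1)
    have x1: "x1 \<in> space M" using elim by (simp add: S'_def)
    let ?t = "\<lambda>m. ennreal (1 / fact m) * rooted_integral \<tau> w x1 m"
    have term_le: "(\<integral>\<^sup>+ x. ennreal (real (n + 2) * norm (phi z (n + 2) (x(1 := x1)))) \<partial>(PiM {2..n + 2} (\<lambda>_. M)))
        \<le> ennreal (w x1) * ?t (Suc n)" for n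
    proof -
      let ?g = "\<lambda>y. (\<Prod>j\<in>{2..n + 2}. w (y j)) * forest (edge_weight \<tau> (override_on (\<lambda>_. x1) y {2..n + 2})) {1} {2..n + 2}"
      have diff: "{1..n + 2} - {1} = {2..n + 2}" by auto
      have "(\<integral>\<^sup>+ x. ennreal (real (n + 2) * norm (phi z (n + 2) (x(1 := x1)))) \<partial>(PiM {2..n + 2} (\<lambda>_. M)))
        \<le> (\<integral>\<^sup>+ y. ennreal (w x1 / fact (Suc n)) * ennreal (?g y) \<partial>(PiM {2..n + 2} (\<lambda>_. M)))"
      proof (rule nn_integral_mono_AE)
        from elim(1) have "AE x in PiM {2..n + 2} (\<lambda>_. M).
          norm (conn (edge_weight z (x(1 := x1))) {1..n + 2}) \<le> (\<Prod>i\<in>{1..n + 2}. w ((x(1 := x1)) i)) *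
            forest (edge_weight \<tau> (x(1 := x1))) {1} ({1..n + 2} - {1})" by blast
        then show "AE x in PiM {2..n + 2} (\<lambda>_. M). ennreal (real (n + 2) * norm (phi z (n + 2) (x(1 := x1))))
          \<le> ennreal (w x1 / fact (Suc n)) * ennreal (?g x)"
        proof eventually_elim
          case (elim y)
          \<comment> \<open>The prefactor reduces \<open>1 / fact (n + 2)\<close> to
            \<open>1 / fact (n + 1)\<close>, the coefficient of trees with \<open>n + 1\<close>
            vertices besides the root.\<close>
          have "real (n + 2) * norm (phi z (n + 2) (y(1 := x1))) = norm (conn (edge_weight z (y(1 := x1))) {1..n + 2}) / fact (Suc n)"
          proof -
            have "norm (phi z (n + 2) (y(1 := x1))) = norm (conn (edge_weight z (y(1 := x1))) {1..n + 2}) / fact (n + 2)"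
              by (subst phi_eq_conn) (simp, simp only: norm_divide norm_fact)
            moreover have "fact (n + 2) = real (n + 2) * fact (Suc n)" by simp
            ultimately show ?thesis by (simp only: times_divide_eq_right) simp
          qed
          also have "\<dots> \<le> ((\<Prod>i\<in>{1..n + 2}. w ((y(1 := x1)) i)) * forest (edge_weight \<tau> (y(1 := x1))) {1} ({1..n + 2} - {1})) / fact (Suc n)"
            using elim by (intro divide_right_mono) auto
          also have "(\<Prod>i\<in>{1..n + 2}. w ((y(1 := x1)) i)) = w x1 * (\<Prod>j\<in>{2..n + 2}. w (y j))"
            unfolding ins by (subst prod.insert) auto
          also have "forest (edge_weight \<tau> (y(1 := x1))) {1} ({1..n + 2} - {1}) =
              forest (edge_weight \<tau> (override_on (\<lambda>_. x1) y {2..n + 2})) {1} {2..n + 2}"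
            unfolding diff
          proof (rule forest_cong)
            fix e assume "e \<in> edges ({1} \<union> {2..n + 2})"
            then show "edge_weight \<tau> (y(1 := x1)) e = edge_weight \<tau> (override_on (\<lambda>_. x1) y {2..n + 2}) e"
              by (rule edge_weight_cong[OF \<tau>(2)]) (auto simp: override_on_def)
          qed auto
          finally have "real (n + 2) * norm (phi z (n + 2) (y(1 := x1))) \<le> (w x1 / fact (Suc n)) * ?g y"
            by (simp only: times_divide_eq_left mult.assoc)
          then show ?case using w0 by (subst ennreal_mult'[symmetric]) (auto intro: ennreal_leI)
        qed
      qed
      also have "\<dots> = ennreal (w x1 / fact (Suc n)) * (\<integral>\<^sup>+ y. ennreal (?g y) \<partial>(PiM {2..n + 2} (\<lambda>_. M)))"
      proof (intro nn_integral_cmult measurable_compose[OF _ measurable_ennreal] borel_measurable_times borel_measurable_prod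
          measurable_forest[OF \<tau>(1,2)])
        show "(\<lambda>y. override_on (\<lambda>_. x1) y {2..n + 2} k) \<in> measurable (PiM {2..n + 2} (\<lambda>_. M)) M" for k
          using x1 by (cases "k \<in> {2..n + 2}") (auto simp: override_on_def)
      qed auto
      also have "(\<integral>\<^sup>+ y. ennreal (?g y) \<partial>(PiM {2..n + 2} (\<lambda>_. M))) = rooted_integral \<tau> w x1 (Suc n)"
        unfolding rooted_integral_def by simp
      also have "ennreal (w x1 / fact (Suc n)) = ennreal (w x1) * ennreal (1 / fact (Suc n))"
        using w0 by (subst ennreal_mult'[symmetric]) auto
      finally show ?thesis by (simp only: mult.assoc)
    qed
    have "(\<Sum>m. ?t m) \<le> ennreal (exp (a x1))"
      using a0 by (intro rooted_integral_sum_le[OF \<tau> w w0 a S' _ _ _ elim(2)]) (auto simp: S'_def)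
    \<comment> \<open>The tree consisting of the root alone contributes 1. The clusters here have at
      least two points, hence \<open>exp (a x1) - 1\<close>.\<close>
    moreover have "(\<Sum>m. ?t m) = (\<Sum>n. ?t (Suc n)) + 1"
      using suminf_offset[of ?t 1] by (simp add: rooted_integral_0)
    ultimately have "(\<Sum>n. ?t (Suc n)) + 1 - 1 \<le> ennreal (exp (a x1)) - 1"
      by (intro ennreal_minus_mono) auto
    then have t: "(\<Sum>n. ?t (Suc n)) \<le> ennreal (exp (a x1) - 1)"
      by (simp add: ennreal_minus flip: ennreal_1)
    have "(\<Sum>n. \<integral>\<^sup>+ x. ennreal (real (n + 2) * norm (phi z (n + 2) (x(1 := x1)))) \<partial>(PiM {2..n + 2} (\<lambda>_. M)))
       \<le> (\<Sum>n. ennreal (w x1) * ?t (Suc n))"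
      by (intro suminf_le term_le) auto
    also have "\<dots> = ennreal (w x1) * (\<Sum>n. ?t (Suc n))" by (rule ennreal_suminf_cmult)
    also have "\<dots> \<le> ennreal (w x1) * ennreal (exp (a x1) - 1)" using t by (intro mult_left_mono) auto
    also have "\<dots> = ennreal ((exp (a x1) - 1) * w x1)" using w0 by (simp add: ennreal_mult' mult.commute)
    finally show ?case .
  qed
qed

lemma measurable_phi:
  assumes "(\<lambda>(x, y). z x y) \<in> borel_measurable (M \<Otimes>\<^sub>M M)" "\<And>x y. z x y = z y x" "n \<ge> 1"
  shows "phi z n \<in> borel_measurable (PiM {1..n} (\<lambda>_. M))"
proof -
  have "(\<lambda>x. conn (edge_weight z x) {1..n}) \<in> borel_measurable (PiM {1..n} (\<lambda>_. M))"
    by (intro measurable_conn[OF assms(1,2)] measurable_component_singleton)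
  moreover have "phi z n = (\<lambda>x. conn (edge_weight z x) {1..n} / fact n)"
    using assms(3) by (intro ext phi_eq_conn)
  ultimately show ?thesis by simp
qed

text \<open>Integrating the pinned bound over the first point controls all clusters of at least two
  points, their prefactor being at least 1; the single points contribute the total mass of
  \<open>M\<close>.\<close>

lemma cluster_sum_finite:
  fixes z :: "'a \<Rightarrow> 'a \<Rightarrow> complex" and f :: "'a \<Rightarrow> ennreal"
  assumes z: "(\<lambda>(x, y). z x y) \<in> borel_measurable (M \<Otimes>\<^sub>M M)" "\<And>x y. z x y = z y x"
    and fin: "emeasure M (space M) < \<infinity>"
    and bd: "AE x1 in M. (\<Sum>n. \<integral>\<^sup>+ x. ennreal (real (n + 2) * norm (phi z (n + 2) (x(1 := x1)))) \<partial>(PiM {2..n + 2} (\<lambda>_. M)))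
            \<le> f x1"
    and f: "(\<integral>\<^sup>+x. f x \<partial>M) < \<infinity>"
  shows "(\<Sum>n. \<integral>\<^sup>+ x. ennreal (norm (phi z (Suc n) x)) \<partial>(PiM {1..Suc n} (\<lambda>_. M))) < \<infinity>"
proof -
  interpret I: product_sigma_finite "\<lambda>_::nat. M" by (rule product_sigma_finite_const)
  let ?s = "\<lambda>n. \<integral>\<^sup>+ x. ennreal (norm (phi z (Suc n) x)) \<partial>(PiM {1..Suc n} (\<lambda>_. M))"
  let ?h = "\<lambda>n x1 x. ennreal (real (n + 2) * norm (phi z (n + 2) (x(1 := x1))))"
  have ins: "{1..n + 2} = insert 1 {2..n + 2}" for n :: nat by auto
  have s0: "?s 0 = emeasure M (space M)"
  proof -
    have "?s 0 = (\<integral>\<^sup>+ x. 1 \<partial>(PiM {1::nat} (\<lambda>_. M)))" by (simp add: phi_def)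
    also have "\<dots> = (\<integral>\<^sup>+ x. 1 \<partial>M)" by (rule I.product_nn_integral_singleton) simp
    finally show ?thesis by simp
  qed
  have pm: "(\<lambda>x. ennreal (real (n + 2) * norm (phi z (n + 2) x))) \<in> borel_measurable (PiM (insert 1 {2..n + 2}) (\<lambda>_. M))" for n
    using measurable_phi[OF z, of "n + 2"] unfolding ins by measurable
  have pm2: "(\<lambda>x1. \<integral>\<^sup>+ x. ?h n x1 x \<partial>(PiM {2..n + 2} (\<lambda>_. M))) \<in> borel_measurable M" for n
  proof -
    interpret I': finite_product_sigma_finite "\<lambda>_::nat. M" "{2..n + 2}" by standard simp
    have "(\<lambda>p. (snd p)(1 := fst p)) \<in> measurable (M \<Otimes>\<^sub>M PiM {2..n + 2} (\<lambda>_. M)) (PiM (insert 1 {2..n + 2}) (\<lambda>_. M))"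
      by measurable
    from measurable_compose[OF this pm] show ?thesis
      by (intro I'.borel_measurable_nn_integral) (simp add: split_beta')
  qed
  have sS: "?s (Suc n) \<le> (\<integral>\<^sup>+ x1. (\<integral>\<^sup>+ x. ?h n x1 x \<partial>(PiM {2..n + 2} (\<lambda>_. M))) \<partial>M)" for n
  proof -
    have "?s (Suc n) \<le> (\<integral>\<^sup>+ x. ennreal (real (n + 2) * norm (phi z (n + 2) x)) \<partial>(PiM {1..n + 2} (\<lambda>_. M)))"
      unfolding Suc_eq_plus1 add.assoc one_add_one
      by (intro nn_integral_mono ennreal_leI) (simp add: mult_le_cancel_right1)
    also have "\<dots> = (\<integral>\<^sup>+ x1. (\<integral>\<^sup>+ x. ?h n x1 x \<partial>(PiM {2..n + 2} (\<lambda>_. M))) \<partial>M)"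
      unfolding ins by (rule I.product_nn_integral_insert_rev[OF _ _ pm]) auto
    finally show ?thesis .
  qed
  have "(\<Sum>n. ?s n) = (\<Sum>n. ?s (Suc n)) + ?s 0"
    using suminf_offset[of ?s 1] by simp
  also have "(\<Sum>n. ?s (Suc n)) \<le> (\<Sum>n. \<integral>\<^sup>+ x1. (\<integral>\<^sup>+ x. ?h n x1 x \<partial>(PiM {2..n + 2} (\<lambda>_. M))) \<partial>M)"
    by (intro suminf_le sS) auto
  also have "\<dots> = (\<integral>\<^sup>+ x1. (\<Sum>n. \<integral>\<^sup>+ x. ?h n x1 x \<partial>(PiM {2..n + 2} (\<lambda>_. M))) \<partial>M)"
    by (intro nn_integral_suminf[symmetric] pm2)
  also have "\<dots> \<le> (\<integral>\<^sup>+x. f x \<partial>M)" by (rule nn_integral_mono_AE[OF bd])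
  finally have "(\<Sum>n. ?s n) \<le> (\<integral>\<^sup>+x. f x \<partial>M) + ?s 0" by (simp add: add_right_mono)
  also have "\<dots> < \<infinity>" using f fin s0 by (simp add: ennreal_add_less_top less_top)
  finally show ?thesis .
qed

end

section \<open>Exponentiation\<close>

lemma continuous_on_cball_powser:
  fixes c :: "nat \<Rightarrow> complex"
  assumes "summable (\<lambda>n. norm (c n))"
  shows "continuous_on (cball 0 1) (\<lambda>s. \<Sum>n. c n * s ^ n)"
proof (rule uniform_limit_theorem)
  show "uniform_limit (cball 0 1) (\<lambda>n s. \<Sum>i<n. c i * s ^ i) (\<lambda>s. \<Sum>n. c n * s ^ n) sequentially"
  proof (rule Weierstrass_m_test[OF _ assms])
    fix n and s :: complex assume "s \<in> cball 0 1"
    then have "norm s ^ n \<le> 1" by (intro power_le_one) auto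
    then show "norm (c n * s ^ n) \<le> norm (c n)"
      by (simp add: norm_mult norm_power mult_left_le)
  qed
qed (auto intro!: always_eventually continuous_intros)

lemma sums_exp_of_recursion:
  fixes Z c :: "nat \<Rightarrow> complex"
  assumes Z0: "Z 0 = 1"
    and rec: "\<And>n. of_nat (Suc n) * Z (Suc n) = (\<Sum>k\<le>n. of_nat (Suc k) * c (Suc k) * Z (n - k))"
    and sZ: "summable (\<lambda>n. norm (Z n))" and sc: "summable (\<lambda>n. norm (c (Suc n)))"
  shows "Z sums exp (\<Sum>n. c (Suc n))"
proof -
  \<comment> \<open>The value \<open>c 0\<close> is not part of the cluster series; setting it to 0
    makes \<open>g\<close> vanish at the origin, which fixes the constant of integration.\<close>
  define C where "C = (\<lambda>n. if n = 0 then 0 else c n)"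
  have CS: "C (Suc n) = c (Suc n)" for n by (simp add: C_def)
  have sC: "summable (\<lambda>n. norm (C n))"
    using sc by (subst summable_Suc_iff[symmetric]) (simp add: CS)
  define f where "f = (\<lambda>s. \<Sum>n. Z n * s ^ n)"
  define g where "g = (\<lambda>s. \<Sum>n. C n * s ^ n)"
  have sum1: "summable (\<lambda>n. a n * 1 ^ n)" if "summable (\<lambda>n. norm (a n))" for a :: "nat \<Rightarrow> complex"
    using summable_norm_cancel[OF that] by simp
  have D: "((\<lambda>s. \<Sum>n. a n * s ^ n) has_field_derivative (\<Sum>n. diffs a n * s ^ n)) (at s)"
    if "summable (\<lambda>n. norm (a n))" "norm s < 1" for a and s :: complex
    using termdiffs_strong[OF sum1[OF that(1)], of s] that(2) by simp
  \<comment> \<open>The Cauchy product needs absolute convergence of the differentiated series. This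
    may fail on the unit circle, but holds inside it by comparison at a radius \<open>r\<close>
    between \<open>norm s\<close> and 1.\<close>
  have dabs: "summable (\<lambda>n. norm (diffs C n * s ^ n))" if "norm s < 1" for s
  proof -
    obtain r where r: "norm s < r" "r < 1" using dense[OF \<open>norm s < 1\<close>] by blast
    then have "0 < r" using norm_ge_zero[of s] by linarith
    have "summable (\<lambda>n. diffs C n * of_real r ^ n)"
      by (rule termdiff_converges[where K = 1])
        (use r \<open>0 < r\<close> powser_inside[OF sum1[OF sC]] in auto)
    from powser_insidea[OF this] r \<open>0 < r\<close> show ?thesis by simp
  qed
  have ODE: "(\<Sum>n. diffs Z n * s ^ n) = (\<Sum>n. diffs C n * s ^ n) * f s" if "norm s < 1" for s
  proof -
    have "summable (\<lambda>n. norm (Z n * s ^ n))"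
      using powser_insidea[OF sum1[OF sZ], of s] that by simp
    then have "(\<Sum>n. diffs C n * s ^ n) * f s = (\<Sum>n. \<Sum>k\<le>n. diffs C k * s ^ k * (Z (n - k) * s ^ (n - k)))"
      unfolding f_def by (rule Cauchy_product[OF dabs[OF that]])
    also have "\<dots> = (\<Sum>n. diffs Z n * s ^ n)"
    proof (intro suminf_cong)
      fix n
      have "(\<Sum>k\<le>n. diffs C k * s ^ k * (Z (n - k) * s ^ (n - k))) = (\<Sum>k\<le>n. (of_nat (Suc k) * c (Suc k) * Z (n - k)) * s ^ n)"
      proof (intro sum.cong refl)
        fix k assume "k \<in> {..n}"
        then have "s ^ n = s ^ k * s ^ (n - k)" by (simp flip: power_add)
        then show "diffs C k * s ^ k * (Z (n - k) * s ^ (n - k)) = (of_nat (Suc k) * c (Suc k) * Z (n - k)) * s ^ n"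
          by (simp add: diffs_def CS mult_ac)
      qed
      also have "\<dots> = diffs Z n * s ^ n"
        unfolding diffs_def rec by (simp add: sum_distrib_right)
      finally show "(\<Sum>k\<le>n. diffs C k * s ^ k * (Z (n - k) * s ^ (n - k))) = diffs Z n * s ^ n" .
    qed
    finally show ?thesis by simp
  qed
  \<comment> \<open>Dividing by the expected solution avoids a complex logarithm of
    \<open>f\<close>.\<close>
  have "\<exists>k. \<forall>s\<in>ball 0 1. f s * exp (- g s) = k"
  proof (rule has_field_derivative_zero_constant)
    fix s :: complex assume "s \<in> ball 0 1"
    then have s: "norm s < 1" by simp
    define dC where "dC = (\<Sum>n. diffs C n * s ^ n)"
    have df: "(f has_field_derivative dC * f s) (at s)"
      using D[OF sZ s] unfolding ODE[OF s] dC_def f_def .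
    have dg: "(g has_field_derivative dC) (at s)"
      using D[OF sC s] unfolding dC_def g_def .
    have "((\<lambda>s. f s * exp (- g s)) has_field_derivative
        (dC * f s) * exp (- g s) + (exp (- g s) * - dC) * f s) (at s)"
      by (intro DERIV_mult df DERIV_fun_exp DERIV_minus dg)
    also have "(dC * f s) * e + (e * - dC) * f s = 0" for e by simp
    finally show "((\<lambda>s. f s * exp (- g s)) has_field_derivative 0) (at s within ball 0 1)"
      by (rule has_field_derivative_at_within)
  qed simp
  then obtain k where k: "\<And>s. norm s < 1 \<Longrightarrow> f s * exp (- g s) = k" by auto
  have "f 0 = 1" "g 0 = 0" unfolding f_def g_def using Z0 by (simp_all add: powser_zero C_def)
  then have "k = 1" using k[of 0] by simp
  then have fg: "f s = exp (g s)" if "norm s < 1" for s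
    using k[OF that] by (simp add: exp_minus field_simps)
  define r where "r = (\<lambda>n. 1 - 1 / of_nat (Suc n) :: complex)"
  have r_real: "r n = of_real (1 - 1 / real (Suc n))" for n by (simp add: r_def)
  have rn: "norm (r n) < 1" for n
    unfolding r_real norm_of_real by (simp add: abs_less_iff field_simps)
  have "r \<longlonglongrightarrow> 1 - 0"
    unfolding r_def by (intro tendsto_diff tendsto_const LIMSEQ_Suc[OF lim_1_over_n])
  then have r1: "r \<longlonglongrightarrow> 1" by simp
  have ev: "\<forall>\<^sub>F n in sequentially. r n \<in> cball 0 1" using rn by (auto intro!: always_eventually less_imp_le)
  have "(\<lambda>n. f (r n)) \<longlonglongrightarrow> f 1"
    unfolding f_def by (rule continuous_on_tendsto_compose[OF continuous_on_cball_powser[OF sZ] r1 _ ev]) simp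
  moreover have "(\<lambda>n. g (r n)) \<longlonglongrightarrow> g 1"
    unfolding g_def by (rule continuous_on_tendsto_compose[OF continuous_on_cball_powser[OF sC] r1 _ ev]) simp
  then have "(\<lambda>n. f (r n)) \<longlonglongrightarrow> exp (g 1)"
    using fg[OF rn] by (simp add: tendsto_exp)
  ultimately have "f 1 = exp (g 1)" by (rule LIMSEQ_unique)
  moreover have "g 1 = (\<Sum>n. c (Suc n))"
    unfolding g_def using suminf_split_head[OF summable_norm_cancel[OF sC]] by (simp add: CS) (simp add: C_def)
  moreover have "Z sums f 1"
    unfolding f_def using summable_norm_cancel[OF sZ] by (simp add: summable_sums)
  ultimately show ?thesis by simp
qed

context sigma_finite_measure
begin

lemma integral_PiM_bij:
  fixes f g :: "(nat \<Rightarrow> 'a) \<Rightarrow> complex" and I J :: "nat set"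
  assumes I: "finite I" "bij_betw p I J" and f: "integrable (PiM I (\<lambda>_. M)) f"
    and g: "\<And>x. g x = f (\<lambda>i\<in>I. x (p i))"
  shows "integrable (PiM J (\<lambda>_. M)) g \<and> integral\<^sup>L (PiM J (\<lambda>_. M)) g = integral\<^sup>L (PiM I (\<lambda>_. M)) f"
proof -
  note m = measurable_PiM_bij[OF I(2)]
  have fm: "f \<in> borel_measurable (PiM I (\<lambda>_. M))" using f by auto
  have geq: "g = (\<lambda>x. f (\<lambda>i\<in>I. x (p i)))" using g by auto
  show ?thesis
    unfolding geq using integrable_distr_eq[OF m fm] integral_distr[OF m fm] f
    unfolding distr_PiM_bij[OF I] by simp
qed

text \<open>The integrands are functions of whole configurations that look only at the coordinates
  in \<open>K\<close> or in \<open>L\<close>, so products of cluster functions can be written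
  without restrictions.\<close>

lemma integral_PiM_mult:
  fixes f g :: "(nat \<Rightarrow> 'a) \<Rightarrow> complex" and K L :: "nat set"
  assumes KL: "finite K" "finite L" "K \<inter> L = {}"
    and f: "integrable (PiM K (\<lambda>_. M)) f" "\<And>x x'. (\<And>i. i \<in> K \<Longrightarrow> x i = x' i) \<Longrightarrow> f x = f x'"
    and g: "integrable (PiM L (\<lambda>_. M)) g" "\<And>x x'. (\<And>i. i \<in> L \<Longrightarrow> x i = x' i) \<Longrightarrow> g x = g x'"
  shows "integrable (PiM (K \<union> L) (\<lambda>_. M)) (\<lambda>x. f x * g x) \<and>
    (\<integral>x. f x * g x \<partial>PiM (K \<union> L) (\<lambda>_. M)) = (\<integral>x. f x \<partial>PiM K (\<lambda>_. M)) * (\<integral>x. g x \<partial>PiM L (\<lambda>_. M))"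
proof -
  interpret I: product_sigma_finite "\<lambda>_::nat. M" by (rule product_sigma_finite_const)
  have fm[measurable]: "f \<in> borel_measurable (PiM K (\<lambda>_. M))" and gm[measurable]: "g \<in> borel_measurable (PiM L (\<lambda>_. M))"
    using f g by auto
  have fr: "f x = f (restrict x K)" and gr: "g x = g (restrict x L)" for x
    by (intro f(2) g(2); simp)+
  have "(\<lambda>x. f (restrict x K)) \<in> borel_measurable (PiM (K \<union> L) (\<lambda>_. M))"
    by (intro measurable_compose[OF measurable_restrict_subset fm]) auto
  then have fm': "f \<in> borel_measurable (PiM (K \<union> L) (\<lambda>_. M))" by (simp flip: fr)
  have "(\<lambda>x. g (restrict x L)) \<in> borel_measurable (PiM (K \<union> L) (\<lambda>_. M))"
    by (intro measurable_compose[OF measurable_restrict_subset gm]) auto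
  then have gm': "g \<in> borel_measurable (PiM (K \<union> L) (\<lambda>_. M))" by (simp flip: gr)
  have fx: "f (merge K L (x, y)) = f x" and gx: "g (merge K L (x, y)) = g y" for x y
    using KL by (auto intro!: f(2) g(2) simp: merge_def)
  have int: "integrable (PiM (K \<union> L) (\<lambda>_. M)) (\<lambda>x. f x * g x)"
  proof (rule integrableI_bounded)
    show "(\<lambda>x. f x * g x) \<in> borel_measurable (PiM (K \<union> L) (\<lambda>_. M))" using fm' gm' by (rule borel_measurable_times)
    then have nm: "(\<lambda>x. ennreal (norm (f x * g x))) \<in> borel_measurable (PiM (K \<union> L) (\<lambda>_. M))" by measurable
    have "(\<integral>\<^sup>+x. ennreal (norm (f x * g x)) \<partial>PiM (K \<union> L) (\<lambda>_. M))
       = (\<integral>\<^sup>+x. (\<integral>\<^sup>+y. ennreal (norm (f x)) * ennreal (norm (g y)) \<partial>PiM L (\<lambda>_. M)) \<partial>PiM K (\<lambda>_. M))"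
      by (subst I.product_nn_integral_fold[OF KL(3,1,2) nm]) (simp add: fx gx norm_mult ennreal_mult')
    also have "\<dots> = (\<integral>\<^sup>+x. ennreal (norm (f x)) \<partial>PiM K (\<lambda>_. M)) * (\<integral>\<^sup>+y. ennreal (norm (g y)) \<partial>PiM L (\<lambda>_. M))"
      by (simp add: nn_integral_cmult nn_integral_multc)
    also have "\<dots> < \<infinity>"
      using f(1) g(1) by (auto simp: integrable_iff_bounded ennreal_mult_less_top)
    finally show "(\<integral>\<^sup>+x. ennreal (norm (f x * g x)) \<partial>PiM (K \<union> L) (\<lambda>_. M)) < \<infinity>" .
  qed
  then show ?thesis
    using I.product_integral_fold[OF KL(3,1,2) int] by (simp add: fx gx)
qed

text \<open>The density \<open>h\<close> factorizes over vertices and therefore follows the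
  splitting of the graphs. The integrals depend only on the number of vertices, and
  \<open>n choose k\<close> counts the components of vertex 1 that have \<open>k\<close> other
  members.\<close>

lemma boltz_integral_recursion:
  fixes z :: "'a \<Rightarrow> 'a \<Rightarrow> complex" and h :: "'a \<Rightarrow> complex"
  assumes zsym: "\<And>x y. z x y = z y x"
  defines "gz \<equiv> \<lambda>V x. (\<Prod>i\<in>V. h (x i)) * boltz (edge_weight z x) V"
    and "gc \<equiv> \<lambda>V x. (\<Prod>i\<in>V. h (x i)) * conn (edge_weight z x) V"
  assumes Iz: "\<And>n. integrable (PiM {1..n} (\<lambda>_. M)) (gz {1..n})"
    and Ic: "\<And>n. integrable (PiM {1..Suc n} (\<lambda>_. M)) (gc {1..Suc n})"
  defines "Iz \<equiv> \<lambda>n. \<integral>x. gz {1..n} x \<partial>PiM {1..n} (\<lambda>_. M)"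
    and "Ic \<equiv> \<lambda>n. \<integral>x. gc {1..n} x \<partial>PiM {1..n} (\<lambda>_. M)"
  shows "Iz (Suc n) = (\<Sum>k\<le>n. of_nat (n choose k) * (Ic (Suc k) * Iz (n - k)))"
proof -
  have hcong: "(\<Prod>i\<in>{1..card V}. h ((\<lambda>i\<in>{1..card V}. x (p i)) i)) = (\<Prod>i\<in>V. h (x i))"
    if p: "bij_betw p {1..card V} V" for V :: "nat set" and p x
  proof -
    have "(\<Prod>i\<in>{1..card V}. h ((\<lambda>i\<in>{1..card V}. x (p i)) i)) = (\<Prod>i\<in>{1..card V}. h (x (p i)))"
      by (intro prod.cong) auto
    then show ?thesis using prod.reindex_bij_betw[OF p, of "\<lambda>i. h (x i)"] by simp
  qed
  have econg: "edge_weight z (\<lambda>i\<in>{1..card V}. x (p i)) e = edge_weight z x (p ` e)"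
    if "e \<in> edges {1..card V}" for V :: "nat set" and p x e
    using edge_weight_image[of z e "{1..card V}" "\<lambda>i\<in>{1..card V}. x (p i)" x p] zsym that by simp
  have Z: "integrable (PiM V (\<lambda>_. M)) (gz V) \<and> (\<integral>x. gz V x \<partial>PiM V (\<lambda>_. M)) = Iz (card V)" if V: "finite V" for V
  proof -
    obtain p where p: "bij_betw p {1..card V} V" using ex_bij_betw_nat_finite_1[OF V] by blast
    have inj: "inj_on p {1..card V}" and img: "p ` {1..card V} = V" using p by (auto simp: bij_betw_def)
    have "gz V x = gz {1..card V} (\<lambda>i\<in>{1..card V}. x (p i))" for x
    proof -
      have "boltz (edge_weight z (\<lambda>i\<in>{1..card V}. x (p i))) {1..card V} = boltz (\<lambda>e. edge_weight z x (p ` e)) {1..card V}"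
        by (intro boltz_cong econg)
      also have "\<dots> = boltz (edge_weight z x) V" using boltz_image[OF inj, of "edge_weight z x"] img by simp
      finally show ?thesis unfolding gz_def hcong[OF p] by simp
    qed
    from integral_PiM_bij[OF _ p Iz this] show ?thesis by (simp add: Iz_def)
  qed
  have C: "integrable (PiM V (\<lambda>_. M)) (gc V) \<and> (\<integral>x. gc V x \<partial>PiM V (\<lambda>_. M)) = Ic (card V)"
    if V: "finite V" "V \<noteq> {}" for V
  proof -
    obtain p where p: "bij_betw p {1..card V} V" using ex_bij_betw_nat_finite_1[OF V(1)] by blast
    have inj: "inj_on p {1..card V}" and img: "p ` {1..card V} = V" using p by (auto simp: bij_betw_def)
    obtain m where m: "card V = Suc m" using V by (metis card_eq_0_iff not0_implies_Suc)
    have "gc V x = gc {1..card V} (\<lambda>i\<in>{1..card V}. x (p i))" for x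
    proof -
      have "conn (edge_weight z (\<lambda>i\<in>{1..card V}. x (p i))) {1..card V} = conn (\<lambda>e. edge_weight z x (p ` e)) {1..card V}"
        by (intro conn_cong econg)
      also have "\<dots> = conn (edge_weight z x) V" using conn_image[OF _ _ inj, of 1 "edge_weight z x"] img m by simp
      finally show ?thesis unfolding gc_def hcong[OF p] by simp
    qed
    moreover have "integrable (PiM {1..card V} (\<lambda>_. M)) (gc {1..card V})" using Ic[of m] m by simp
    ultimately show ?thesis
      using integral_PiM_bij[of "{1..card V}" p V "gc {1..card V}" "gc V"] p unfolding Ic_def by blast
  qed
  have zc: "gz V x = gz V x'" "gc V x = gc V x'" if "\<And>i. i \<in> V \<Longrightarrow> x i = x' i" for V and x x' :: "nat \<Rightarrow> 'a"
  proof -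
    have e: "edge_weight z x e = edge_weight z x' e" if "e \<in> edges V" for e
      using edge_weight_cong[of z e V x x'] zsym that \<open>\<And>i. i \<in> V \<Longrightarrow> x i = x' i\<close> by blast
    have "(\<Prod>i\<in>V. h (x i)) = (\<Prod>i\<in>V. h (x' i))" using that by (intro prod.cong) auto
    then show "gz V x = gz V x'" "gc V x = gc V x'"
      unfolding gz_def gc_def using boltz_cong[of V "edge_weight z x" "edge_weight z x'", OF e]
        conn_cong[of V "edge_weight z x" "edge_weight z x'", OF e] by auto
  qed
  let ?V = "{1..Suc n}"
  have "gz ?V x = (\<Sum>K\<in>subs 1 ?V. gc K x * gz (?V - K) x)" for x
  proof -
    have "(\<Prod>i\<in>?V. h (x i)) * (conn (edge_weight z x) K * boltz (edge_weight z x) (?V - K)) = gc K x * gz (?V - K) x"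
      if "K \<in> subs 1 ?V" for K
    proof -
      have "(\<Prod>i\<in>?V. h (x i)) = (\<Prod>i\<in>?V - K. h (x i)) * (\<Prod>i\<in>K. h (x i))"
        using that by (intro prod.subset_diff) (auto simp: subs_def)
      then show ?thesis by (simp add: gc_def gz_def mult_ac)
    qed
    moreover have "gz ?V x = (\<Prod>i\<in>?V. h (x i)) *
        (\<Sum>K\<in>subs 1 ?V. conn (edge_weight z x) K * boltz (edge_weight z x) (?V - K))"
      unfolding gz_def by (subst boltz_conn[of _ 1]) simp_all
    ultimately show ?thesis by (simp only: sum_distrib_left) (intro sum.cong; simp)
  qed
  then have "Iz (Suc n) = (\<integral>x. (\<Sum>K\<in>subs 1 ?V. gc K x * gz (?V - K) x) \<partial>PiM ?V (\<lambda>_. M))"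
    unfolding Iz_def by (intro Bochner_Integration.integral_cong refl)
  also have "\<dots> = (\<Sum>K\<in>subs 1 ?V. Ic (card K) * Iz (Suc n - card K))"
  proof -
    have *: "integrable (PiM ?V (\<lambda>_. M)) (\<lambda>x. gc K x * gz (?V - K) x) \<and>
       (\<integral>x. gc K x * gz (?V - K) x \<partial>PiM ?V (\<lambda>_. M)) = Ic (card K) * Iz (Suc n - card K)" if K: "K \<in> subs 1 ?V" for K
    proof -
      have K': "finite K" "K \<noteq> {}" "finite (?V - K)" "K \<inter> (?V - K) = {}" "K \<union> (?V - K) = ?V" "K \<subseteq> ?V"
        using K by (auto simp: subs_def intro: finite_subset)
      have "card (?V - K) = Suc n - card K" using K' by (simp add: card_Diff_subset)
      then show ?thesis
        using integral_PiM_mult[OF K'(1,3,4) conjunct1[OF C[OF K'(1,2)]] zc(2) conjunct1[OF Z[OF K'(3)]] zc(1)]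
          C[OF K'(1,2)] Z[OF K'(3)]
        unfolding K'(5) by simp
    qed
    then show ?thesis by (subst Bochner_Integration.integral_sum) auto
  qed
  also have "\<dots> = (\<Sum>K\<in>Pow {2..Suc n}. Ic (Suc (card K)) * Iz (n - card K))"
  proof (rule sum.reindex_bij_witness[where i = "insert 1" and j = "\<lambda>K. K - {1}"])
    fix K assume K: "K \<in> subs 1 ?V"
    then have "finite K" "1 \<in> K" by (auto simp: subs_def intro: finite_subset)
    then have "card K = Suc (card (K - {1}))" by (rule card.remove)
    then show "Ic (Suc (card (K - {1}))) * Iz (n - card (K - {1})) = Ic (card K) * Iz (Suc n - card K)" by simp
    have "?V - {1} = {2..Suc n}" by auto
    then show "K - {1} \<in> Pow {2..Suc n}" using K unfolding subs_def by blast
  qed (auto simp: subs_def)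
  also have "\<dots> = (\<Sum>k\<le>n. of_nat (n choose k) * (Ic (Suc k) * Iz (n - k)))"
    using sum_Pow_card[of "{2..Suc n}" "\<lambda>k. Ic (Suc k) * Iz (n - k)"] by simp
  finally show ?thesis .
qed

end

context sigma_finite_measure
begin

lemma sums_Zterm_exp_cluster:
  fixes z :: "'a \<Rightarrow> 'a \<Rightarrow> complex" and h :: "'a \<Rightarrow> complex" and b :: "'a \<Rightarrow> real"
  assumes h[measurable]: "h \<in> borel_measurable M" and h1: "\<And>x. x \<in> space M \<Longrightarrow> norm (h x) = 1"
    and z: "(\<lambda>(x, y). z x y) \<in> borel_measurable (M \<Otimes>\<^sub>M M)" "\<And>x y. z x y = z y x"
    and b[measurable]: "b \<in> borel_measurable M" and bfin: "(\<integral>\<^sup>+x. ennreal (exp (b x)) \<partial>M) < \<infinity>"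
    and stab: "\<And>n. AE x in PiM {1..n} (\<lambda>_. M).
        (\<Prod>e\<in>edges {1..n}. norm (1 + edge_weight z x e)) \<le> (\<Prod>i\<in>{1..n}. exp (b (x i)))"
    and fin: "(\<Sum>n. \<integral>\<^sup>+ x. ennreal (norm (phi z (Suc n) x)) \<partial>(PiM {1..Suc n} (\<lambda>_. M))) < \<infinity>"
  shows "Zterm M h z sums exp (\<Sum>n. cluster_term M h z (Suc n))"
proof -
  interpret I: product_sigma_finite "\<lambda>_::nat. M" by (rule product_sigma_finite_const)
  define gz where "gz = (\<lambda>V x. (\<Prod>i\<in>V. h (x i)) * boltz (edge_weight z x) V)"
  define gc where "gc = (\<lambda>V x. (\<Prod>i\<in>V. h (x i)) * conn (edge_weight z x) V)"
  define Iz where "Iz = (\<lambda>n. \<integral>x. gz {1..n} x \<partial>PiM {1..n} (\<lambda>_. M))"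
  define Ic where "Ic = (\<lambda>n. \<integral>x. gc {1..n} x \<partial>PiM {1..n} (\<lambda>_. M))"
  define B where "B = enn2real (\<integral>\<^sup>+x. ennreal (exp (b x)) \<partial>M)"
  have B: "(\<integral>\<^sup>+x. ennreal (exp (b x)) \<partial>M) = ennreal B" "0 \<le> B" using bfin by (auto simp: B_def)
  have hm: "(\<lambda>x. \<Prod>i\<in>{1..n}. h (x i)) \<in> borel_measurable (PiM {1..n} (\<lambda>_. M))" for n :: nat
    by measurable
  have norm_h: "norm (\<Prod>i\<in>{1..n}. h (x i)) = 1" if "x \<in> space (PiM {1..n} (\<lambda>_. M))" for n :: nat and x
  proof -
    have "norm (h (x i)) = 1" if "i \<in> {1..n}" for i
      using that \<open>x \<in> _\<close> by (intro h1) (auto simp: space_PiM)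
    then show ?thesis by (simp add: prod_norm[symmetric])
  qed
  have gz_meas: "gz {1..n} \<in> borel_measurable (PiM {1..n} (\<lambda>_. M))" for n
    unfolding gz_def by (intro borel_measurable_times hm measurable_boltz[OF z] measurable_component_singleton)
  have gc_meas: "gc {1..n} \<in> borel_measurable (PiM {1..n} (\<lambda>_. M))" for n
    unfolding gc_def by (intro borel_measurable_times hm measurable_conn[OF z] measurable_component_singleton)
  \<comment> \<open>Stability makes the integrand at most a product of one-point functions, so the
    series for \<open>Z\<close> is dominated by that of \<open>exp B\<close>.\<close>
  have gz_bound: "(\<integral>\<^sup>+x. ennreal (norm (gz {1..n} x)) \<partial>PiM {1..n} (\<lambda>_. M)) \<le> ennreal (B ^ n)" for n
  proof -
    have "(\<integral>\<^sup>+x. ennreal (norm (gz {1..n} x)) \<partial>PiM {1..n} (\<lambda>_. M)) \<le>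
       (\<integral>\<^sup>+x. (\<Prod>i\<in>{1..n}. ennreal (exp (b (x i)))) \<partial>PiM {1..n} (\<lambda>_. M))"
    proof (rule nn_integral_mono_AE)
      show "AE x in PiM {1..n} (\<lambda>_. M). ennreal (norm (gz {1..n} x)) \<le> (\<Prod>i\<in>{1..n}. ennreal (exp (b (x i))))"
        using stab[of n] AE_space
      proof eventually_elim
        case (elim x)
        then have "norm (gz {1..n} x) \<le> (\<Prod>i\<in>{1..n}. exp (b (x i)))"
          using norm_h[of x n] by (simp add: gz_def norm_mult boltz_def prod_norm[symmetric])
        then show ?case by (subst prod_ennreal) (auto intro: ennreal_leI)
      qed
    qed
    also have "\<dots> = (\<Prod>i\<in>{1..n}. \<integral>\<^sup>+x. ennreal (exp (b x)) \<partial>M)"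
      by (intro I.product_nn_integral_prod) auto
    also have "\<dots> = ennreal (B ^ n)" using B by (simp add: ennreal_power)
    finally show ?thesis .
  qed
  have Iz: "integrable (PiM {1..n} (\<lambda>_. M)) (gz {1..n})" for n
    using gz_meas gz_bound[of n] by (intro integrableI_bounded) (auto simp: less_top[symmetric] top_unique intro: le_less_trans)
  have gc_phi: "norm (gc {1..Suc n} x) = fact (Suc n) * norm (phi z (Suc n) x)"
    if "x \<in> space (PiM {1..Suc n} (\<lambda>_. M))" for n x
  proof -
    have "norm (phi z (Suc n) x) = norm (conn (edge_weight z x) {1..Suc n}) / fact (Suc n)"
      by (subst phi_eq_conn) (simp, simp only: norm_divide norm_fact)
    then show ?thesis using norm_h[OF that] by (simp add: gc_def norm_mult del: fact_Suc)
  qed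
  have phi_fin: "(\<integral>\<^sup>+ x. ennreal (norm (phi z (Suc n) x)) \<partial>(PiM {1..Suc n} (\<lambda>_. M))) < \<infinity>" for n
    using ennreal_suminf_lessD[OF fin] .
  have gc_nn: "(\<integral>\<^sup>+x. ennreal (norm (gc {1..Suc n} x)) \<partial>PiM {1..Suc n} (\<lambda>_. M))
     = ennreal (fact (Suc n)) * (\<integral>\<^sup>+ x. ennreal (norm (phi z (Suc n) x)) \<partial>(PiM {1..Suc n} (\<lambda>_. M)))" for n
  proof -
    have "(\<integral>\<^sup>+x. ennreal (norm (gc {1..Suc n} x)) \<partial>PiM {1..Suc n} (\<lambda>_. M))
      = (\<integral>\<^sup>+x. ennreal (fact (Suc n)) * ennreal (norm (phi z (Suc n) x)) \<partial>PiM {1..Suc n} (\<lambda>_. M))"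
      using gc_phi by (intro nn_integral_cong) (simp add: ennreal_mult' del: fact_Suc)
    also have "\<dots> = ennreal (fact (Suc n)) * (\<integral>\<^sup>+ x. ennreal (norm (phi z (Suc n) x)) \<partial>(PiM {1..Suc n} (\<lambda>_. M)))"
    proof (rule nn_integral_cmult)
      have "phi z (Suc n) \<in> borel_measurable (PiM {1..Suc n} (\<lambda>_. M))" by (rule measurable_phi[OF z]) simp
      then show "(\<lambda>x. ennreal (norm (phi z (Suc n) x))) \<in> borel_measurable (PiM {1..Suc n} (\<lambda>_. M))" by measurable
    qed
    finally show ?thesis .
  qed
  have Ic: "integrable (PiM {1..Suc n} (\<lambda>_. M)) (gc {1..Suc n})" for n
  proof (rule integrableI_bounded[OF gc_meas])
    show "(\<integral>\<^sup>+x. ennreal (norm (gc {1..Suc n} x)) \<partial>PiM {1..Suc n} (\<lambda>_. M)) < \<infinity>"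
      unfolding gc_nn using phi_fin[of n] by (simp add: ennreal_mult_less_top del: fact_Suc)
  qed
  have rec: "Iz (Suc n) = (\<Sum>k\<le>n. of_nat (n choose k) * (Ic (Suc k) * Iz (n - k)))" for n
    using boltz_integral_recursion[where z = z and h = h and n = n, OF z(2)] Iz Ic unfolding gz_def gc_def Iz_def Ic_def by simp
  have Zt: "Zterm M h z n = Iz n / fact n" for n
    unfolding Zterm_def Iz_def gz_def boltz_def using prod_pairs_edge_weight[where z = z and F = "\<lambda>c. 1 + c" and n = n] z(2) by simp
  have Ct: "cluster_term M h z (Suc n) = Ic (Suc n) / fact (Suc n)" for n
  proof -
    have "(\<Prod>i\<in>{1..Suc n}. h (x i)) * phi z (Suc n) x = gc {1..Suc n} x / fact (Suc n)" for x
      by (subst phi_eq_conn) (simp_all add: gc_def del: fact_Suc)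
    then show ?thesis unfolding cluster_term_def Ic_def by (simp del: fact_Suc)
  qed
  show ?thesis
  proof (rule sums_exp_of_recursion)
    have "Iz 0 = 1"
      using I.product_integral_prod[of "{}" "\<lambda>_ _. 1 :: complex"] by (simp add: Iz_def gz_def)
    then show "Zterm M h z 0 = 1" by (simp add: Zt)
    fix n
    have "of_nat (Suc n) * Zterm M h z (Suc n) = Iz (Suc n) / fact n"
      unfolding Zt fact_Suc by (simp del: of_nat_Suc)
    also have "\<dots> = (\<Sum>k\<le>n. of_nat (Suc k) * cluster_term M h z (Suc k) * Zterm M h z (n - k))"
      unfolding rec sum_divide_distrib
    proof (intro sum.cong refl)
      fix k assume "k \<in> {..n}"
      \<comment> \<open>The binomial coefficient distributes the factorials: \<open>k!\<close> goes
        to the cluster term, where it is \<open>(k + 1)!\<close> without its factor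
        \<open>k + 1\<close>, and \<open>(n - k)!\<close> to the remaining partition
        function.\<close>
      then have "of_nat (n choose k) = (fact n / (fact k * fact (n - k)) :: complex)"
        by (simp add: binomial_fact)
      moreover have "of_nat (Suc k) * cluster_term M h z (Suc k) = Ic (Suc k) / fact k"
        unfolding Ct fact_Suc by (simp del: of_nat_Suc)
      ultimately show "of_nat (n choose k) * (Ic (Suc k) * Iz (n - k)) / fact n =
         of_nat (Suc k) * cluster_term M h z (Suc k) * Zterm M h z (n - k)"
        by (simp add: Zt)
    qed
    finally show "of_nat (Suc n) * Zterm M h z (Suc n) = (\<Sum>k\<le>n. of_nat (Suc k) * cluster_term M h z (Suc k) * Zterm M h z (n - k))" .
  next
    show "summable (\<lambda>n. norm (Zterm M h z n))"
    proof (rule summable_comparison_test'[OF summable_exp[of B]])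
      fix n
      have "ennreal (norm (Iz n)) \<le> ennreal (B ^ n)"
        unfolding Iz_def by (rule order.trans[OF integral_norm_bound_ennreal[OF Iz] gz_bound])
      then have "norm (Iz n) \<le> B ^ n" using B by (simp add: ennreal_le_iff)
      then show "norm (norm (Zterm M h z n)) \<le> inverse (fact n) * B ^ n"
        by (simp add: Zt norm_divide field_simps)
    qed
    show "summable (\<lambda>n. norm (cluster_term M h z (Suc n)))"
    proof (rule summable_suminf_not_top)
      have "ennreal (norm (cluster_term M h z (Suc n))) \<le> (\<integral>\<^sup>+ x. ennreal (norm (phi z (Suc n) x)) \<partial>(PiM {1..Suc n} (\<lambda>_. M)))" for n
      proof -
        have "ennreal (norm (Ic (Suc n))) \<le> ennreal (fact (Suc n)) * (\<integral>\<^sup>+ x. ennreal (norm (phi z (Suc n) x)) \<partial>(PiM {1..Suc n} (\<lambda>_. M)))"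
          unfolding Ic_def gc_nn[symmetric] by (rule integral_norm_bound_ennreal[OF Ic])
        moreover have "norm (cluster_term M h z (Suc n)) = (1 / fact (Suc n)) * norm (Ic (Suc n))"
          unfolding Ct by (simp only: norm_divide norm_fact) simp
        then have "ennreal (norm (cluster_term M h z (Suc n))) = ennreal (1 / fact (Suc n)) * ennreal (norm (Ic (Suc n)))"
          by (simp only: ennreal_mult' norm_ge_zero zero_le_divide_1_iff fact_ge_zero)
        ultimately have "ennreal (norm (cluster_term M h z (Suc n))) \<le> ennreal (1 / fact (Suc n)) *
            (ennreal (fact (Suc n)) * (\<integral>\<^sup>+ x. ennreal (norm (phi z (Suc n) x)) \<partial>(PiM {1..Suc n} (\<lambda>_. M))))"
          by (simp only: mult_left_mono zero_le)
        also have "\<dots> = (\<integral>\<^sup>+ x. ennreal (norm (phi z (Suc n) x)) \<partial>(PiM {1..Suc n} (\<lambda>_. M)))"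
          by (simp add: mult.assoc[symmetric] ennreal_mult'[symmetric] del: fact_Suc)
        finally show ?thesis .
      qed
      then have "(\<Sum>n. ennreal (norm (cluster_term M h z (Suc n)))) \<le>
          (\<Sum>n. \<integral>\<^sup>+ x. ennreal (norm (phi z (Suc n) x)) \<partial>(PiM {1..Suc n} (\<lambda>_. M)))"
        by (intro suminf_le) auto
      then show "(\<Sum>n. ennreal (norm (cluster_term M h z (Suc n)))) \<noteq> top"
        using fin by (auto simp: top_unique)
    qed simp
  qed
qed

end

theorem mainTheorem1:
  fixes M :: "'a measure" and h :: "'a \<Rightarrow> complex"
    and u :: "'a \<Rightarrow> 'a \<Rightarrow> complex" and hc :: "'a \<Rightarrow> 'a \<Rightarrow> bool"
    and a b :: "'a \<Rightarrow> real"
  assumes h_meas: "h \<in> borel_measurable M"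
    and h_norm: "\<forall>x\<in>space M. norm (h x) = 1"
    and u_meas: "(\<lambda>(x, y). u x y) \<in> borel_measurable (M \<Otimes>\<^sub>M M)"
    and hc_meas: "(\<lambda>(x, y). hc x y) \<in> measurable (M \<Otimes>\<^sub>M M) (count_space UNIV)"
    and u_sym: "\<forall>x y. u x y = u y x"
    and hc_sym: "\<forall>x y. hc x y = hc y x"
    and a_meas: "a \<in> borel_measurable M" and b_meas: "b \<in> borel_measurable M"
    and a_nonneg: "\<forall>x\<in>space M. 0 \<le> a x" and b_nonneg: "\<forall>x\<in>space M. 0 \<le> b x"
    and stability: "\<forall>n::nat. AE x in PiM {1..n} (\<lambda>_. M).
        (\<Prod>i\<in>{1..n}. \<Prod>j\<in>{i<..n}. norm (1 + zeta u hc (x i) (x j)))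
          \<le> (\<Prod>i\<in>{1..n}. exp (b (x i)))"
    and A2_or_A2': "(AE x in M. (\<integral>\<^sup>+ y. ennreal (norm (zeta u hc x y) * exp (a y + 2 * b y)) \<partial>M)
                        \<le> ennreal (a x))
                  \<or> (AE x in M. (\<integral>\<^sup>+ y. ennreal (norm (ubar u hc x y) * exp (a y + b y)) \<partial>M)
                        \<le> ennreal (a x))"
    and finite_int: "(\<integral>\<^sup>+ y. ennreal (exp (a y + 2 * b y)) \<partial>M) < \<infinity>"
  shows "(\<Sum>n. \<integral>\<^sup>+ x. ennreal (norm (phi (zeta u hc) (Suc n) x)) \<partial>(PiM {1..Suc n} (\<lambda>_. M))) < \<infinity>
    \<and> Zterm M h (zeta u hc) sums exp (\<Sum>n. cluster_term M h (zeta u hc) (Suc n))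
    \<and> ((AE x in M. (\<integral>\<^sup>+ y. ennreal (norm (zeta u hc x y) * exp (a y + 2 * b y)) \<partial>M)
                        \<le> ennreal (a x)) \<longrightarrow>
         (AE x1 in M. (\<Sum>n. \<integral>\<^sup>+ x. ennreal (real (n + 2) * norm (phi (zeta u hc) (n + 2) (x(1 := x1))))
                  \<partial>(PiM {2..n + 2} (\<lambda>_. M)))
            \<le> ennreal ((exp (a x1) - 1) * exp (2 * b x1))))
    \<and> ((AE x in M. (\<integral>\<^sup>+ y. ennreal (norm (ubar u hc x y) * exp (a y + b y)) \<partial>M)
                        \<le> ennreal (a x)) \<longrightarrow>
         (AE x1 in M. (\<Sum>n. \<integral>\<^sup>+ x. ennreal (real (n + 2) * norm (phi (zeta u hc) (n + 2) (x(1 := x1))))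
                  \<partial>(PiM {2..n + 2} (\<lambda>_. M)))
            \<le> ennreal ((exp (a x1) - 1) * exp (b x1))))"
proof -
  let ?z = "zeta u hc"
  have zsym: "?z x y = ?z y x" and usym: "ubar u hc x y = ubar u hc y x" for x y
    using u_sym hc_sym by (metis zeta_def, metis ubar_def)
  have [measurable]: "Measurable.pred (M \<Otimes>\<^sub>M M) (\<lambda>p. hc (fst p) (snd p))"
    "(\<lambda>p. u (fst p) (snd p)) \<in> borel_measurable (M \<Otimes>\<^sub>M M)"
    using hc_meas u_meas by (simp_all add: split_beta')
  have zm: "(\<lambda>(x, y). ?z x y) \<in> borel_measurable (M \<Otimes>\<^sub>M M)"
    unfolding zeta_def split_beta' by measurable
  have um: "(\<lambda>(x, y). ubar u hc x y) \<in> borel_measurable (M \<Otimes>\<^sub>M M)"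
    unfolding ubar_def split_beta' by measurable
  note a_meas[measurable] b_meas[measurable]
  \<comment> \<open>The exponent is nonnegative, so the integrand is at least 1 and \<open>M\<close>
    has finite mass; this also makes the lemmas on sigma-finite measures available.\<close>
  have fin: "emeasure M (space M) < \<infinity>"
  proof -
    have "emeasure M (space M) = (\<integral>\<^sup>+ y. 1 \<partial>M)" by simp
    also have "\<dots> \<le> (\<integral>\<^sup>+ y. ennreal (exp (a y + 2 * b y)) \<partial>M)"
      using a_nonneg b_nonneg by (intro nn_integral_mono) (simp add: one_le_exp_iff flip: ennreal_1)
    also note finite_int
    finally show ?thesis .
  qed
  interpret finite_measure M using fin by (intro finite_measureI) auto
  have stab: "AE x in PiM {1..n} (\<lambda>_. M).
        (\<Prod>e\<in>edges {1..n}. norm (1 + edge_weight ?z x e)) \<le> (\<Prod>i\<in>{1..n}. exp (b (x i)))" for n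
    using stability unfolding prod_pairs_edge_weight[where z = ?z and F = "\<lambda>c. norm (1 + c)", OF zsym] by blast
  note sub = AE_stable_subsets[of ?z b, OF zsym stab]
  have treeA: "AE x in PiM {1..n} (\<lambda>_. M). norm (conn (edge_weight ?z x) {1..n}) \<le>
      (\<Prod>i\<in>{1..n}. exp (2 * b (x i))) * forest (edge_weight (\<lambda>x y. norm (?z x y)) x) {1} ({1..n} - {1})"
    if "n \<ge> 1" for n
    using sub[of n]
  proof eventually_elim
    case (elim x)
    have 1: "{1} \<union> ({1..n} - {1}) = {1..n}" "1 \<in> {1..n}" using that by auto
    have "norm (ursell (edge_weight ?z x) {1} ({1..n} - {1})) \<le> (\<Prod>i\<in>{1} \<union> ({1..n} - {1}). exp (2 * b (x i))) *
       forest (\<lambda>e. norm (edge_weight ?z x e)) {1} ({1..n} - {1})"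
    proof (rule norm_ursell_le_forest)
      fix A' :: "nat set" assume "A' \<subseteq> {1} \<union> ({1..n} - {1})"
      then show "(\<Prod>e\<in>edges A'. norm (1 + edge_weight ?z x e)) \<le> (\<Prod>i\<in>A'. exp (b (x i)))"
        using elim unfolding 1(1) by blast
    qed auto
    then show ?case unfolding 1(1) ursell_conn[OF 1(2)] norm_edge_weight .
  qed
  have treeB: "AE x in PiM {1..n} (\<lambda>_. M). norm (conn (edge_weight ?z x) {1..n}) \<le>
      (\<Prod>i\<in>{1..n}. exp (b (x i))) * forest (edge_weight (\<lambda>x y. norm (ubar u hc x y)) x) {1} ({1..n} - {1})"
    if "n \<ge> 1" for n
    using sub[of n] AE_space
  proof eventually_elim
    case (elim x)
    \<comment> \<open>For a fixed configuration the hard-core predicate becomes a set of edges, as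
      the deterministic bound expects.\<close>
    let ?H = "{e. edge_weight hc x e}"
    have z: "edge_weight ?z x = (\<lambda>e. if e \<in> ?H then -1 else exp (- edge_weight u x e) - 1)"
      by (auto simp: edge_weight_def zeta_def)
    have ub: "edge_weight (\<lambda>x y. norm (ubar u hc x y)) x = (\<lambda>e. norm (if e \<in> ?H then 1 else edge_weight u x e))"
      by (auto simp: edge_weight_def ubar_def)
    have "0 \<le> b (x i)" if "i \<in> {1..n}" for i
      using that elim(2) b_nonneg by (auto simp: space_PiM)
    then show ?case
      unfolding z ub using that elim(1) by (intro norm_conn_le_forest) (auto simp: z)
  qed
  have exA: "norm c * exp (2 * b y) * exp (a y) = norm c * exp (a y + 2 * b y)" for c :: complex and y
    by (simp add: exp_add mult_ac)
  have exB: "norm c * exp (b y) * exp (a y) = norm c * exp (a y + b y)" for c :: complex and y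
    by (simp add: exp_add mult_ac)
  have nzm: "(\<lambda>(x, y). norm (?z x y)) \<in> borel_measurable (M \<Otimes>\<^sub>M M)"
    using measurable_compose[OF zm borel_measurable_norm] by (simp add: split_beta')
  have num: "(\<lambda>(x, y). norm (ubar u hc x y)) \<in> borel_measurable (M \<Otimes>\<^sub>M M)"
    using measurable_compose[OF um borel_measurable_norm] by (simp add: split_beta')
  let ?lhs = "\<lambda>x1. \<Sum>n. \<integral>\<^sup>+ x. ennreal (real (n + 2) * norm (phi ?z (n + 2) (x(1 := x1)))) \<partial>(PiM {2..n + 2} (\<lambda>_. M))"
  have boundA: "AE x1 in M. ?lhs x1 \<le> ennreal ((exp (a x1) - 1) * exp (2 * b x1))"
    if A2: "AE x in M. (\<integral>\<^sup>+ y. ennreal (norm (?z x y) * exp (a y + 2 * b y)) \<partial>M) \<le> ennreal (a x)"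
    using A2 a_nonneg treeA zsym
    by (intro cluster_bound[where \<tau> = "\<lambda>x y. norm (?z x y)"] nzm) (auto simp: exA)
  have boundB: "AE x1 in M. ?lhs x1 \<le> ennreal ((exp (a x1) - 1) * exp (b x1))"
    if A2': "AE x in M. (\<integral>\<^sup>+ y. ennreal (norm (ubar u hc x y) * exp (a y + b y)) \<partial>M) \<le> ennreal (a x)"
    using A2' a_nonneg treeB zsym usym
    by (intro cluster_bound[where \<tau> = "\<lambda>x y. norm (ubar u hc x y)"] num) (auto simp: exB)
  \<comment> \<open>The bound with \<open>exp (2 * b x1)\<close> holds in both cases, and it is
    dominated by the integrable function \<open>exp (a x1 + 2 * b x1)\<close>; the sharper bound is
    kept for the last claim only.\<close>
  have bound: "AE x1 in M. ?lhs x1 \<le> ennreal ((exp (a x1) - 1) * exp (2 * b x1))"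
    using A2_or_A2'
  proof
    assume "AE x in M. (\<integral>\<^sup>+ y. ennreal (norm (ubar u hc x y) * exp (a y + b y)) \<partial>M) \<le> ennreal (a x)"
    from boundB[OF this] AE_space show ?thesis
    proof eventually_elim
      case (elim x1)
      have "(exp (a x1) - 1) * exp (b x1) \<le> (exp (a x1) - 1) * exp (2 * b x1)"
        using elim(2) a_nonneg b_nonneg by (intro mult_left_mono) auto
      then show ?case using elim(1) ennreal_leI order.trans by blast
    qed
  qed (rule boundA)
  have f_fin: "(\<integral>\<^sup>+ x. ennreal ((exp (a x) - 1) * exp (2 * b x)) \<partial>M) < \<infinity>"
    by (rule le_less_trans[OF nn_integral_mono finite_int]) (auto intro!: ennreal_leI simp: exp_add)
  have sum_fin: "(\<Sum>n. \<integral>\<^sup>+ x. ennreal (norm (phi ?z (Suc n) x)) \<partial>(PiM {1..Suc n} (\<lambda>_. M))) < \<infinity>"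
    by (rule cluster_sum_finite[OF zm zsym fin bound f_fin])
  have b_fin: "(\<integral>\<^sup>+ x. ennreal (exp (b x)) \<partial>M) < \<infinity>"
    by (rule le_less_trans[OF nn_integral_mono finite_int])
      (use a_nonneg b_nonneg in \<open>auto intro!: ennreal_leI\<close>)
  have "Zterm M h ?z sums exp (\<Sum>n. cluster_term M h ?z (Suc n))"
    using h_norm by (intro sums_Zterm_exp_cluster[OF h_meas _ zm zsym b_meas b_fin stab sum_fin]) auto
  then show ?thesis using sum_fin boundA boundB by blast
qed

end
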